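(* Let $\gamma\in\mathbb R$, let the coupling constant $\alpha>0$ be arbitrary, and let $\mathcal A=\mathcal A_{\gamma,\alpha}$, $E$, $F$, $\alpha_1,\dots,\alpha_4$, the intervals $I_E,I_D,I_F$ and the conditions $(R_0)$, $(R_1)$ be as defined in the context. Then the essential spectrum of $\mathcal A$ is as follows. (i) Suppose that both $(R_0)$ and $(R_1)$ are violated. (a) If $\gamma\in(-\infty,\frac{\omega_0}{2}-\omega_1]$, then $\sigma_{\rm ess}(\mathcal A)=[\omega_0+E,2\omega_1+\gamma]\cup I_F$ if $\alpha\in(0,\alpha_2]$; $=I_E\cup I_D\cup I_F$ if $\alpha\in(\alpha_2,\infty)$. (b) If $\gamma\in(\frac{\omega_0}{2}-\omega_1,\frac{\omega_1}{2}-\omega_0]$, then $\sigma_{\rm ess}(\mathcal A)=[\omega_0+E,\omega_1+F]$ if $\alpha\in(0,\alpha_2]$; $=I_E\cup[2\omega_0+\gamma,\omega_1+F]$ if $\alpha\in(\alpha_2,\alpha_4]$; $=I_E\cup I_D\cup I_F$ if $\alpha\in(\alpha_4,\infty)$. (c) If $\gamma\in(\frac{\omega_1}{2}-\omega_0,\infty)$, then $\sigma_{\rm ess}(\mathcal A)=I_E\cup[2\omega_0+\gamma,\omega_1+F]$ if $\alpha\in(0,\alpha_4]$; $=I_E\cup I_D\cup I_F$ if $\alpha\in(\alpha_4,\infty)$. (ii) Suppose that $(R_0)$ is satisfied but $(R_1)$ is violated. (a) If $\gamma\in(-\infty,\frac{\omega_0}{2}-\omega_1]$, then $\sigma_{\rm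 ess}(\mathcal A)=I_D\cup I_F$ if $\alpha\in(0,\alpha_1]$; $=[\omega_0+E,2\omega_1+\gamma]\cup I_F$ if $\alpha\in(\alpha_1,\alpha_2]$; $=I_E\cup I_D\cup I_F$ if $\alpha\in(\alpha_2,\infty)$. (b) If $\gamma\in(\frac{\omega_0}{2}-\omega_1,-\frac{\omega_0}{2}]$, then $\sigma_{\rm ess}(\mathcal A)=[2\omega_0+\gamma,\omega_1+F]$ if $\alpha\in(0,\alpha_1]$; $=[\omega_0+E,\omega_1+F]$ if $\alpha\in(\alpha_1,\alpha_2]$; $=I_E\cup[2\omega_0+\gamma,\omega_1+F]$ if $\alpha\in(\alpha_2,\alpha_4]$; $=I_E\cup I_D\cup I_F$ if $\alpha\in(\alpha_4,\infty)$. (c) If $\gamma\in(-\frac{\omega_0}{2},\frac{\omega_1}{2}-\omega_0]$, then $\sigma_{\rm ess}(\mathcal A)=[\omega_0+E,\omega_1+F]$ if $\alpha\in(0,\alpha_2]$; $=I_E\cup[2\omega_0+\gamma,\omega_1+F]$ if $\alpha\in(\alpha_2,\alpha_4]$; $=I_E\cup I_D\cup I_F$ if $\alpha\in(\alpha_4,\infty)$. (d) If $\gamma\in(\frac{\omega_1}{2}-\omega_0,\infty)$, then $\sigma_{\rm ess}(\mathcal A)=I_E\cup[2\omega_0+\gamma,\omega_1+F]$ if $\alpha\in(0,\alpha_4]$; $=I_E\cup I_D\cup I_F$ if $\alpha\in(\alpha_4,\infty)$. (iii) Suppose that $(R_0)$ is violated but $(R_1)$ is satisfied. (a) If $\gamma\in(-\infty,\frac{\omega_0}{2}-\omega_1]$,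 then $\sigma_{\rm ess}(\mathcal A)=[\omega_0+E,2\omega_1+\gamma]\cup I_F$ if $\alpha\in(0,\alpha_2]$; $=I_E\cup I_D\cup I_F$ if $\alpha\in(\alpha_2,\infty)$. (b) If $\gamma\in(\frac{\omega_0}{2}-\omega_1,-\frac{\omega_1}{2}]$, then $\sigma_{\rm ess}(\mathcal A)=[\omega_0+E,\omega_1+F]$ if $\alpha\in(0,\alpha_2]$; $=I_E\cup[2\omega_0+\gamma,\omega_1+F]$ if $\alpha\in(\alpha_2,\alpha_4]$; $=I_E\cup I_D\cup I_F$ if $\alpha\in(\alpha_4,\infty)$. (c) If $\gamma\in(-\frac{\omega_1}{2},\frac{\omega_1}{2}-\omega_0]$, then $\sigma_{\rm ess}(\mathcal A)=[\omega_0+E,2\omega_1+\gamma]$ if $\alpha\in(0,\alpha_2]$; $=I_E\cup I_D$ if $\alpha\in(\alpha_2,\alpha_3]$; $=I_E\cup[2\omega_0+\gamma,\omega_1+F]$ if $\alpha\in(\alpha_3,\alpha_4]$; $=I_E\cup I_D\cup I_F$ if $\alpha\in(\alpha_4,\infty)$. (d) If $\gamma\in(\frac{\omega_1}{2}-\omega_0,\infty)$, then $\sigma_{\rm ess}(\mathcal A)=I_E\cup I_D$ if $\alpha\in(0,\alpha_3]$; $=I_E\cup[2\omega_0+\gamma,\omega_1+F]$ if $\alpha\in(\alpha_3,\alpha_4]$; $=I_E\cup I_D\cup I_F$ if $\alpha\in(\alpha_4,\infty)$. (iv) Suppose that both $(R_0)$ and $(R_1)$ are satisfied. (a) If $\gamma\in(-\infty,\frac{\omega_0}{2}-\omega_1]$,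 then $\sigma_{\rm ess}(\mathcal A)=I_D\cup I_F$ if $\alpha\in(0,\alpha_1]$; $=[\omega_0+E,2\omega_1+\gamma]\cup I_F$ if $\alpha\in(\alpha_1,\alpha_2]$; $=I_E\cup I_D\cup I_F$ if $\alpha\in(\alpha_2,\infty)$. (b) If $\gamma\in(\frac{\omega_0}{2}-\omega_1,-\frac{\omega_1}{2}]$, then $\sigma_{\rm ess}(\mathcal A)=[2\omega_0+\gamma,\omega_1+F]$ if $\alpha\in(0,\alpha_1]$; $=[\omega_0+E,\omega_1+F]$ if $\alpha\in(\alpha_1,\alpha_2]$; $=I_E\cup[2\omega_0+\gamma,\omega_1+F]$ if $\alpha\in(\alpha_2,\alpha_4]$; $=I_E\cup I_D\cup I_F$ if $\alpha\in(\alpha_4,\infty)$. (c) If $\gamma\in(-\frac{\omega_1}{2},-\frac{\omega_0}{2}]$, then $\sigma_{\rm ess}(\mathcal A)=I_D$ if $\alpha\in(0,\alpha_1]$; $=[\omega_0+E,2\omega_1+\gamma]$ if $\alpha\in(\alpha_1,\alpha_2]$; $=I_E\cup I_D$ if $\alpha\in(\alpha_2,\alpha_3]$; $=I_E\cup[2\omega_0+\gamma,\omega_1+F]$ if $\alpha\in(\alpha_3,\alpha_4]$; $=I_E\cup I_D\cup I_F$ if $\alpha\in(\alpha_4,\infty)$. (d) If $\gamma\in(-\frac{\omega_0}{2},\frac{\omega_1}{2}-\omega_0]$, then $\sigma_{\rm ess}(\mathcal A)=[\omega_0+E,2\omega_1+\gamma]$ if $\alpha\in(0,\alpha_2]$;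 $=I_E\cup I_D$ if $\alpha\in(\alpha_2,\alpha_3]$; $=I_E\cup[2\omega_0+\gamma,\omega_1+F]$ if $\alpha\in(\alpha_3,\alpha_4]$; $=I_E\cup I_D\cup I_F$ if $\alpha\in(\alpha_4,\infty)$. (e) If $\gamma\in(\frac{\omega_1}{2}-\omega_0,\infty)$, then $\sigma_{\rm ess}(\mathcal A)=I_E\cup I_D$ if $\alpha\in(0,\alpha_3]$; $=I_E\cup[2\omega_0+\gamma,\omega_1+F]$ if $\alpha\in(\alpha_3,\alpha_4]$; $=I_E\cup I_D\cup I_F$ if $\alpha\in(\alpha_4,\infty)$.
   Context: Standing assumptions: $d\ge1$; $\omega:\mathbb R^d\to[0,\infty)$ is a non-constant, bounded, continuous function; $\lambda\in L^2(\mathbb R^d)$ is complex-valued and not identically zero. Put $\omega_0:=\inf_{\mathbb R^d}\omega$ and $\omega_1:=\sup_{\mathbb R^d}\omega$. Let $L^2_s(\mathbb R^d\times\mathbb R^d)$ be the subspace of symmetric functions in $L^2(\mathbb R^d\times\mathbb R^d)$, equipped with $\frac12$ times the inner product of the latter. For $\gamma\in\mathbb R$, $\alpha>0$ the operator matrix $\mathcal A=\begin{pmatrix}A&B\\ C&D\end{pmatrix}$ acts in $L^2(\mathbb R^d)\oplus L^2_s(\mathbb R^d\times\mathbb R^d)$ by $(Af)(k)=(-\gamma+\omega(k))f(k)$, $(Bg)(k)=\alpha\int_{\mathbb R^d} g(k,q)\lambda(q)\,dq$, $(Cf)(k,q)=\alpha\overline{\lambda(k)}f(q)+\alpha\overline{\lambda(q)}f(k)$,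 $(Dg)(k,q)=(\gamma+\omega(k)+\omega(q))g(k,q)$. It is bounded and self-adjoint. $\sigma_{\rm ess}$ denotes the essential spectrum, i.e. the spectrum minus the isolated eigenvalues of finite multiplicity. Conditions: $(R_0)$: $\frac{\lambda}{\sqrt{\omega-\omega_0}}\in L^2(\mathbb R^d)$; $(R_1)$: $\frac{\lambda}{\sqrt{\omega_1-\omega}}\in L^2(\mathbb R^d)$. Function: $\Phi(z)=-\gamma-z-\alpha^2\int_{\mathbb R^d}\frac{|\lambda(q)|^2\,dq}{\omega(q)+\gamma-z}$ for $z\in(-\infty,\omega_0+\gamma)\cup(\omega_1+\gamma,\infty)$; it is strictly decreasing on each of the two intervals. $E=E(\gamma,\alpha)$ denotes the unique zero of $\Phi$ in $(-\infty,\omega_0+\gamma)$ whenever a zero exists there, which is the case exactly when $(R_0)$ is violated, or $(R_0)$ holds and either $\gamma\ge-\frac{\omega_0}{2}$, or $\gamma<-\frac{\omega_0}{2}$ and $\alpha>\alpha_1$. $F=F(\gamma,\alpha)$ denotes the unique zero of $\Phi$ in $(\omega_1+\gamma,\infty)$ whenever a zero exists there, which is the case exactly when $(R_1)$ is violated, or $(R_1)$ holds and either $\gamma\le-\frac{\omega_1}{2}$, or $\gamma>-\frac{\omega_1}{2}$ and $\alpha>\alpha_3$. Critical values of the coupling (all norms in $L^2(\mathbb R^d)$), each used only when the radicand is nonnegative (and, for $\alpha_1$, $\alpha_3$, when $(R_0)$, resp. $(R_1)$, holds): $\alpha_1=\frac{\sqrt{-2\gamma-\omega_0}}{\|\lambda/\sqrt{\omega-\omega_0}\|}$,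 $\alpha_2=\frac{\sqrt{\omega_1-2\omega_0-2\gamma}}{\|\lambda/\sqrt{\omega_1-2\omega_0+\omega}\|}$, $\alpha_3=\frac{\sqrt{\omega_1+2\gamma}}{\|\lambda/\sqrt{\omega_1-\omega}\|}$, $\alpha_4=\frac{\sqrt{2\omega_1-\omega_0+2\gamma}}{\|\lambda/\sqrt{2\omega_1-\omega_0-\omega}\|}$. Intervals: $I_E=[\omega_0+E,\omega_1+E]$, $I_D=[2\omega_0+\gamma,2\omega_1+\gamma]$, $I_F=[\omega_0+F,\omega_1+F]$.
   Formalization: As α1, α2 need not lie below α3, α4, the α-ranges in (i)(b), (ii)(b),(c), (iii)(b),(c), (iv)(b),(c),(d) are cut by min/max (e.g. (0,α2] to (0,min(α2,α4)], (α4,∞) to (max(α1,α4),∞)), dropping only α where the printed equality is false or E does not exist. *)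

theory Defs
  imports "HOL-Analysis.Analysis" "HOL-Library.Function_Algebras"
begin

text \<open>
  Elements of the Hilbert spaces are represented by Borel measurable functions;
  two representatives denote the same vector iff they agree almost everywhere.
  Vector space operations on representatives are the pointwise ones.
\<close>

definition L2 :: "('a::euclidean_space \<Rightarrow> complex) set" where
  "L2 = {f. f \<in> borel_measurable lborel \<and> integrable lborel (\<lambda>x. (cmod (f x))\<^sup>2)}"

definition norm_L2 :: "('a::euclidean_space \<Rightarrow> complex) \<Rightarrow> real" where
  "norm_L2 f = sqrt (\<integral>x. (cmod (f x))\<^sup>2 \<partial>lborel)"

type_synonym 'a state = "('a \<Rightarrow> complex) \<times> ('a \<times> 'a \<Rightarrow> complex)"

definition space_H :: "'a::euclidean_space state set" where
  "space_H = {(f, g). f \<in> L2 \<and> g \<in> L2 \<and> (AE p in lborel. g (prod.swap p) = g p)}"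

text \<open>The factor 1/2 is the weight of the inner product on the symmetric functions.\<close>

definition norm_H :: "'a::euclidean_space state \<Rightarrow> real" where
  "norm_H u = sqrt ((norm_L2 (fst u))\<^sup>2 + (norm_L2 (snd u))\<^sup>2 / 2)"

definition eq_H :: "'a::euclidean_space state \<Rightarrow> 'a state \<Rightarrow> bool"  (infix \<open>\<approx>\<close> 50) where
  "u \<approx> v \<longleftrightarrow> (AE x in lborel. fst u x = fst v x) \<and> (AE p in lborel. snd u p = snd v p)"

definition scale_H :: "complex \<Rightarrow> 'a state \<Rightarrow> 'a state"  (infixr \<open>\<odot>\<close> 75) where
  "c \<odot> u = (\<lambda>x. c * fst u x, \<lambda>p. c * snd u p)"

definition bounded_operator :: "('a::euclidean_space state \<Rightarrow> 'a state) \<Rightarrow> bool" where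
  "bounded_operator R \<longleftrightarrow>
     (\<forall>u\<in>space_H. R u \<in> space_H) \<and>
     (\<forall>u\<in>space_H. \<forall>v\<in>space_H. R (u + v) \<approx> R u + R v) \<and>
     (\<forall>c. \<forall>u\<in>space_H. R (c \<odot> u) \<approx> c \<odot> R u) \<and>
     (\<exists>K. \<forall>u\<in>space_H. norm_H (R u) \<le> K * norm_H u)"

definition resolvent_set :: "('a::euclidean_space state \<Rightarrow> 'a state) \<Rightarrow> complex set" where
  "resolvent_set T = {z. \<exists>R. bounded_operator R \<and>
     (\<forall>u\<in>space_H. R (T u - z \<odot> u) \<approx> u \<and> T (R u) - z \<odot> R u \<approx> u)}"

definition spectrum :: "('a::euclidean_space state \<Rightarrow> 'a state) \<Rightarrow> complex set" where
  "spectrum T = - resolvent_set T"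

definition eigenspace :: "('a::euclidean_space state \<Rightarrow> 'a state) \<Rightarrow> complex \<Rightarrow> 'a state set" where
  "eigenspace T z = {u \<in> space_H. T u \<approx> z \<odot> u}"

definition eigenvalue :: "('a::euclidean_space state \<Rightarrow> 'a state) \<Rightarrow> complex \<Rightarrow> bool" where
  "eigenvalue T z \<longleftrightarrow> (\<exists>u\<in>eigenspace T z. \<not> u \<approx> 0)"

text \<open>
  Multiplicity is the dimension of the eigenspace; for self-adjoint operators,
  the only ones considered here, this is also the algebraic multiplicity.
\<close>

definition finite_multiplicity :: "('a::euclidean_space state \<Rightarrow> 'a state) \<Rightarrow> complex \<Rightarrow> bool" where
  "finite_multiplicity T z \<longleftrightarrow> (\<exists>B. finite B \<and> B \<subseteq> space_H \<and>
     (\<forall>u\<in>eigenspace T z. \<exists>c. u \<approx> (\<Sum>b\<in>B. c b \<odot> b)))"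

definition essential_spectrum :: "('a::euclidean_space state \<Rightarrow> 'a state) \<Rightarrow> complex set" where
  "essential_spectrum T = spectrum T -
     {z. z isolated_in spectrum T \<and> eigenvalue T z \<and> finite_multiplicity T z}"

text \<open>
  The operator matrix. In \<open>op_B\<close> the integral exists for almost every \<open>k\<close>.
\<close>

definition op_A :: "('a::euclidean_space \<Rightarrow> real) \<Rightarrow> real \<Rightarrow> ('a \<Rightarrow> complex) \<Rightarrow> 'a \<Rightarrow> complex" where
  "op_A \<omega> \<gamma> f = (\<lambda>k. complex_of_real (- \<gamma> + \<omega> k) * f k)"

definition op_B :: "('a::euclidean_space \<Rightarrow> complex) \<Rightarrow> real \<Rightarrow> ('a \<times> 'a \<Rightarrow> complex) \<Rightarrow> 'a \<Rightarrow> complex" where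
  "op_B l \<alpha> g = (\<lambda>k. complex_of_real \<alpha> * (\<integral>q. g (k, q) * l q \<partial>lborel))"

definition op_C :: "('a::euclidean_space \<Rightarrow> complex) \<Rightarrow> real \<Rightarrow> ('a \<Rightarrow> complex) \<Rightarrow> 'a \<times> 'a \<Rightarrow> complex" where
  "op_C l \<alpha> f = (\<lambda>(k, q). complex_of_real \<alpha> * cnj (l k) * f q + complex_of_real \<alpha> * cnj (l q) * f k)"

definition op_D :: "('a::euclidean_space \<Rightarrow> real) \<Rightarrow> real \<Rightarrow> ('a \<times> 'a \<Rightarrow> complex) \<Rightarrow> 'a \<times> 'a \<Rightarrow> complex" where
  "op_D \<omega> \<gamma> g = (\<lambda>(k, q). complex_of_real (\<gamma> + \<omega> k + \<omega> q) * g (k, q))"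

definition op_matrix ::
  "('a::euclidean_space \<Rightarrow> real) \<Rightarrow> ('a \<Rightarrow> complex) \<Rightarrow> real \<Rightarrow> real \<Rightarrow> 'a state \<Rightarrow> 'a state" where
  "op_matrix \<omega> l \<gamma> \<alpha> = (\<lambda>(f, g). (op_A \<omega> \<gamma> f + op_B l \<alpha> g, op_C l \<alpha> f + op_D \<omega> \<gamma> g))"

definition inf_of :: "('a::euclidean_space \<Rightarrow> real) \<Rightarrow> real" where
  "inf_of \<omega> = (INF x. \<omega> x)"

definition sup_of :: "('a::euclidean_space \<Rightarrow> real) \<Rightarrow> real" where
  "sup_of \<omega> = (SUP x. \<omega> x)"

definition quot_sqrt :: "('a::euclidean_space \<Rightarrow> complex) \<Rightarrow> ('a \<Rightarrow> real) \<Rightarrow> 'a \<Rightarrow> complex" where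
  "quot_sqrt l w = (\<lambda>q. l q / complex_of_real (sqrt (w q)))"

text \<open>
  Since division by 0 yields 0 here, it has to be required separately that
  \<open>l\<close> vanishes almost everywhere on the zero set of the denominator
  (where the quotient would otherwise be infinite).
\<close>

definition quot_sqrt_in_L2 :: "('a::euclidean_space \<Rightarrow> complex) \<Rightarrow> ('a \<Rightarrow> real) \<Rightarrow> bool" where
  "quot_sqrt_in_L2 l w \<longleftrightarrow> (AE q in lborel. w q = 0 \<longrightarrow> l q = 0) \<and> quot_sqrt l w \<in> L2"

definition cond_R0 :: "('a::euclidean_space \<Rightarrow> real) \<Rightarrow> ('a \<Rightarrow> complex) \<Rightarrow> bool" where
  "cond_R0 \<omega> l \<longleftrightarrow> quot_sqrt_in_L2 l (\<lambda>q. \<omega> q - inf_of \<omega>)"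

definition cond_R1 :: "('a::euclidean_space \<Rightarrow> real) \<Rightarrow> ('a \<Rightarrow> complex) \<Rightarrow> bool" where
  "cond_R1 \<omega> l \<longleftrightarrow> quot_sqrt_in_L2 l (\<lambda>q. sup_of \<omega> - \<omega> q)"

definition Phi :: "('a::euclidean_space \<Rightarrow> real) \<Rightarrow> ('a \<Rightarrow> complex) \<Rightarrow> real \<Rightarrow> real \<Rightarrow> real \<Rightarrow> real" where
  "Phi \<omega> l \<gamma> \<alpha> z = - \<gamma> - z - \<alpha>\<^sup>2 * (\<integral>q. (cmod (l q))\<^sup>2 / (\<omega> q + \<gamma> - z) \<partial>lborel)"

text \<open>The following two are meaningful only when the zero in question exists.\<close>

definition zero_E :: "('a::euclidean_space \<Rightarrow> real) \<Rightarrow> ('a \<Rightarrow> complex) \<Rightarrow> real \<Rightarrow> real \<Rightarrow> real" where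
  "zero_E \<omega> l \<gamma> \<alpha> = (THE z. z < inf_of \<omega> + \<gamma> \<and> Phi \<omega> l \<gamma> \<alpha> z = 0)"

definition zero_F :: "('a::euclidean_space \<Rightarrow> real) \<Rightarrow> ('a \<Rightarrow> complex) \<Rightarrow> real \<Rightarrow> real \<Rightarrow> real" where
  "zero_F \<omega> l \<gamma> \<alpha> = (THE z. z > sup_of \<omega> + \<gamma> \<and> Phi \<omega> l \<gamma> \<alpha> z = 0)"

text \<open>
  Under the conditions \<open>cond_R0\<close>, \<open>cond_R1\<close> and with positive radicands, one has
  \<open>alpha1 < alpha2\<close> and \<open>alpha3 < alpha4\<close>, respectively. There is
  no such relation between thresholds of the two pairs: \<open>alpha4\<close> tends to 0 for
  \<open>\<gamma>\<close> decreasing to \<open>inf_of \<omega> / 2 - sup_of \<omega>\<close> while \<open>alpha2\<close> stays bounded away from 0.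
\<close>

definition alpha1 :: "('a::euclidean_space \<Rightarrow> real) \<Rightarrow> ('a \<Rightarrow> complex) \<Rightarrow> real \<Rightarrow> real" where
  "alpha1 \<omega> l \<gamma> = sqrt (- 2 * \<gamma> - inf_of \<omega>) /
     norm_L2 (quot_sqrt l (\<lambda>q. \<omega> q - inf_of \<omega>))"

definition alpha2 :: "('a::euclidean_space \<Rightarrow> real) \<Rightarrow> ('a \<Rightarrow> complex) \<Rightarrow> real \<Rightarrow> real" where
  "alpha2 \<omega> l \<gamma> = sqrt (sup_of \<omega> - 2 * inf_of \<omega> - 2 * \<gamma>) /
     norm_L2 (quot_sqrt l (\<lambda>q. sup_of \<omega> - 2 * inf_of \<omega> + \<omega> q))"

definition alpha3 :: "('a::euclidean_space \<Rightarrow> real) \<Rightarrow> ('a \<Rightarrow> complex) \<Rightarrow> real \<Rightarrow> real" where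
  "alpha3 \<omega> l \<gamma> = sqrt (sup_of \<omega> + 2 * \<gamma>) /
     norm_L2 (quot_sqrt l (\<lambda>q. sup_of \<omega> - \<omega> q))"

definition alpha4 :: "('a::euclidean_space \<Rightarrow> real) \<Rightarrow> ('a \<Rightarrow> complex) \<Rightarrow> real \<Rightarrow> real" where
  "alpha4 \<omega> l \<gamma> = sqrt (2 * sup_of \<omega> - inf_of \<omega> + 2 * \<gamma>) /
     norm_L2 (quot_sqrt l (\<lambda>q. 2 * sup_of \<omega> - inf_of \<omega> - \<omega> q))"

end

theory Submission
  imports Defs
begin

text \<open>
  Off \<open>I_D\<close> the component \<open>D - z\<close> is invertible, and eliminating it turns \<open>T - z\<close> into
  multiplication by \<open>\<Phi> (z - \<omega> k)\<close> plus a Hilbert--Schmidt operator whose kernel depends on \<open>k\<close>,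
  apart from a factor, only through \<open>\<omega> k\<close>. If \<open>\<Phi> (z - \<omega> k)\<close> is bounded away from 0, then
  \<open>T - z\<close> is bounded below up to finitely many functionals, and since \<open>T\<close> is symmetric, \<open>z\<close> is
  a regular point or an isolated eigenvalue of finite multiplicity. Conversely, vectors concentrated
  near a point show that \<open>I_D\<close>, \<open>I_E\<close> and \<open>I_F\<close> lie in the spectrum; as these intervals are
  nondegenerate, none of their points is isolated there. Hence the essential spectrum is
  \<open>I_E \<union> I_D \<union> I_F\<close>, where \<open>I_E\<close> and \<open>I_F\<close> occur only if the respective zero of \<open>\<Phi>\<close> exists. The
  critical couplings are the values of \<open>\<alpha>\<close> at which \<open>\<Phi>\<close> vanishes at \<open>w0 + \<gamma>\<close> and \<open>w1 + \<gamma>\<close>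
  (existence) and at \<open>2 * w0 + \<gamma> - w1\<close> and \<open>2 * w1 + \<gamma> - w0\<close> (contact with \<open>I_D\<close>).
\<close>

section \<open>Symmetric operators on spaces with a complete seminorm\<close>

text \<open>Vectors are functions, not classes modulo null sets, so \<open>ip\<close> may degenerate
  and equality of vectors becomes \<open>nrm (u - v) = 0\<close>. The carrier is a set because
  square integrable functions form no type. Moreover, the integral in \<open>op_B\<close> has the
  value 0 where it does not exist, so the operator matrix is additive only almost everywhere;
  linearity is therefore not assumed of T but drawn from its symmetry.

  Compactness of the Hilbert--Schmidt part enters in an elementary way. Apart from a factor, its
  kernel sees k only through a parameter s in the compact interval from w0 to w1, and it is
  Lipschitz in s. Finitely many values of s thus give finitely many functionals that control the
  operator up to an error which the lower bound of \<Phi> absorbs. An estimate modulo these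
  functionals takes the place of the invariance of the essential spectrum under compact
  perturbations.\<close>

locale semi_inner_space = vector_space sc
  for sc :: "complex \<Rightarrow> 'v::ab_group_add \<Rightarrow> 'v" +
  fixes V :: "'v set" and ip :: "'v \<Rightarrow> 'v \<Rightarrow> complex"
  assumes zero_mem [simp]: "0 \<in> V"
    and add_mem [simp]: "u \<in> V \<Longrightarrow> v \<in> V \<Longrightarrow> u + v \<in> V"
    and sc_mem [simp]: "u \<in> V \<Longrightarrow> sc c u \<in> V"
    and ip_add_right: "u \<in> V \<Longrightarrow> v \<in> V \<Longrightarrow> w \<in> V \<Longrightarrow> ip u (v + w) = ip u v + ip u w"
    and ip_sc_right: "u \<in> V \<Longrightarrow> v \<in> V \<Longrightarrow> ip u (sc c v) = c * ip u v"
    and ip_cnj: "u \<in> V \<Longrightarrow> v \<in> V \<Longrightarrow> cnj (ip u v) = ip v u"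
    and ip_nonneg: "u \<in> V \<Longrightarrow> 0 \<le> Re (ip u u)"
begin

definition nrm :: "'v \<Rightarrow> real" where
  "nrm u = sqrt (Re (ip u u))"

lemma uminus_mem [simp]: "u \<in> V \<Longrightarrow> - u \<in> V"
  using sc_mem[of u "-1"] by simp

lemma diff_mem [simp]: "u \<in> V \<Longrightarrow> v \<in> V \<Longrightarrow> u - v \<in> V"
  using add_mem[of u "-v"] by simp

lemma sum_mem: "(\<And>i. i \<in> A \<Longrightarrow> f i \<in> V) \<Longrightarrow> sum f A \<in> V"
  by (induction A rule: infinite_finite_induct) auto

lemma ip_add_left: "u \<in> V \<Longrightarrow> v \<in> V \<Longrightarrow> w \<in> V \<Longrightarrow> ip (u + v) w = ip u w + ip v w"
  by (metis add_mem complex_cnj_add ip_add_right ip_cnj)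

lemma ip_sc_left: "u \<in> V \<Longrightarrow> v \<in> V \<Longrightarrow> ip (sc c u) v = cnj c * ip u v"
  by (metis sc_mem complex_cnj_mult ip_sc_right ip_cnj)

lemma ip_uminus_right: "u \<in> V \<Longrightarrow> v \<in> V \<Longrightarrow> ip u (- v) = - ip u v"
  using ip_sc_right[of u v "-1"] by simp

lemma ip_diff_right: "u \<in> V \<Longrightarrow> v \<in> V \<Longrightarrow> w \<in> V \<Longrightarrow> ip u (v - w) = ip u v - ip u w"
  using ip_add_right[of u v "-w"] by (simp add: ip_uminus_right)

lemma ip_uminus_left: "u \<in> V \<Longrightarrow> v \<in> V \<Longrightarrow> ip (- u) v = - ip u v"
  using ip_sc_left[of u v "-1"] by simp

lemma ip_diff_left: "u \<in> V \<Longrightarrow> v \<in> V \<Longrightarrow> w \<in> V \<Longrightarrow> ip (u - v) w = ip u w - ip v w"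
  using ip_add_left[of u "-v" w] by (simp add: ip_uminus_left)

lemmas ip_simps = ip_add_left ip_add_right ip_diff_left ip_diff_right ip_sc_left ip_sc_right

lemma nrm_nonneg [simp]: "u \<in> V \<Longrightarrow> 0 \<le> nrm u"
  by (simp add: nrm_def ip_nonneg)

lemma nrm_le_zero_iff [simp]: "u \<in> V \<Longrightarrow> nrm u \<le> 0 \<longleftrightarrow> nrm u = 0"
  using nrm_nonneg[of u] by linarith

lemma nrm_sq: "u \<in> V \<Longrightarrow> (nrm u)\<^sup>2 = Re (ip u u)"
  by (simp add: nrm_def ip_nonneg)

lemma ip_self: "u \<in> V \<Longrightarrow> ip u u = of_real ((nrm u)\<^sup>2)"
  using ip_cnj[of u u] by (simp add: nrm_sq complex_eq_iff)

lemma nrm_zero [simp]: "nrm 0 = 0"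
  using ip_sc_right[of 0 0 0] by (simp add: nrm_def)

lemma nrm_sq_add:
  assumes "u \<in> V" "v \<in> V"
  shows "(nrm (u + v))\<^sup>2 = (nrm u)\<^sup>2 + 2 * Re (ip u v) + (nrm v)\<^sup>2"
proof -
  have "Re (ip v u) = Re (ip u v)"
    using ip_cnj[of u v] assms by (metis cnj.sel(1))
  then show ?thesis
    using assms by (simp add: nrm_sq ip_simps)
qed

lemma nrm_sc [simp]:
  assumes "u \<in> V"
  shows "nrm (sc c u) = cmod c * nrm u"
proof -
  have "ip (sc c u) (sc c u) = of_real ((cmod c)\<^sup>2 * (nrm u)\<^sup>2)"
    using assms by (simp add: ip_sc_left ip_sc_right ip_self[of u] complex_norm_square del: of_real_power)
  then have "nrm (sc c u) = sqrt ((cmod c * nrm u)\<^sup>2)"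
    by (simp only: nrm_def Re_complex_of_real power_mult_distrib)
  then show ?thesis
    using assms by (simp add: abs_mult)
qed

lemma nrm_minus [simp]: "u \<in> V \<Longrightarrow> nrm (- u) = nrm u"
  using nrm_sc[of u "-1"] by simp

lemma nrm_minus_commute: "u \<in> V \<Longrightarrow> v \<in> V \<Longrightarrow> nrm (u - v) = nrm (v - u)"
  using nrm_minus[of "u - v"] by simp

text \<open>The square of \<open>nrm (u + sc c v)\<close> is nonnegative for every
  \<open>c = - t * cnj p\<close>, which gives a quadratic in t, minimal at the inverse square of
  \<open>nrm v\<close>. As \<open>nrm v = 0\<close> does not force \<open>v = 0\<close>, this case
  is treated separately.\<close>

lemma cauchy_schwarz:
  assumes "u \<in> V" "v \<in> V"
  shows "cmod (ip u v) \<le> nrm u * nrm v"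
proof -
  define p where "p = ip u v"
  have key: "0 \<le> (nrm u)\<^sup>2 - 2 * t * (cmod p)\<^sup>2 + t\<^sup>2 * (cmod p)\<^sup>2 * (nrm v)\<^sup>2" for t :: real
  proof -
    define c where "c = - of_real t * cnj p"
    have "Re (ip u (sc c v)) = Re (c * p)"
      using assms by (simp add: ip_sc_right p_def)
    then have 1: "Re (ip u (sc c v)) = - t * (cmod p)\<^sup>2"
      unfolding cmod_power2 by (simp add: c_def power2_eq_square algebra_simps)
    have 2: "(nrm (sc c v))\<^sup>2 = t\<^sup>2 * (cmod p)\<^sup>2 * (nrm v)\<^sup>2"
      using assms by (simp add: c_def norm_mult power_mult_distrib)
    have "0 \<le> (nrm (u + sc c v))\<^sup>2"
      by simp
    then show ?thesis
      using assms 1 2 by (simp add: nrm_sq_add)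
  qed
  have "(cmod p)\<^sup>2 \<le> (nrm u * nrm v)\<^sup>2"
  proof (cases "nrm v = 0")
    case True
    have "p = 0"
    proof (rule ccontr)
      assume "p \<noteq> 0"
      then have "(cmod p)\<^sup>2 > 0" by simp
      then show False
        \<comment> \<open>With \<open>nrm v = 0\<close> the quadratic is affine in t, and this t
          gives it the value -1.\<close>
        using key[of "((nrm u)\<^sup>2 + 1) / (2 * (cmod p)\<^sup>2)"] True by (simp add: field_simps)
    qed
    then show ?thesis by simp
  next
    case False
    then show ?thesis
      using key[of "1 / (nrm v)\<^sup>2"]
      by (simp add: zero_le_divide_iff field_simps power2_eq_square) (auto simp: mult_le_0_iff not_le)
  qed
  then show ?thesis
    unfolding p_def by (rule power2_le_imp_le) (use assms in simp)
qed

lemma nrm_triangle: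
  assumes "u \<in> V" "v \<in> V"
  shows "nrm (u + v) \<le> nrm u + nrm v"
proof -
  have "Re (ip u v) \<le> nrm u * nrm v"
    using cauchy_schwarz[OF assms] complex_Re_le_cmod[of "ip u v"] by linarith
  then have "(nrm (u + v))\<^sup>2 \<le> (nrm u + nrm v)\<^sup>2"
    using assms by (simp add: nrm_sq_add power2_sum)
  then show ?thesis
    by (rule power2_le_imp_le) (use assms in simp)
qed

lemma nrm_triangle_diff: "u \<in> V \<Longrightarrow> v \<in> V \<Longrightarrow> nrm (u - v) \<le> nrm u + nrm v"
  using nrm_triangle[of u "- v"] by simp

lemma nrm_triangle_sub: "u \<in> V \<Longrightarrow> v \<in> V \<Longrightarrow> nrm u \<le> nrm v + nrm (u - v)"
  using nrm_triangle[of v "u - v"] by simp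

lemma nrm_triangle_mid:
  "u \<in> V \<Longrightarrow> v \<in> V \<Longrightarrow> w \<in> V \<Longrightarrow> nrm (u - w) \<le> nrm (u - v) + nrm (v - w)"
  using nrm_triangle[of "u - v" "v - w"] by simp

lemma nrm_cong: "u \<in> V \<Longrightarrow> v \<in> V \<Longrightarrow> nrm (u - v) = 0 \<Longrightarrow> nrm u = nrm v"
  using nrm_triangle_sub[of u v] nrm_triangle_sub[of v u] nrm_minus_commute[of u v] by simp

lemma null_if_orthogonal: "u \<in> V \<Longrightarrow> (\<And>v. v \<in> V \<Longrightarrow> ip v u = 0) \<Longrightarrow> nrm u = 0"
  by (simp add: nrm_def)

lemma tendsto_nrm:
  assumes "\<And>n. x n \<in> V" "y \<in> V" "(\<lambda>n. nrm (x n - y)) \<longlonglongrightarrow> 0"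
  shows "(\<lambda>n. nrm (x n)) \<longlonglongrightarrow> nrm y"
proof -
  have "\<bar>nrm (x n) - nrm y\<bar> \<le> nrm (x n - y)" for n
    using nrm_triangle_sub[of "x n" y] nrm_triangle_sub[of y "x n"]
      nrm_minus_commute[of "x n" y] assms by force
  then have "(\<lambda>n. nrm (x n) - nrm y) \<longlonglongrightarrow> 0"
    by (intro Lim_null_comparison[OF _ assms(3)]) auto
  then show ?thesis
    using LIM_zero_iff by blast
qed

text \<open>
  \<open>nrm\<close> is only a seminorm, so finite dimension means spanning up to null vectors.
\<close>

lemma finite_span_if_finite_separating:
  fixes ell :: "'i \<Rightarrow> 'v \<Rightarrow> complex"
  assumes "finite I" "N \<subseteq> V"
    and "\<And>u v. u \<in> N \<Longrightarrow> v \<in> N \<Longrightarrow> u + v \<in> N" "\<And>c u. u \<in> N \<Longrightarrow> sc c u \<in> N"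
    and "\<And>i u v. i \<in> I \<Longrightarrow> u \<in> N \<Longrightarrow> v \<in> N \<Longrightarrow> ell i (u + v) = ell i u + ell i v"
    and "\<And>i c u. i \<in> I \<Longrightarrow> u \<in> N \<Longrightarrow> ell i (sc c u) = c * ell i u"
    and "\<And>u. u \<in> N \<Longrightarrow> (\<forall>i\<in>I. ell i u = 0) \<Longrightarrow> nrm u = 0"
  shows "\<exists>B. finite B \<and> B \<subseteq> N \<and> (\<forall>u\<in>N. \<exists>c. nrm (u - (\<Sum>b\<in>B. sc (c b) b)) = 0)"
  using assms
proof (induction I arbitrary: N rule: finite_induct)
  case empty
  then show ?case
    by (intro exI[of _ "{}"]) auto
next
  case (insert i I)
  \<comment> \<open>Passing to the kernel of one functional costs at most one spanning vector: any
    vector of N with nonzero value, normalised to value 1, can be used to move u into the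
    kernel.\<close>
  define N' where "N' = {u \<in> N. ell i u = 0}"
  have "\<exists>B. finite B \<and> B \<subseteq> N' \<and> (\<forall>u\<in>N'. \<exists>c. nrm (u - (\<Sum>b\<in>B. sc (c b) b)) = 0)"
    by (rule insert.IH) (use insert.prems in \<open>auto simp: N'_def\<close>)
  then obtain B where B: "finite B" "B \<subseteq> N'"
    "\<And>u. u \<in> N' \<Longrightarrow> \<exists>c. nrm (u - (\<Sum>b\<in>B. sc (c b) b)) = 0"
    by blast
  show ?case
  proof (cases "N' = N")
    case True
    then show ?thesis using B by blast
  next
    case False
    then obtain b where b: "b \<in> N" "ell i b \<noteq> 0"
      by (auto simp: N'_def)
    define b0 where "b0 = sc (1 / ell i b) b"
    have b0: "b0 \<in> N" "ell i b0 = 1"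
      using b insert.prems by (auto simp: b0_def)
    then have "b0 \<notin> B"
      using B by (auto simp: N'_def)
    have "\<exists>c. nrm (u - (\<Sum>b\<in>insert b0 B. sc (c b) b)) = 0" if u: "u \<in> N" for u
    proof -
      define u' where "u' = u + sc (- ell i u) b0"
      have "u' \<in> N'"
        unfolding N'_def u'_def using u b0 insert.prems by (simp del: scale_minus_left)
      then obtain c where c: "nrm (u' - (\<Sum>b\<in>B. sc (c b) b)) = 0"
        using B by blast
      define c' where "c' = c(b0 := ell i u)"
      have "(\<Sum>b\<in>insert b0 B. sc (c' b) b) = sc (ell i u) b0 + (\<Sum>b\<in>B. sc (c b) b)"
        using \<open>b0 \<notin> B\<close> B(1) by (auto simp: c'_def intro!: sum.cong)
      then have "u - (\<Sum>b\<in>insert b0 B. sc (c' b) b) = u' - (\<Sum>b\<in>B. sc (c b) b)"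
        by (simp add: u'_def algebra_simps)
      then show ?thesis using c by metis
    qed
    then show ?thesis
      using B b0 by (intro exI[of _ "insert b0 B"]) (auto simp: N'_def)
  qed
qed

end

lemma convergent_subseq_finite:
  fixes x :: "'i \<Rightarrow> nat \<Rightarrow> 'a::{heine_borel, real_normed_vector}"
  assumes "finite I" "\<And>i. i \<in> I \<Longrightarrow> bounded (range (x i))"
  shows "\<exists>r. strict_mono (r :: nat \<Rightarrow> nat) \<and> (\<forall>i\<in>I. convergent (\<lambda>n. x i (r n)))"
  using assms
proof (induction I rule: finite_induct)
  case empty
  then show ?case
    by (auto intro: exI[of _ "\<lambda>n. n"] simp: strict_mono_def)
next
  case (insert i I)
  then obtain r where r: "strict_mono r" "\<forall>i\<in>I. convergent (\<lambda>n. x i (r n))"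
    by auto
  have "bounded (range (\<lambda>n. x i (r n)))"
    by (rule bounded_subset[OF insert.prems[of i]]) auto
  then obtain l s where s: "strict_mono (s :: nat \<Rightarrow> nat)" "((\<lambda>n. x i (r n)) \<circ> s) \<longlonglongrightarrow> l"
    using bounded_imp_convergent_subsequence by blast
  have "convergent (\<lambda>n. x j (r (s n)))" if "j \<in> insert i I" for j
    using that s r convergent_subseq_convergent[of "\<lambda>n. x j (r n)" s]
    by (cases "j = i") (auto simp: convergent_def o_def)
  then show ?case
    using r(1) s(1) by (intro exI[of _ "\<lambda>n. r (s n)"]) (auto simp: strict_mono_def)
qed

locale semi_hilbert_space = semi_inner_space +
  assumes complete: "(\<And>n. x n \<in> V) \<Longrightarrow>
      (\<And>e. 0 < e \<Longrightarrow> \<exists>N. \<forall>m\<ge>N. \<forall>n\<ge>N. nrm (x m - x n) < e) \<Longrightarrow>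
      \<exists>y\<in>V. (\<lambda>n. nrm (x n - y)) \<longlonglongrightarrow> 0"
begin

lemma limit_of_geometric_increments:
  assumes x: "\<And>n. x n \<in> V" and q: "0 \<le> q" "q < 1"
    and incr: "\<And>n. nrm (x (Suc n) - x n) \<le> C * q ^ n"
  shows "\<exists>y\<in>V. (\<lambda>n. nrm (x n - y)) \<longlonglongrightarrow> 0"
proof (rule complete[OF x])
  fix e :: real assume "0 < e"
  define s where "s n = (\<Sum>i<n. C * q ^ i)" for n
  have "summable (\<lambda>i. C * q ^ i)"
    using q by (intro summable_mult summable_geometric) auto
  then have "Cauchy s"
    unfolding s_def by (rule LIMSEQ_imp_Cauchy[OF summable_LIMSEQ])
  then obtain N where N: "\<And>m n. m \<ge> N \<Longrightarrow> n \<ge> N \<Longrightarrow> \<bar>s m - s n\<bar> < e"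
    using \<open>0 < e\<close> unfolding Cauchy_def dist_real_def by blast
  have le: "nrm (x (n + k) - x n) \<le> s (n + k) - s n" for n k
  proof (induction k)
    case (Suc k)
    have "nrm (x (n + Suc k) - x n) \<le> nrm (x (Suc (n + k)) - x (n + k)) + nrm (x (n + k) - x n)"
      using x by (simp add: nrm_triangle_mid)
    then show ?case
      using Suc incr[of "n + k"] by (simp add: s_def)
  qed simp
  have "nrm (x m - x n) < e" if "m \<ge> N" "n \<ge> N" for m n
  proof (cases "n \<le> m")
    case True
    then show ?thesis
      using le[of n "m - n"] N[of m n] that by auto
  next
    case False
    then show ?thesis
      using le[of m "n - m"] N[of n m] that x nrm_minus_commute[of "x n" "x m"] by auto
  qed
  then show "\<exists>N. \<forall>m\<ge>N. \<forall>n\<ge>N. nrm (x m - x n) < e" by blast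
qed

end

section \<open>Bounded symmetric operators: lower bounds and resolvents\<close>

locale symmetric_operator = semi_hilbert_space +
  fixes T :: "'a \<Rightarrow> 'a" and M :: real
  assumes T_mem [simp]: "u \<in> V \<Longrightarrow> T u \<in> V"
    and T_sym: "u \<in> V \<Longrightarrow> v \<in> V \<Longrightarrow> ip (T u) v = ip u (T v)"
    and T_bounded: "u \<in> V \<Longrightarrow> nrm (T u) \<le> M * nrm u"
    and M_nonneg: "0 \<le> M"
begin

definition shift :: "complex \<Rightarrow> 'a \<Rightarrow> 'a" where
  "shift w u = T u - sc w u"

text \<open>This characterises the regular points: \<open>shift w\<close> is onto as soon as
  \<open>shift (cnj w)\<close> has such a bound, and for symmetric T a bound at w entails one at
  \<open>cnj w\<close>.\<close>

definition bounded_below :: "complex \<Rightarrow> bool" where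
  "bounded_below w \<longleftrightarrow> (\<exists>c>0. \<forall>u\<in>V. c * nrm u \<le> nrm (shift w u))"

lemma shift_mem [simp]: "u \<in> V \<Longrightarrow> shift w u \<in> V"
  by (simp add: shift_def)

lemma shift_sym: "u \<in> V \<Longrightarrow> v \<in> V \<Longrightarrow> ip (shift w u) v = ip u (shift (cnj w) v)"
  by (simp add: shift_def ip_simps T_sym)

lemma ip_shift_right: "u \<in> V \<Longrightarrow> v \<in> V \<Longrightarrow> ip u (shift w v) = ip (shift (cnj w) u) v"
  by (simp add: shift_sym)

lemma shift_bounded: "u \<in> V \<Longrightarrow> nrm (shift w u) \<le> (M + cmod w) * nrm u"
  using nrm_triangle_diff[of "T u" "sc w u"] T_bounded[of u] by (simp add: shift_def algebra_simps)

text \<open>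
  An everywhere defined operator with an adjoint is linear up to null vectors.
\<close>

lemma shift_add:
  assumes "u \<in> V" "v \<in> V"
  shows "nrm (shift w (u + v) - (shift w u + shift w v)) = 0"
proof (rule null_if_orthogonal)
  fix x assume "x \<in> V"
  then show "ip x (shift w (u + v) - (shift w u + shift w v)) = 0"
    using assms by (simp add: ip_simps ip_shift_right)
qed (use assms in auto)

lemma shift_scale:
  assumes "u \<in> V"
  shows "nrm (shift w (sc c u) - sc c (shift w u)) = 0"
proof (rule null_if_orthogonal)
  fix x assume "x \<in> V"
  then show "ip x (shift w (sc c u) - sc c (shift w u)) = 0"
    using assms by (simp add: ip_simps ip_shift_right)
qed (use assms in auto)

lemma nrm_shift_scale: "u \<in> V \<Longrightarrow> nrm (shift w (sc c u)) = cmod c * nrm (shift w u)"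
  using nrm_cong[OF _ _ shift_scale[of u w c]] by simp

lemma shift_diff:
  assumes "u \<in> V" "v \<in> V"
  shows "nrm (shift w (u - v) - (shift w u - shift w v)) = 0"
proof (rule null_if_orthogonal)
  fix x assume "x \<in> V"
  then show "ip x (shift w (u - v) - (shift w u - shift w v)) = 0"
    using assms by (simp add: ip_simps ip_shift_right)
qed (use assms in auto)

lemma nrm_shift_diff:
  "u \<in> V \<Longrightarrow> v \<in> V \<Longrightarrow> nrm (shift w (u - v)) = nrm (shift w u - shift w v)"
  using nrm_cong[OF _ _ shift_diff[of u v w]] by simp

lemma shift_shift: "shift z u = shift w u + sc (w - z) u"
  by (simp add: shift_def scale_left_diff_distrib)

text \<open>By symmetry \<open>ip u (T u)\<close> is real, so the imaginary part of
  \<open>ip u (shift w u)\<close> is \<open>- Im w\<close> times the square of \<open>nrm u\<close>.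
  Cauchy--Schwarz does the rest.\<close>

lemma bounded_below_nonreal:
  assumes "Im w \<noteq> 0"
  shows "bounded_below w"
  unfolding bounded_below_def
proof (intro exI[of _ "\<bar>Im w\<bar>"] conjI ballI)
  fix u assume u: "u \<in> V"
  have "ip u (T u) = cnj (ip u (T u))"
    using u T_sym[of u u] ip_cnj[of u "T u"] by simp
  then have "Im (ip u (T u)) = 0"
    by (metis Im_complex_of_real Reals_cnj_iff complex_is_Real_iff)
  then have "\<bar>Im w\<bar> * (nrm u)\<^sup>2 = \<bar>Im (ip u (shift w u))\<bar>"
    using u by (simp add: shift_def ip_simps ip_self abs_mult)
  also have "\<dots> \<le> nrm u * nrm (shift w u)"
    using u cauchy_schwarz[of u "shift w u"] abs_Im_le_cmod[of "ip u (shift w u)"] by force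
  finally have "nrm u * (\<bar>Im w\<bar> * nrm u) \<le> nrm u * nrm (shift w u)"
    by (simp add: power2_eq_square algebra_simps)
  then show "\<bar>Im w\<bar> * nrm u \<le> nrm (shift w u)"
    using u nrm_nonneg[OF u] by (cases "nrm u = 0") (simp_all add: less_le)
qed (use assms in auto)

text \<open>Let S be \<open>shift w\<close> and S' its adjoint \<open>shift (cnj w)\<close>. As S S'
  lies between c^2 and K^2, the map taking r to r - \<tau> S S' r is a contraction for suitable
  \<tau>. Iterating it from v drives the residuals to 0 geometrically, and the sum of the
  corrections \<tau> S' r converges to a solution. This replaces the usual argument with closed
  range and orthogonal complement.\<close>

lemma surjective_if_adjoint_bounded_below:
  assumes "bounded_below (cnj w)" "v \<in> V"
  shows "\<exists>x\<in>V. nrm (shift w x - v) = 0"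
proof -
  define K where "K = M + cmod w + 1"
  have K: "K > 0"
    using M_nonneg by (simp add: K_def add_nonneg_pos)
  have bd: "nrm (shift w u) \<le> K * nrm u" "nrm (shift (cnj w) u) \<le> K * nrm u" if "u \<in> V" for u
    using shift_bounded[OF that, of w] shift_bounded[OF that, of "cnj w"] nrm_nonneg[OF that]
    by (auto simp: K_def algebra_simps)
  obtain c' where c': "c' > 0" "\<And>u. u \<in> V \<Longrightarrow> c' * nrm u \<le> nrm (shift (cnj w) u)"
    using assms unfolding bounded_below_def by blast
  \<comment> \<open>Cutting c' at K keeps \<open>c ^ 4 / K ^ 4\<close> at most 1, so that the
    radicand in q is nonnegative.\<close>
  define c where "c = min c' K"
  have c: "0 < c" "c \<le> K" "\<And>u. u \<in> V \<Longrightarrow> c * nrm u \<le> nrm (shift (cnj w) u)"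
  proof -
    fix u assume "u \<in> V"
    then have "c * nrm u \<le> c' * nrm u"
      by (intro mult_right_mono) (auto simp: c_def)
    then show "c * nrm u \<le> nrm (shift (cnj w) u)"
      using c'(2)[OF \<open>u \<in> V\<close>] by simp
  qed (use c' K in \<open>auto simp: c_def\<close>)
  \<comment> \<open>The squared contraction factor is at most 1 - 2 \<tau> c^2 + \<tau>^2 K^4. This
    \<tau> minimises the bound, and the minimum is the radicand of q.\<close>
  define \<tau> where "\<tau> = c\<^sup>2 / K ^ 4"
  define q where "q = sqrt (1 - c ^ 4 / K ^ 4)"
  have \<tau>: "\<tau> > 0" using c K by (simp add: \<tau>_def)
  have "0 < c ^ 4 / K ^ 4" "c ^ 4 / K ^ 4 \<le> 1"
    using c K by (auto simp: power_mono)
  then have q: "0 \<le> q" "q < 1" "q\<^sup>2 = 1 - c ^ 4 / K ^ 4"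
    by (auto simp: q_def real_sqrt_lt_1_iff)
  define y where "y r = sc (of_real \<tau>) (shift (cnj w) r)" for r
  have y [simp]: "y r \<in> V" if "r \<in> V" for r
    using that by (simp add: y_def)
  have contr: "nrm (r - shift w (y r)) \<le> q * nrm r" if r: "r \<in> V" for r
  proof -
    let ?s = "shift (cnj w) r"
    have s: "?s \<in> V" using r by simp
    have "nrm (r - shift w (y r)) = nrm (r + sc (of_real (- \<tau>)) (shift w ?s))"
    proof (rule nrm_cong)
      have "r - shift w (y r) - (r + sc (of_real (- \<tau>)) (shift w ?s)) = - (shift w (y r) - sc (of_real \<tau>) (shift w ?s))"
        by (simp add: algebra_simps)
      then show "nrm (r - shift w (y r) - (r + sc (of_real (- \<tau>)) (shift w ?s))) = 0"
        using shift_scale[OF s, of w "of_real \<tau>"] s r by (simp only: y_def nrm_minus shift_mem diff_mem sc_mem)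
    qed (use r s in auto)
    then have "(nrm (r - shift w (y r)))\<^sup>2 =
        (nrm r)\<^sup>2 + 2 * Re (ip r (sc (of_real (- \<tau>)) (shift w ?s))) + (nrm (sc (of_real (- \<tau>)) (shift w ?s)))\<^sup>2"
      using r by (simp only: nrm_sq_add shift_mem sc_mem)
    also have "ip r (sc (of_real (- \<tau>)) (shift w ?s)) = of_real (- \<tau>) * ip r (shift w ?s)"
      using r by (simp only: ip_sc_right shift_mem)
    also have "ip r (shift w ?s) = of_real ((nrm ?s)\<^sup>2)"
      using r s shift_sym[of r ?s "cnj w"] by (simp only: ip_self complex_cnj_cnj)
    also have "(nrm (sc (of_real (- \<tau>)) (shift w ?s)))\<^sup>2 = \<tau>\<^sup>2 * (nrm (shift w ?s))\<^sup>2"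
      using r by (simp add: power_mult_distrib del: scale_minus_left of_real_minus)
    finally have eq: "(nrm (r - shift w (y r)))\<^sup>2 =
        (nrm r)\<^sup>2 - 2 * \<tau> * (nrm ?s)\<^sup>2 + \<tau>\<^sup>2 * (nrm (shift w ?s))\<^sup>2"
      by (simp add: algebra_simps)
    have "(c * nrm r)\<^sup>2 \<le> (nrm ?s)\<^sup>2"
      using c r by (intro power_mono) auto
    then have 1: "\<tau> * (c\<^sup>2 * (nrm r)\<^sup>2) \<le> \<tau> * (nrm ?s)\<^sup>2"
      using \<tau> by (intro mult_left_mono) (auto simp: power_mult_distrib)
    have "nrm (shift w ?s) \<le> K * (K * nrm r)"
      using bd(1)[OF s] mult_left_mono[OF bd(2)[OF r], of K] K by linarith
    then have "(nrm (shift w ?s))\<^sup>2 \<le> (K * (K * nrm r))\<^sup>2"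
      using r by (intro power_mono) auto
    then have 2: "\<tau>\<^sup>2 * (nrm (shift w ?s))\<^sup>2 \<le> \<tau>\<^sup>2 * (K ^ 4 * (nrm r)\<^sup>2)"
      by (intro mult_left_mono) (auto simp: power_mult_distrib power4_eq_xxxx power2_eq_square algebra_simps)
    have "\<tau>\<^sup>2 * (K ^ 4 * (nrm r)\<^sup>2) = c ^ 4 / K ^ 4 * (nrm r)\<^sup>2"
      using K by (simp add: \<tau>_def field_simps power2_eq_square power4_eq_xxxx)
    moreover have "\<tau> * (c\<^sup>2 * (nrm r)\<^sup>2) = c ^ 4 / K ^ 4 * (nrm r)\<^sup>2"
      using K by (simp add: \<tau>_def field_simps power2_eq_square power4_eq_xxxx)
    ultimately have "(nrm (r - shift w (y r)))\<^sup>2 \<le> (nrm r)\<^sup>2 - c ^ 4 / K ^ 4 * (nrm r)\<^sup>2"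
      using eq 1 2 by linarith
    also have "\<dots> = (q * nrm r)\<^sup>2"
      unfolding power_mult_distrib q(3) by (simp add: algebra_simps)
    finally have "(nrm (r - shift w (y r)))\<^sup>2 \<le> (q * nrm r)\<^sup>2" .
    then show ?thesis
      by (rule power2_le_imp_le) (use q r in simp)
  qed
  define r where "r = rec_nat v (\<lambda>_ r. r - shift w (y r))"
  have r0: "r 0 = v" and rS: "r (Suc n) = r n - shift w (y (r n))" for n
    by (auto simp: r_def)
  define x where "x n = (\<Sum>i<n. y (r i))" for n
  have r_mem [simp]: "r n \<in> V" for n
    by (induction n) (auto simp: r0 rS assms)
  have x_mem [simp]: "x n \<in> V" for n
    unfolding x_def by (intro sum_mem) auto
  have r_le: "nrm (r n) \<le> nrm v * q ^ n" for n
  proof (induction n)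
    case (Suc n)
    have "nrm (r (Suc n)) \<le> q * nrm (r n)"
      using contr by (simp add: rS)
    also have "\<dots> \<le> q * (nrm v * q ^ n)"
      using Suc q by (intro mult_left_mono) auto
    finally show ?case by (simp add: algebra_simps)
  qed (simp add: r0)
  \<comment> \<open>The corrections telescope: \<open>x n\<close> solves the equation up to the
    residual \<open>r n\<close>, modulo null vectors because \<open>shift w\<close> is additive only
    modulo these.\<close>
  have resid: "nrm (shift w (x n) - (v - r n)) = 0" for n
  proof (induction n)
    case 0
    then show ?case
      using nrm_shift_scale[of 0 w 0] by (simp add: x_def r0)
  next
    case (Suc n)
    have "nrm (shift w (x (Suc n)) - (v - r (Suc n))) =
        nrm ((shift w (x n + y (r n)) - (shift w (x n) + shift w (y (r n)))) + (shift w (x n) - (v - r n)))"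
      by (simp add: x_def rS algebra_simps)
    also have "\<dots> \<le> nrm (shift w (x n + y (r n)) - (shift w (x n) + shift w (y (r n)))) + nrm (shift w (x n) - (v - r n))"
      by (intro nrm_triangle) (auto simp: assms)
    also have "\<dots> = 0"
      using Suc by (simp add: shift_add)
    finally show ?case
      using nrm_nonneg[of "shift w (x (Suc n)) - (v - r (Suc n))"] assms by simp
  qed
  have "nrm (x (Suc n) - x n) \<le> (\<tau> * K * nrm v) * q ^ n" for n
  proof -
    have "nrm (x (Suc n) - x n) = \<tau> * nrm (shift (cnj w) (r n))"
      using \<tau> by (simp add: x_def y_def)
    also have "\<dots> \<le> \<tau> * (K * (nrm v * q ^ n))"
      using \<tau> K order_trans[OF bd(2)[of "r n"] mult_left_mono[OF r_le[of n], of K]]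
      by (intro mult_left_mono) auto
    finally show ?thesis by (simp add: algebra_simps)
  qed
  then obtain X where X: "X \<in> V" "(\<lambda>n. nrm (x n - X)) \<longlonglongrightarrow> 0"
    using limit_of_geometric_increments[of x q] q by auto
  have "nrm (shift w X - v) \<le> K * nrm (x n - X) + nrm v * q ^ n" for n
  proof -
    have "nrm (shift w X - v) \<le> nrm (shift w X - shift w (x n)) + nrm (shift w (x n) - v)"
      using X assms by (intro nrm_triangle_mid) auto
    also have "nrm (shift w X - shift w (x n)) \<le> K * nrm (x n - X)"
      using bd(1)[of "X - x n"] X nrm_minus_commute[of X "x n"] by (simp add: nrm_shift_diff)
    also have "nrm (shift w (x n) - v) \<le> nrm (shift w (x n) - (v - r n)) + nrm (- r n)"
      using nrm_triangle[of "shift w (x n) - (v - r n)" "- r n"] assms by (simp del: nrm_minus)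
    also have "\<dots> \<le> nrm v * q ^ n"
      using resid r_le by simp
    finally show ?thesis by simp
  qed
  moreover have "(\<lambda>n. K * nrm (x n - X) + nrm v * q ^ n) \<longlonglongrightarrow> K * 0 + nrm v * 0"
    using q by (intro tendsto_intros X(2) LIMSEQ_power_zero) auto
  ultimately have "nrm (shift w X - v) \<le> 0"
    by (intro LIMSEQ_le_const[of _ 0]) auto
  then show ?thesis
    using X assms nrm_nonneg[of "shift w X - v"] by (intro bexI[of _ X]) auto
qed

text \<open>R selects one of many solutions, which differ by null vectors. The lower bound gives
  uniqueness in this sense (\<open>uniq\<close>), and the linearity of R follows by applying
  \<open>shift w\<close> to both sides.\<close>

lemma resolvent_exists:
  assumes bb: "bounded_below w" "bounded_below (cnj w)"
  shows "\<exists>R. (\<forall>u\<in>V. R u \<in> V) \<and>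
    (\<forall>u\<in>V. \<forall>v\<in>V. nrm (R (u + v) - (R u + R v)) = 0) \<and>
    (\<forall>c. \<forall>u\<in>V. nrm (R (sc c u) - sc c (R u)) = 0) \<and>
    (\<exists>K. \<forall>u\<in>V. nrm (R u) \<le> K * nrm u) \<and>
    (\<forall>u\<in>V. nrm (R (T u - sc w u) - u) = 0 \<and> nrm (T (R u) - sc w (R u) - u) = 0)"
proof -
  obtain c where c: "c > 0" "\<And>u. u \<in> V \<Longrightarrow> c * nrm u \<le> nrm (shift w u)"
    using bb unfolding bounded_below_def by blast
  have "\<forall>v\<in>V. \<exists>x. x \<in> V \<and> nrm (shift w x - v) = 0"
    using surjective_if_adjoint_bounded_below[OF bb(2)] by blast
  then obtain R where R: "\<And>v. v \<in> V \<Longrightarrow> R v \<in> V" "\<And>v. v \<in> V \<Longrightarrow> nrm (shift w (R v) - v) = 0"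
    by metis
  have uniq: "nrm (x - y) = 0" if "x \<in> V" "y \<in> V" "nrm (shift w x - shift w y) = 0" for x y
  proof -
    have "c * nrm (x - y) \<le> 0"
      using c(2)[of "x - y"] that by (simp add: nrm_shift_diff)
    then show ?thesis
      using c(1) that nrm_nonneg[of "x - y"] by (simp add: mult_le_0_iff)
  qed
  have null_add: "nrm (x + y) = 0" if "x \<in> V" "y \<in> V" "nrm x = 0" "nrm y = 0" for x y
    using nrm_triangle[of x y] nrm_nonneg[of "x + y"] that by simp
  have add: "nrm (R (u + v) - (R u + R v)) = 0" if "u \<in> V" "v \<in> V" for u v
  proof (rule uniq)
    have "shift w (R (u + v)) - shift w (R u + R v) =
      (shift w (R (u + v)) - (u + v)) + (- (shift w (R u) - u) + (- (shift w (R v) - v)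
        + - (shift w (R u + R v) - (shift w (R u) + shift w (R v)))))"
      by simp
    also have "nrm \<dots> = 0"
      using that R by (intro null_add) (simp_all only: nrm_minus shift_add add_mem shift_mem diff_mem uminus_mem)
    finally show "nrm (shift w (R (u + v)) - shift w (R u + R v)) = 0" .
  qed (use that R in auto)
  have scl: "nrm (R (sc a u) - sc a (R u)) = 0" if "u \<in> V" for a u
  proof (rule uniq)
    have "shift w (R (sc a u)) - shift w (sc a (R u)) =
      (shift w (R (sc a u)) - sc a u) + (- (shift w (sc a (R u)) - sc a (shift w (R u))) + - sc a (shift w (R u) - u))"
      by (simp add: scale_right_diff_distrib)
    also have "nrm \<dots> = 0"
      using that R by (intro null_add) (simp_all only: nrm_minus nrm_sc shift_scale sc_mem add_mem shift_mem diff_mem uminus_mem mult_zero_right)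
    finally show "nrm (shift w (R (sc a u)) - shift w (sc a (R u))) = 0" .
  qed (use that R in auto)
  have bound: "nrm (R u) \<le> 1 / c * nrm u" if "u \<in> V" for u
    using c(2)[of "R u"] c(1) R that nrm_cong[of "shift w (R u)" u] by (simp add: field_simps)
  have "nrm (R (shift w u) - u) = 0" if "u \<in> V" for u
    by (rule uniq) (use that R in auto)
  then show ?thesis
    using R add scl bound unfolding shift_def by (intro exI[of _ R] conjI exI[of _ "1 / c"]) auto
qed

lemma bounded_below_if_left_inverse:
  assumes R: "\<And>u. u \<in> V \<Longrightarrow> R u \<in> V" "\<And>u. u \<in> V \<Longrightarrow> nrm (R u) \<le> K * nrm u"
    "\<And>u. u \<in> V \<Longrightarrow> nrm (R (T u - sc w u) - u) = 0"
  shows "bounded_below w"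
  unfolding bounded_below_def
proof (intro exI[of _ "1 / (\<bar>K\<bar> + 1)"] conjI ballI)
  fix u assume u: "u \<in> V"
  have "nrm u = nrm (R (shift w u))"
    using R u nrm_cong[of "R (shift w u)" u] by (simp add: shift_def)
  also have "\<dots> \<le> K * nrm (shift w u)"
    using R u by simp
  also have "\<dots> \<le> (\<bar>K\<bar> + 1) * nrm (shift w u)"
    using u by (intro mult_right_mono) auto
  finally show "1 / (\<bar>K\<bar> + 1) * nrm u \<le> nrm (shift w u)"
    by (simp add: field_simps)
qed auto

lemma unit_vector_if_not_bounded_below:
  assumes "\<not> bounded_below w" "0 < c"
  shows "\<exists>u\<in>V. nrm u = 1 \<and> nrm (shift w u) < c"
proof -
  obtain v where v: "v \<in> V" "nrm (shift w v) < c * nrm v"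
    using assms unfolding bounded_below_def by force
  then have pos: "nrm v > 0"
    using nrm_nonneg[of "shift w v"] nrm_nonneg[of v] by (cases "nrm v = 0") (simp_all add: less_le)
  show ?thesis
  proof (intro bexI[of _ "sc (of_real (1 / nrm v)) v"] conjI)
    show "nrm (sc (of_real (1 / nrm v)) v) = 1"
      using v pos by (simp add: norm_divide)
    show "nrm (shift w (sc (of_real (1 / nrm v)) v)) < c"
      using v pos by (simp add: nrm_shift_scale norm_divide field_simps)
  qed (use v in simp)
qed

end

text \<open>
  By \<open>estimate\<close>, \<open>T - z\<close> is bounded below up to finitely many functionals, hence semi-Fredholm.
\<close>

locale semi_fredholm_at = symmetric_operator +
  fixes z C L :: real and I :: "'i set" and ell :: "'i \<Rightarrow> 'a \<Rightarrow> complex"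
  assumes finite_I: "finite I"
    and ell_add: "i \<in> I \<Longrightarrow> u \<in> V \<Longrightarrow> v \<in> V \<Longrightarrow> ell i (u + v) = ell i u + ell i v"
    and ell_scale: "i \<in> I \<Longrightarrow> u \<in> V \<Longrightarrow> ell i (sc c u) = c * ell i u"
    and ell_bounded: "i \<in> I \<Longrightarrow> u \<in> V \<Longrightarrow> cmod (ell i u) \<le> L * nrm u"
    and estimate: "u \<in> V \<Longrightarrow>
      nrm u \<le> C * (nrm (shift (of_real z) u) + (\<Sum>i\<in>I. cmod (ell i u)))"
begin

lemma ell_diff: "i \<in> I \<Longrightarrow> u \<in> V \<Longrightarrow> v \<in> V \<Longrightarrow> ell i (u - v) = ell i u - ell i v"
  using ell_add[of i u "- v"] ell_scale[of i v "-1"] by simp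

text \<open>The values of the finitely many functionals converge along a subsequence. On differences
  of its terms the right-hand side of \<open>estimate\<close> becomes arbitrarily small, so the
  subsequence is Cauchy.\<close>

lemma convergent_subsequence:
  assumes x: "\<And>n. x n \<in> V" "\<And>n. nrm (x n) = 1"
    and lim: "(\<lambda>n. nrm (shift (of_real z) (x n))) \<longlonglongrightarrow> 0"
  shows "\<exists>r y. strict_mono (r :: nat \<Rightarrow> nat) \<and> y \<in> V \<and> (\<lambda>n. nrm (x (r n) - y)) \<longlonglongrightarrow> 0"
proof -
  have "bounded (range (\<lambda>n. ell i (x n)))" if "i \<in> I" for i
    unfolding bounded_iff using ell_bounded[OF that x(1)] x(2) by auto
  then obtain r where r: "strict_mono (r :: nat \<Rightarrow> nat)" "\<forall>i\<in>I. convergent (\<lambda>n. ell i (x (r n)))"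
    using convergent_subseq_finite[OF finite_I, of "\<lambda>i n. ell i (x n)"] by blast
  have lim': "(\<lambda>n. nrm (shift (of_real z) (x (r n)))) \<longlonglongrightarrow> 0"
    using LIMSEQ_subseq_LIMSEQ[OF lim r(1)] by (simp add: o_def)
  have "\<exists>y\<in>V. (\<lambda>n. nrm (x (r n) - y)) \<longlonglongrightarrow> 0"
  proof (rule complete)
    fix e :: real assume e: "0 < e"
    define C' where "C' = \<bar>C\<bar> + 1"
    \<comment> \<open>The estimate will give at most \<open>C' * (2 * d + card I * d)\<close>, which
      is strictly below e.\<close>
    define d where "d = e / (C' * (card I + 3))"
    have d: "d > 0" using e by (simp add: d_def C'_def)
    have "\<forall>i\<in>I. \<exists>N. \<forall>m\<ge>N. \<forall>n\<ge>N. cmod (ell i (x (r m)) - ell i (x (r n))) < d"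
    proof
      fix i assume "i \<in> I"
      then have "Cauchy (\<lambda>n. ell i (x (r n)))"
        using r(2) convergent_Cauchy by blast
      then show "\<exists>N. \<forall>m\<ge>N. \<forall>n\<ge>N. cmod (ell i (x (r m)) - ell i (x (r n))) < d"
        using d unfolding Cauchy_def dist_norm by blast
    qed
    then obtain N where N: "\<And>i m n. i \<in> I \<Longrightarrow> m \<ge> N i \<Longrightarrow> n \<ge> N i \<Longrightarrow> cmod (ell i (x (r m)) - ell i (x (r n))) < d"
      by metis
    obtain N0 where N0: "\<And>n. n \<ge> N0 \<Longrightarrow> nrm (shift (of_real z) (x (r n))) < d"
      using LIMSEQ_D[OF lim' d] x(1) by fastforce
    define N1 where "N1 = Max (insert N0 (N ` I))"
    have N1: "N0 \<le> N1" "\<And>i. i \<in> I \<Longrightarrow> N i \<le> N1"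
      using finite_I by (auto simp: N1_def)
    have "nrm (x (r m) - x (r n)) < e" if mn: "m \<ge> N1" "n \<ge> N1" for m n
    proof -
      let ?u = "x (r m) - x (r n)"
      have "nrm (shift (of_real z) ?u) \<le> nrm (shift (of_real z) (x (r m))) + nrm (shift (of_real z) (x (r n)))"
        using x by (simp add: nrm_shift_diff nrm_triangle_diff)
      then have 1: "nrm (shift (of_real z) ?u) \<le> 2 * d"
        using N0[of m] N0[of n] N1 mn by simp
      have 2: "(\<Sum>i\<in>I. cmod (ell i ?u)) \<le> card I * d"
      proof (rule sum_bounded_above)
        fix i assume "i \<in> I"
        then show "cmod (ell i ?u) \<le> d"
          using N[of i "m" "n"] N1(2)[of i] mn x by (simp add: ell_diff)
      qed
      have "nrm ?u \<le> C * (nrm (shift (of_real z) ?u) + (\<Sum>i\<in>I. cmod (ell i ?u)))"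
        using x estimate by simp
      also have "\<dots> \<le> C' * (nrm (shift (of_real z) ?u) + (\<Sum>i\<in>I. cmod (ell i ?u)))"
        using x by (intro mult_right_mono) (auto simp: C'_def intro!: add_nonneg_nonneg sum_nonneg)
      also have "\<dots> \<le> C' * (2 * d + card I * d)"
        using 1 2 by (intro mult_left_mono) (auto simp: C'_def)
      also have "\<dots> < C' * (d * (card I + 3))"
        using d by (intro mult_strict_left_mono) (auto simp: C'_def algebra_simps)
      also have "\<dots> = e"
        by (simp add: d_def C'_def field_simps add_nonneg_eq_0_iff)
      finally show ?thesis .
    qed
    then show "\<exists>N. \<forall>m\<ge>N. \<forall>n\<ge>N. nrm (x (r m) - x (r n)) < e" by blast
  qed (use x in auto)
  then show ?thesis using r by blast
qed

lemma null_limit: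
  assumes x: "\<And>n. x n \<in> V" "y \<in> V" "(\<lambda>n. nrm (x n - y)) \<longlonglongrightarrow> 0"
    and lim: "(\<lambda>n. nrm (shift w (x n))) \<longlonglongrightarrow> 0"
  shows "nrm (shift w y) = 0"
proof -
  have "nrm (shift w y) \<le> nrm (shift w (x n)) + (M + cmod w) * nrm (x n - y)" for n
  proof -
    have "nrm (shift w y) \<le> nrm (shift w (x n)) + nrm (shift w y - shift w (x n))"
      using x by (intro nrm_triangle_sub) auto
    also have "nrm (shift w y - shift w (x n)) = nrm (shift w (x n - y))"
      using x nrm_minus_commute[of "shift w y" "shift w (x n)"] by (simp add: nrm_shift_diff)
    also have "\<dots> \<le> (M + cmod w) * nrm (x n - y)"
      using x by (intro shift_bounded) auto
    finally show ?thesis by simp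
  qed
  moreover have "(\<lambda>n. nrm (shift w (x n)) + (M + cmod w) * nrm (x n - y)) \<longlonglongrightarrow> 0 + (M + cmod w) * 0"
    by (intro tendsto_intros lim x)
  ultimately have "nrm (shift w y) \<le> 0"
    by (intro LIMSEQ_le_const[of _ 0]) auto
  then show ?thesis
    using x nrm_nonneg[of "shift w y"] by simp
qed

lemma eigenvector_if_not_bounded_below:
  assumes "\<not> bounded_below (of_real z)"
  shows "\<exists>u\<in>V. nrm u = 1 \<and> nrm (shift (of_real z) u) = 0"
proof -
  have "\<forall>n. \<exists>u. u \<in> V \<and> nrm u = 1 \<and> nrm (shift (of_real z) u) < inverse (Suc n)"
    using unit_vector_if_not_bounded_below[OF assms] by (metis inverse_positive_iff_positive of_nat_0_less_iff zero_less_Suc)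
  then obtain x where x: "\<And>n. x n \<in> V" "\<And>n. nrm (x n) = 1"
    "\<And>n. nrm (shift (of_real z) (x n)) < inverse (Suc n)"
    by metis
  have lim: "(\<lambda>n. nrm (shift (of_real z) (x n))) \<longlonglongrightarrow> 0"
    by (intro Lim_null_comparison[OF _ LIMSEQ_inverse_real_of_nat])
      (use x in \<open>auto intro!: always_eventually less_imp_le\<close>)
  then obtain r y where r: "strict_mono (r :: nat \<Rightarrow> nat)" and y: "y \<in> V" "(\<lambda>n. nrm (x (r n) - y)) \<longlonglongrightarrow> 0"
    using convergent_subsequence[OF x(1,2) lim] by blast
  have "nrm (shift (of_real z) y) = 0"
    by (rule null_limit[of "\<lambda>n. x (r n)"]) (use x y LIMSEQ_subseq_LIMSEQ[OF lim r] in \<open>auto simp: o_def\<close>)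
  moreover have "nrm y = 1"
    using tendsto_nrm[of "\<lambda>n. x (r n)" y] x y by (simp add: LIMSEQ_const_iff)
  ultimately show ?thesis using y by blast
qed

text \<open>A quantitative form of the orthogonality of eigenvectors to different eigenvalues. If
  points w n without lower bound tend to z, unit vectors x n almost annihilated by
  \<open>shift (w n)\<close> accumulate at an eigenvector y for z. But \<open>ip y (x n)\<close>
  tends to 0, whereas along the subsequence it would have to approach
  \<open>ip y y = 1\<close>.\<close>

lemma bounded_below_near:
  "\<exists>d>0. \<forall>w. 0 < dist w (of_real z) \<and> dist w (of_real z) < d \<longrightarrow> bounded_below w"
proof (rule ccontr)
  assume "\<not> ?thesis"
  then have "\<forall>n. \<exists>w. 0 < dist w (of_real z) \<and> dist w (of_real z) < inverse (Suc n) \<and> \<not> bounded_below w"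
    by (metis inverse_positive_iff_positive of_nat_0_less_iff zero_less_Suc)
  then obtain w where w: "\<And>n. 0 < cmod (w n - of_real z)"
      "\<And>n. cmod (w n - of_real z) < inverse (Suc n)" "\<And>n. \<not> bounded_below (w n)"
    unfolding dist_norm by metis
  \<comment> \<open>The defect of \<open>x n\<close> must be small relative to the distance of
    \<open>w n\<close> from z, since \<open>small\<close> divides by that distance.\<close>
  define c where "c n = cmod (w n - of_real z) * inverse (Suc n)" for n
  have c: "c n > 0" for n
    using w(1) by (simp add: c_def)
  have "\<forall>n. \<exists>u. u \<in> V \<and> nrm u = 1 \<and> nrm (shift (w n) u) < c n"
    using unit_vector_if_not_bounded_below[OF w(3) c] by blast
  then obtain x where x: "\<And>n. x n \<in> V" "\<And>n. nrm (x n) = 1" "\<And>n. nrm (shift (w n) (x n)) < c n"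
    by metis
  have le: "nrm (shift (of_real z) (x n)) \<le> 2 * inverse (Suc n)" for n
  proof -
    have "nrm (shift (of_real z) (x n)) \<le> nrm (shift (w n) (x n)) + cmod (w n - of_real z)"
      using nrm_triangle[of "shift (w n) (x n)" "sc (w n - of_real z) (x n)"] x
      by (simp add: shift_shift[of "of_real z" _ "w n"])
    moreover have "c n \<le> cmod (w n - of_real z)"
      unfolding c_def by (intro mult_left_le) (auto simp: field_simps)
    ultimately show ?thesis
      using w(2)[of n] x(3)[of n] by linarith
  qed
  have g: "(\<lambda>n. 2 * inverse (Suc n)) \<longlonglongrightarrow> 0"
    using tendsto_mult[OF tendsto_const LIMSEQ_inverse_real_of_nat, of 2] by simp
  have lim: "(\<lambda>n. nrm (shift (of_real z) (x n))) \<longlonglongrightarrow> 0"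
    by (rule real_tendsto_sandwich[OF _ _ tendsto_const g]) (use le x in auto)
  obtain r y where r: "strict_mono (r :: nat \<Rightarrow> nat)" and y: "y \<in> V" "(\<lambda>n. nrm (x (r n) - y)) \<longlonglongrightarrow> 0"
    using convergent_subsequence[OF x(1,2) lim] by blast
  have null: "nrm (shift (of_real z) y) = 0"
    by (rule null_limit[of "\<lambda>n. x (r n)"]) (use x y LIMSEQ_subseq_LIMSEQ[OF lim r] in \<open>auto simp: o_def\<close>)
  have y1: "nrm y = 1"
    using tendsto_nrm[of "\<lambda>n. x (r n)" y] x y by (simp add: LIMSEQ_const_iff)
  have small: "cmod (ip y (x n)) \<le> inverse (Suc n)" for n
  proof -
    have "ip (shift (of_real z) y) (x n) = 0"
      using cauchy_schwarz[of "shift (of_real z) y" "x n"] null x y by simp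
    then have "ip (shift (cnj (w n)) y) (x n) = (of_real z - w n) * ip y (x n)"
      using x y by (simp add: shift_shift[of "cnj (w n)" _ "of_real z"] ip_simps)
    then have "cmod (w n - of_real z) * cmod (ip y (x n)) = cmod (ip y (shift (w n) (x n)))"
      using x y shift_sym[of y "x n" "cnj (w n)"] by (simp add: norm_mult norm_minus_commute)
    also have "\<dots> \<le> nrm (shift (w n) (x n))"
      using cauchy_schwarz[of y "shift (w n) (x n)"] x y y1 by simp
    also have "\<dots> \<le> cmod (w n - of_real z) * inverse (Suc n)"
      using x(3)[of n] by (simp add: c_def)
    finally show ?thesis
      using w(1)[of n] by (simp add: mult_le_cancel_left)
  qed
  have "1 \<le> inverse (Suc n) + nrm (x (r n) - y)" for n
  proof -
    have "inverse (Suc (r n)) \<le> inverse (real (Suc n))"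
      using seq_suble[OF r, of n] by (simp add: field_simps)
    moreover have "1 = cmod (ip y (x (r n)) - ip y (x (r n) - y))"
      using x y y1 by (simp add: ip_simps ip_self)
    moreover have "\<dots> \<le> cmod (ip y (x (r n))) + cmod (ip y (x (r n) - y))"
      by (rule norm_triangle_ineq4)
    moreover have "cmod (ip y (x (r n) - y)) \<le> nrm (x (r n) - y)"
      using cauchy_schwarz[of y "x (r n) - y"] x y y1 by simp
    ultimately show ?thesis
      using small[of "r n"] by linarith
  qed
  moreover have "(\<lambda>n. inverse (Suc n) + nrm (x (r n) - y)) \<longlonglongrightarrow> 0 + 0"
    by (intro tendsto_add LIMSEQ_inverse_real_of_nat y)
  ultimately have "1 \<le> (0 :: real)"
    by (intro LIMSEQ_le_const[of _ 0]) auto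
  then show False by simp
qed

text \<open>On the kernel only the functionals remain on the right-hand side of
  \<open>estimate\<close>, so they separate its vectors up to null vectors.\<close>

lemma finite_dimensional_kernel:
  "\<exists>B. finite B \<and> B \<subseteq> V \<and>
    (\<forall>u\<in>V. nrm (shift (of_real z) u) = 0 \<longrightarrow> (\<exists>c. nrm (u - (\<Sum>b\<in>B. sc (c b) b)) = 0))"
proof -
  let ?N = "{u \<in> V. nrm (shift (of_real z) u) = 0}"
  have "\<exists>B. finite B \<and> B \<subseteq> ?N \<and> (\<forall>u\<in>?N. \<exists>c. nrm (u - (\<Sum>b\<in>B. sc (c b) b)) = 0)"
  proof (rule finite_span_if_finite_separating[OF finite_I, where ell = ell])
    fix u v assume uv: "u \<in> ?N" "v \<in> ?N"
    then have "nrm (shift (of_real z) (u + v)) \<le> 0"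
      using nrm_cong[OF _ _ shift_add[of u v "of_real z"]]
        nrm_triangle[of "shift (of_real z) u" "shift (of_real z) v"] by simp
    then show "u + v \<in> ?N"
      using uv nrm_nonneg[of "shift (of_real z) (u + v)"] by auto
  next
    fix u assume u: "u \<in> ?N" "\<forall>i\<in>I. ell i u = 0"
    then show "nrm u = 0"
      using estimate[of u] nrm_nonneg[of u] by simp
  qed (auto simp: nrm_shift_scale ell_add ell_scale)
  then show ?thesis by blast
qed

end

section \<open>Square integrable functions\<close>

definition ip_L2 :: "('a::euclidean_space \<Rightarrow> complex) \<Rightarrow> ('a \<Rightarrow> complex) \<Rightarrow> complex" where
  "ip_L2 f g = (\<integral>x. cnj (f x) * g x \<partial>lborel)"

lemma ip_L2_self: "ip_L2 f f = of_real (\<integral>x. (cmod (f x))\<^sup>2 \<partial>lborel)"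
proof -
  have "ip_L2 f f = (\<integral>x. of_real ((cmod (f x))\<^sup>2) \<partial>lborel)"
    unfolding ip_L2_def by (intro Bochner_Integration.integral_cong refl) (metis complex_norm_square mult.commute)
  then show ?thesis
    by (simp only: integral_complex_of_real)
qed

lemma L2I:
  "f \<in> borel_measurable borel \<Longrightarrow> integrable lborel (\<lambda>x. (cmod (f x))\<^sup>2) \<Longrightarrow> f \<in> L2"
  by (simp add: L2_def)

lemma L2_measurable [measurable_dest]: "f \<in> L2 \<Longrightarrow> f \<in> borel_measurable borel"
  by (simp add: L2_def)

lemma L2_integrable: "f \<in> L2 \<Longrightarrow> integrable lborel (\<lambda>x. (cmod (f x))\<^sup>2)"
  by (simp add: L2_def)

lemma L2_dominated:
  assumes "g \<in> L2" "f \<in> borel_measurable borel"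
    and "AE x in lborel. cmod (f x) \<le> K * cmod (g x)"
  shows "f \<in> L2"
proof (rule L2I)
  show "integrable lborel (\<lambda>x. (cmod (f x))\<^sup>2)"
  proof (rule Bochner_Integration.integrable_bound)
    show "integrable lborel (\<lambda>x. K\<^sup>2 * (cmod (g x))\<^sup>2)"
      using assms by (simp add: L2_integrable)
    show "AE x in lborel. norm ((cmod (f x))\<^sup>2) \<le> norm (K\<^sup>2 * (cmod (g x))\<^sup>2)"
      using assms(3)
    proof eventually_elim
      case (elim x)
      then have "(cmod (f x))\<^sup>2 \<le> (K * cmod (g x))\<^sup>2"
        by (intro power_mono) auto
      then show ?case by (simp add: power_mult_distrib)
    qed
  qed (use assms(2) in measurable)
qed (use assms in auto)

lemma norm_L2_nonneg [simp]: "0 \<le> norm_L2 f"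
  by (simp add: norm_L2_def)

lemma norm_L2_sq: "(norm_L2 f)\<^sup>2 = (\<integral>x. (cmod (f x))\<^sup>2 \<partial>lborel)"
  by (simp add: norm_L2_def)

lemma norm_L2_le:
  assumes "g \<in> L2" "f \<in> borel_measurable borel" "0 \<le> K"
    and "AE x in lborel. cmod (f x) \<le> K * cmod (g x)"
  shows "norm_L2 f \<le> K * norm_L2 g"
proof -
  have "(\<integral>x. (cmod (f x))\<^sup>2 \<partial>lborel) \<le> (\<integral>x. K\<^sup>2 * (cmod (g x))\<^sup>2 \<partial>lborel)"
  proof (rule integral_mono_AE)
    show "integrable lborel (\<lambda>x. (cmod (f x))\<^sup>2)"
      using L2_dominated[OF assms(1,2,4)] by (rule L2_integrable)
    show "AE x in lborel. (cmod (f x))\<^sup>2 \<le> K\<^sup>2 * (cmod (g x))\<^sup>2"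
      using assms(4) by eventually_elim (simp add: power_mono flip: power_mult_distrib)
  qed (use assms in \<open>simp add: L2_integrable\<close>)
  then have "norm_L2 f \<le> sqrt (K\<^sup>2 * (\<integral>x. (cmod (g x))\<^sup>2 \<partial>lborel))"
    by (simp add: norm_L2_def)
  then show ?thesis
    using assms(3) by (simp add: real_sqrt_mult norm_L2_def)
qed

lemma L2_add:
  assumes "f \<in> L2" "g \<in> L2"
  shows "f + g \<in> L2"
proof (rule L2I)
  have [measurable]: "f \<in> borel_measurable borel" "g \<in> borel_measurable borel"
    using assms by (auto simp: L2_measurable)
  show "integrable lborel (\<lambda>x. (cmod ((f + g) x))\<^sup>2)"
  proof (rule Bochner_Integration.integrable_bound)
    show "integrable lborel (\<lambda>x. 2 * (cmod (f x))\<^sup>2 + 2 * (cmod (g x))\<^sup>2)"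
      using assms by (simp add: L2_integrable)
    have "(cmod (a + b))\<^sup>2 \<le> 2 * (cmod a)\<^sup>2 + 2 * (cmod b)\<^sup>2" for a b :: complex
    proof -
      have "(cmod (a + b))\<^sup>2 \<le> (cmod a + cmod b)\<^sup>2"
        by (intro power_mono norm_triangle_ineq) auto
      also have "\<dots> \<le> 2 * (cmod a)\<^sup>2 + 2 * (cmod b)\<^sup>2"
        using sum_squares_bound[of "cmod a" "cmod b"] by (simp add: power2_sum)
      finally show ?thesis .
    qed
    then show "AE x in lborel. norm ((cmod ((f + g) x))\<^sup>2) \<le> norm (2 * (cmod (f x))\<^sup>2 + 2 * (cmod (g x))\<^sup>2)"
      by (auto intro!: AE_I2)
  qed (simp add: plus_fun_def)
qed (use assms in \<open>auto simp: plus_fun_def L2_measurable\<close>)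

lemma L2_mult_bounded:
  assumes "f \<in> L2" "m \<in> borel_measurable borel" "\<And>x. cmod (m x) \<le> K"
  shows "(\<lambda>x. m x * f x) \<in> L2" "norm_L2 (\<lambda>x. m x * f x) \<le> K * norm_L2 f"
proof -
  have K: "0 \<le> K"
    using assms(3) order_trans[OF norm_ge_zero] by blast
  have [measurable]: "f \<in> borel_measurable borel"
    using assms by (auto simp: L2_measurable)
  have *: "AE x in lborel. cmod (m x * f x) \<le> K * cmod (f x)"
    using assms(3) by (auto simp: norm_mult mult_right_mono)
  show "(\<lambda>x. m x * f x) \<in> L2"
    by (rule L2_dominated[OF assms(1) _ *]) (use assms(2) in measurable)
  show "norm_L2 (\<lambda>x. m x * f x) \<le> K * norm_L2 f"
    by (rule norm_L2_le[OF assms(1) _ K *]) (use assms(2) in measurable)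
qed

lemma L2_scale: "f \<in> L2 \<Longrightarrow> (\<lambda>x. c * f x) \<in> L2"
  using L2_mult_bounded(1)[of f "\<lambda>_. c" "cmod c"] by simp

lemma borel_measurable_cnj [measurable]: "cnj \<in> borel_measurable borel"
  by (intro borel_measurable_continuous_onI continuous_intros)

lemma L2_cnj: "f \<in> L2 \<Longrightarrow> (\<lambda>x. cnj (f x)) \<in> L2"
  by (auto simp: L2_def)

lemma norm_L2_cnj [simp]: "norm_L2 (\<lambda>x. cnj (f x)) = norm_L2 f"
  by (simp add: norm_L2_def)

lemma L2_zero: "0 \<in> L2"
  by (auto simp: L2_def zero_fun_def)

lemma L2_mult_integrable:
  assumes "f \<in> L2" "g \<in> L2"
  shows "integrable lborel (\<lambda>x. f x * g x)"
proof (rule Bochner_Integration.integrable_bound)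
  have [measurable]: "f \<in> borel_measurable borel" "g \<in> borel_measurable borel"
    using assms by (auto simp: L2_measurable)
  show "(\<lambda>x. f x * g x) \<in> borel_measurable lborel"
    by simp
  show "integrable lborel (\<lambda>x. (cmod (f x))\<^sup>2 + (cmod (g x))\<^sup>2)"
    using assms by (simp add: L2_integrable)
  have "cmod a * cmod b \<le> (cmod a)\<^sup>2 + (cmod b)\<^sup>2" for a b :: complex
  proof -
    have "0 \<le> cmod a * cmod b" by simp
    then show ?thesis
      using sum_squares_bound[of "cmod a" "cmod b"] unfolding mult.assoc by linarith
  qed
  then show "AE x in lborel. norm (f x * g x) \<le> norm ((cmod (f x))\<^sup>2 + (cmod (g x))\<^sup>2)"
    by (auto simp: norm_mult intro!: AE_I2)
qed

lemma vector_space_pointwise: "vector_space (\<lambda>c f x. c * f x :: complex)"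
  by unfold_locales (auto simp: algebra_simps)

interpretation L2: semi_inner_space "\<lambda>c f x. c * f x" "L2 :: ('a::euclidean_space \<Rightarrow> complex) set" ip_L2
  rewrites "L2.nrm = norm_L2"
proof -
  interpret vector_space "\<lambda>c (f::'a \<Rightarrow> complex) x. c * f x"
    by (rule vector_space_pointwise)
  show *: "semi_inner_space (\<lambda>c f x. c * f x) (L2 :: ('a \<Rightarrow> complex) set) ip_L2"
  proof
    fix u v w :: "'a \<Rightarrow> complex" and c :: complex
    assume L2: "u \<in> L2" "v \<in> L2"
    show "ip_L2 u (\<lambda>x. c * v x) = c * ip_L2 u v"
      by (simp add: ip_L2_def mult.left_commute)
    show "cnj (ip_L2 u v) = ip_L2 v u"
    proof -
      have "ip_L2 v u = (\<integral>x. cnj (cnj (u x) * v x) \<partial>lborel)"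
        by (simp add: ip_L2_def mult.commute del: integral_cnj)
      then show ?thesis
        by (simp add: ip_L2_def del: complex_cnj_mult complex_cnj_cnj)
    qed
    assume "w \<in> L2"
    then show "ip_L2 u (v + w) = ip_L2 u v + ip_L2 u w"
      using L2 by (simp add: ip_L2_def distrib_left L2_mult_integrable L2_cnj)
  next
    fix u :: "'a \<Rightarrow> complex"
    show "0 \<le> Re (ip_L2 u u)"
      by (simp add: ip_L2_self)
  qed (auto simp: L2_zero L2_add L2_scale)
  interpret semi_inner_space "\<lambda>c f x. c * f x" "L2 :: ('a \<Rightarrow> complex) set" ip_L2
    by fact
  have "Re (ip_L2 u u) = (\<integral>x. (cmod (u x))\<^sup>2 \<partial>lborel)" for u :: "'a \<Rightarrow> complex"
    by (simp add: ip_L2_self)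
  then show "semi_inner_space.nrm (ip_L2 :: ('a \<Rightarrow> complex) \<Rightarrow> _) = norm_L2"
    by (simp add: fun_eq_iff nrm_def norm_L2_def)
qed

lemma Cauchy_Schwarz_L2:
  assumes "f \<in> L2" "g \<in> L2"
  shows "cmod (\<integral>x. f x * g x \<partial>lborel) \<le> norm_L2 f * norm_L2 g"
  using L2.cauchy_schwarz[OF L2_cnj[OF assms(1)] assms(2)] by (simp add: ip_L2_def)

lemma norm_L2_eq_0_iff:
  assumes "f \<in> L2"
  shows "norm_L2 f = 0 \<longleftrightarrow> (AE x in lborel. f x = 0)"
  using integral_nonneg_eq_0_iff_AE[OF L2_integrable[OF assms]] by (simp add: norm_L2_def)

lemma nn_integral_norm_sq:
  "f \<in> L2 \<Longrightarrow> (\<integral>\<^sup>+x. ennreal ((cmod (f x))\<^sup>2) \<partial>lborel) = ennreal ((norm_L2 f)\<^sup>2)"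
  by (simp add: norm_L2_sq nn_integral_eq_integral L2_integrable)

lemma L2_if_nn_integral_le:
  assumes "f \<in> borel_measurable borel" "0 \<le> c"
    and "(\<integral>\<^sup>+x. ennreal ((cmod (f x))\<^sup>2) \<partial>lborel) \<le> ennreal (c\<^sup>2)"
  shows "f \<in> L2" "norm_L2 f \<le> c"
proof -
  show f: "f \<in> L2"
  proof (rule L2I[OF assms(1)])
    show "integrable lborel (\<lambda>x. (cmod (f x))\<^sup>2)"
      using assms by (intro integrableI_bounded) (auto intro: le_less_trans)
  qed
  have "(norm_L2 f)\<^sup>2 \<le> c\<^sup>2"
    using assms(3) unfolding nn_integral_norm_sq[OF f] by simp
  then show "norm_L2 f \<le> c"
    using assms(2) by (rule power2_le_imp_le)
qed

text \<open>
  Along a fast Cauchy subsequence \<open>y\<close> the weighted sum \<open>\<Sum>k. 2 ^ k * \<bar>y (k + 1) - y k\<bar>\<^sup>2\<close> has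
  finite integral, so that the increments decay geometrically almost everywhere.
\<close>

lemma AE_convergent_fast_Cauchy:
  fixes y :: "nat \<Rightarrow> 'a::euclidean_space \<Rightarrow> complex"
  assumes y: "\<And>k. y k \<in> L2" and fast: "\<And>k. norm_L2 (y (Suc k) - y k) \<le> (1/4) ^ k"
  shows "AE x in lborel. convergent (\<lambda>k. y k x)"
proof -
  have [measurable]: "y k \<in> borel_measurable borel" for k
    using y by (rule L2_measurable)
  define d where "d k x = cmod (y (Suc k) x - y k x)" for k x
  have [measurable]: "d k \<in> borel_measurable borel" for k
    unfolding d_def by measurable
  have "(\<integral>\<^sup>+x. (\<Sum>k. ennreal (2 ^ k * (d k x)\<^sup>2)) \<partial>lborel) = (\<Sum>k. \<integral>\<^sup>+x. ennreal (2 ^ k * (d k x)\<^sup>2) \<partial>lborel)"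
    by (rule nn_integral_suminf) measurable
  also have "\<dots> \<le> (\<Sum>k. ennreal ((1/8) ^ k))"
  proof (rule suminf_le)
    fix k
    have "(\<integral>\<^sup>+x. ennreal (2 ^ k * (d k x)\<^sup>2) \<partial>lborel) = 2 ^ k * (\<integral>\<^sup>+x. ennreal ((d k x)\<^sup>2) \<partial>lborel)"
      by (subst nn_integral_cmult[symmetric]) (auto simp: ennreal_mult ennreal_power[symmetric])
    also have "(\<integral>\<^sup>+x. ennreal ((d k x)\<^sup>2) \<partial>lborel) = ennreal ((norm_L2 (y (Suc k) - y k))\<^sup>2)"
      using nn_integral_norm_sq[of "y (Suc k) - y k"] y by (simp add: d_def)
    also have "2 ^ k * \<dots> \<le> 2 ^ k * ennreal (((1/4) ^ k)\<^sup>2)"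
      using fast by (intro mult_left_mono ennreal_leI power_mono) auto
    also have "\<dots> = ennreal (2 ^ k * ((1/4) ^ k)\<^sup>2)"
      by (simp add: ennreal_mult ennreal_power[symmetric])
    also have "2 ^ k * ((1/4) ^ k)\<^sup>2 = ((1/8)::real) ^ k"
      by (simp add: power2_eq_square flip: power_mult_distrib)
    finally show "(\<integral>\<^sup>+x. ennreal (2 ^ k * (d k x)\<^sup>2) \<partial>lborel) \<le> ennreal ((1/8) ^ k)" .
  qed auto
  also have "\<dots> < \<infinity>"
    by (subst suminf_ennreal2) (auto intro!: summable_geometric)
  finally have fin: "(\<integral>\<^sup>+x. (\<Sum>k. ennreal (2 ^ k * (d k x)\<^sup>2)) \<partial>lborel) \<noteq> \<infinity>"
    by (rule less_imp_neq)
  have "AE x in lborel. (\<Sum>k. ennreal (2 ^ k * (d k x)\<^sup>2)) \<noteq> \<infinity>"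
    by (rule nn_integral_noteq_infinite[OF _ fin]) measurable
  then show ?thesis
  proof eventually_elim
    case (elim x)
    define b where "b = enn2real (\<Sum>k. ennreal (2 ^ k * (d k x)\<^sup>2))"
    have le: "d k x \<le> sqrt b * (1 / sqrt 2) ^ k" for k
    proof -
      have "f k \<le> suminf f" for f :: "nat \<Rightarrow> ennreal"
        using sum_le_suminf[of f "{k}"] by simp
      then have "ennreal (2 ^ k * (d k x)\<^sup>2) \<le> (\<Sum>k. ennreal (2 ^ k * (d k x)\<^sup>2))" .
      also have "\<dots> = ennreal b"
        using elim by (simp add: b_def less_top)
      finally have "2 ^ k * (d k x)\<^sup>2 \<le> b"
        by (simp add: b_def)
      then have "sqrt (2 ^ k * (d k x)\<^sup>2) \<le> sqrt b"
        by simp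
      then have "sqrt 2 ^ k * d k x \<le> sqrt b"
        by (simp add: real_sqrt_mult real_sqrt_power d_def)
      then show ?thesis
        by (simp add: power_divide field_simps)
    qed
    have "summable (\<lambda>k. sqrt b * (1 / sqrt 2) ^ k)"
      by (intro summable_mult summable_geometric) (simp add: real_less_rsqrt)
    then have "summable (\<lambda>k. y (Suc k) x - y k x)"
      by (rule summable_comparison_test'[where N = 0]) (use le in \<open>simp add: d_def\<close>)
    then have "convergent (\<lambda>n. (\<Sum>k<n. y (Suc k) x - y k x) + y 0 x)"
      by (intro convergent_add convergent_const) (simp add: summable_iff_convergent)
    moreover have "(\<Sum>k<n. y (Suc k) x - y k x) + y 0 x = y n x" for n
      using sum_lessThan_telescope[of "\<lambda>k. y k x" n] by simp
    ultimately show ?case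
      by simp
  qed
qed

text \<open>A fast subsequence converges almost everywhere. Fatou's lemma turns the Cauchy bounds
  into bounds for the distance to the pointwise limit, and these also place the limit in
  \<open>L2\<close>.\<close>

lemma L2_complete:
  fixes x :: "nat \<Rightarrow> 'a::euclidean_space \<Rightarrow> complex"
  assumes x: "\<And>n. x n \<in> L2"
    and Cauchy: "\<And>e. 0 < e \<Longrightarrow> \<exists>N. \<forall>m\<ge>N. \<forall>n\<ge>N. norm_L2 (x m - x n) < e"
  shows "\<exists>f\<in>L2. (\<lambda>n. norm_L2 (x n - f)) \<longlonglongrightarrow> 0"
proof -
  have "\<forall>k. \<exists>N. \<forall>m\<ge>N. \<forall>n\<ge>N. norm_L2 (x m - x n) < (1/4) ^ k"
    using Cauchy by simp
  then obtain N where N: "\<And>k m n. m \<ge> N k \<Longrightarrow> n \<ge> N k \<Longrightarrow> norm_L2 (x m - x n) < (1/4) ^ k"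
    by metis
  \<comment> \<open>Summing the thresholds puts \<open>r k\<close> above \<open>N j\<close> for
    every j up to k, although N need not be monotone.\<close>
  define r where "r k = (\<Sum>j\<le>k. N j) + k" for k
  have r: "N j \<le> r k" if "j \<le> k" for j k
  proof -
    have "N j \<le> (\<Sum>j\<le>k. N j)"
      using that by (intro member_le_sum) auto
    then show ?thesis by (simp add: r_def)
  qed
  define y where "y k = x (r k)" for k
  have y: "y k \<in> L2" for k
    by (simp add: y_def x)
  have [measurable]: "y k \<in> borel_measurable borel" for k
    using y by (rule L2_measurable)
  have "norm_L2 (y (Suc k) - y k) \<le> (1/4) ^ k" for k
    using N[of k "r (Suc k)" "r k"] r[of k "Suc k"] r[of k k] by (simp add: y_def)
  then have conv: "AE p in lborel. convergent (\<lambda>k. y k p)"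
    by (intro AE_convergent_fast_Cauchy y)
  \<comment> \<open>The value of \<open>lim\<close> is arbitrary on the null set of divergence; f is
    measurable all the same.\<close>
  define f where "f p = lim (\<lambda>k. y k p)" for p
  have f_meas [measurable]: "f \<in> borel_measurable borel"
    unfolding f_def by measurable
  have key: "y k - f \<in> L2 \<and> norm_L2 (y k - f) \<le> (1/4) ^ j" if "j \<le> k" for k j
  proof -
    have "(\<integral>\<^sup>+p. ennreal ((cmod ((y k - f) p))\<^sup>2) \<partial>lborel) =
        (\<integral>\<^sup>+p. liminf (\<lambda>m. ennreal ((cmod (y k p - y m p))\<^sup>2)) \<partial>lborel)"
    proof (rule nn_integral_cong_AE)
      show "AE p in lborel. ennreal ((cmod ((y k - f) p))\<^sup>2) = liminf (\<lambda>m. ennreal ((cmod (y k p - y m p))\<^sup>2))"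
        using conv
      proof eventually_elim
        case (elim p)
        then have "(\<lambda>m. y m p) \<longlonglongrightarrow> f p"
          by (simp add: f_def convergent_LIMSEQ_iff)
        then have "(\<lambda>m. ennreal ((cmod (y k p - y m p))\<^sup>2)) \<longlonglongrightarrow> ennreal ((cmod (y k p - f p))\<^sup>2)"
          by (intro tendsto_intros)
        from lim_imp_Liminf[OF sequentially_bot this] show ?case
          by simp
      qed
    qed
    also have "\<dots> \<le> liminf (\<lambda>m. \<integral>\<^sup>+p. ennreal ((cmod (y k p - y m p))\<^sup>2) \<partial>lborel)"
      by (rule nn_integral_liminf) measurable
    also have "\<dots> \<le> ennreal (((1/4) ^ j)\<^sup>2)"
    proof -
      have "(\<integral>\<^sup>+p. ennreal ((cmod (y k p - y m p))\<^sup>2) \<partial>lborel) \<le> ennreal (((1/4) ^ j)\<^sup>2)" if "j \<le> m" for m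
      proof -
        have "(\<integral>\<^sup>+p. ennreal ((cmod (y k p - y m p))\<^sup>2) \<partial>lborel) = ennreal ((norm_L2 (y k - y m))\<^sup>2)"
          using nn_integral_norm_sq[of "y k - y m"] y by simp
        also have "\<dots> \<le> ennreal (((1/4) ^ j)\<^sup>2)"
          using N[of j "r k" "r m"] r \<open>j \<le> k\<close> that by (intro ennreal_leI power_mono) (auto simp: y_def)
        finally show ?thesis .
      qed
      then show ?thesis
        by (intro Liminf_le) (auto simp: eventually_sequentially)
    qed
    finally have "(\<integral>\<^sup>+p. ennreal ((cmod ((y k - f) p))\<^sup>2) \<partial>lborel) \<le> ennreal (((1/4) ^ j)\<^sup>2)" .
    then show ?thesis
      using L2_if_nn_integral_le[of "y k - f" "(1/4) ^ j"] by (simp add: fun_diff_def)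
  qed
  have f: "f \<in> L2"
    using L2.diff_mem[of "y 0" "y 0 - f"] key[of 0 0] y by simp
  have "(\<lambda>n. norm_L2 (x n - f)) \<longlonglongrightarrow> 0"
  proof (rule LIMSEQ_I)
    fix e :: real assume "0 < e"
    then obtain j where j: "(1/4) ^ j < e / 2"
      using real_arch_pow_inv[of "e / 2" "1/4"] by auto
    have "norm_L2 (x n - f) < e" if "n \<ge> N j" for n
    proof -
      have "norm_L2 (x n - f) \<le> norm_L2 (x n - y j) + norm_L2 (y j - f)"
        using x y f by (intro L2.nrm_triangle_mid) auto
      moreover have "norm_L2 (x n - y j) < (1/4) ^ j"
        unfolding y_def using that r[of j j] by (intro N) auto
      ultimately show ?thesis
        using key[of j j] j by linarith
    qed
    then show "\<exists>n0. \<forall>n\<ge>n0. norm (norm_L2 (x n - f) - 0) < e"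
      by auto
  qed
  then show ?thesis using f by blast
qed

section \<open>Functions of two variables and the state space\<close>

lemma borel_measurable_o_fst:
  fixes f :: "'a::euclidean_space \<Rightarrow> 'c::topological_space"
  assumes [measurable]: "f \<in> borel_measurable borel"
  shows "(\<lambda>p :: 'a \<times> 'b::euclidean_space. f (fst p)) \<in> borel_measurable borel"
  unfolding borel_prod[symmetric] by measurable

lemma borel_measurable_o_snd:
  fixes f :: "'b::euclidean_space \<Rightarrow> 'c::topological_space"
  assumes [measurable]: "f \<in> borel_measurable borel"
  shows "(\<lambda>p :: 'a::euclidean_space \<times> 'b. f (snd p)) \<in> borel_measurable borel"
  unfolding borel_prod[symmetric] by measurable

lemma borel_measurable_section:
  fixes f :: "'a::euclidean_space \<times> 'b::euclidean_space \<Rightarrow> 'c::topological_space"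
  assumes "f \<in> borel_measurable borel"
  shows "(\<lambda>q. f (k, q)) \<in> borel_measurable borel"
proof -
  have [measurable]: "f \<in> borel_measurable (borel \<Otimes>\<^sub>M borel)"
    using assms by (simp add: borel_prod)
  show ?thesis by measurable
qed

lemma borel_measurable_integral_section:
  fixes f :: "'a::euclidean_space \<times> 'b::euclidean_space \<Rightarrow> 'c::{banach, second_countable_topology}"
  assumes "f \<in> borel_measurable borel"
  shows "(\<lambda>k. \<integral>q. f (k, q) \<partial>lborel) \<in> borel_measurable borel"
proof -
  have [measurable]: "f \<in> borel_measurable (borel \<Otimes>\<^sub>M lborel)"
    using assms measurable_cong_sets[OF sets_pair_measure_cong[OF refl sets_lborel] refl]
    by (metis borel_prod)
  show ?thesis by measurable
qed

lemma swap_eq: "prod.swap = (\<lambda>(x, y). (y, x))"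
  by auto

lemma distr_lborel_swap:
  "distr lborel lborel prod.swap = (lborel :: ('a::euclidean_space \<times> 'a) measure)"
  using lborel_pair.distr_pair_swap[where 'a = 'a and 'b = 'a]
  by (simp add: lborel_prod swap_eq)

lemma measurable_swap_lborel [measurable]:
  "prod.swap \<in> lborel \<rightarrow>\<^sub>M (lborel :: ('a::euclidean_space \<times> 'a) measure)"
  using measurable_pair_swap'[of "lborel :: 'a measure" "lborel :: 'a measure"]
  by (simp add: lborel_prod swap_eq)

lemma integral_lborel_swap:
  fixes f :: "'a::euclidean_space \<times> 'a \<Rightarrow> 'c::{banach, second_countable_topology}"
  assumes "f \<in> borel_measurable borel"
  shows "(\<integral>p. f (prod.swap p) \<partial>lborel) = (\<integral>p. f p \<partial>lborel)"
proof -
  have "(\<integral>p. f p \<partial>distr lborel lborel prod.swap) = (\<integral>p. f (prod.swap p) \<partial>lborel)"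
    by (rule integral_distr[OF measurable_swap_lborel]) (use assms in simp)
  then show ?thesis by (simp only: distr_lborel_swap)
qed

lemma L2_swap:
  fixes g :: "'a::euclidean_space \<times> 'a \<Rightarrow> complex"
  assumes "g \<in> L2"
  shows "(\<lambda>p. g (prod.swap p)) \<in> L2" "norm_L2 (\<lambda>p. g (prod.swap p)) = norm_L2 g"
proof -
  have [measurable]: "g \<in> borel_measurable borel"
    using assms by (rule L2_measurable)
  have m: "(\<lambda>p. g (prod.swap p)) \<in> borel_measurable borel"
    using measurable_compose[OF measurable_swap_lborel, of g borel] by simp
  have "integrable (distr lborel lborel prod.swap) (\<lambda>p. (cmod (g p))\<^sup>2)"
    using L2_integrable[OF assms] by (simp only: distr_lborel_swap)
  then have "integrable lborel (\<lambda>p. (cmod (g (prod.swap p)))\<^sup>2)"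
    by (rule integrable_distr[OF measurable_swap_lborel])
  with m show "(\<lambda>p. g (prod.swap p)) \<in> L2"
    by (rule L2I)
  show "norm_L2 (\<lambda>p. g (prod.swap p)) = norm_L2 g"
    unfolding norm_L2_def using integral_lborel_swap[of "\<lambda>p. (cmod (g p))\<^sup>2"] by simp
qed

definition tensor :: "('a \<Rightarrow> complex) \<Rightarrow> ('b \<Rightarrow> complex) \<Rightarrow> 'a \<times> 'b \<Rightarrow> complex" where
  "tensor f h = (\<lambda>p. f (fst p) * h (snd p))"

lemma L2_tensor:
  fixes f :: "'a::euclidean_space \<Rightarrow> complex" and h :: "'b::euclidean_space \<Rightarrow> complex"
  assumes f: "f \<in> L2" and h: "h \<in> L2"
  shows "tensor f h \<in> L2" "norm_L2 (tensor f h) = norm_L2 f * norm_L2 h"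
proof -
  have [measurable]: "f \<in> borel_measurable borel" "h \<in> borel_measurable borel"
    using assms by (auto simp: L2_measurable)
  have eq: "(cmod (tensor f h (k, q)))\<^sup>2 = (cmod (f k))\<^sup>2 * (cmod (h q))\<^sup>2" for k q
    by (simp add: tensor_def norm_mult power_mult_distrib)
  have int: "integrable (lborel \<Otimes>\<^sub>M lborel) (\<lambda>p. (cmod (tensor f h p))\<^sup>2)"
  proof (rule lborel_pair.Fubini_integrable)
    show "(\<lambda>p. (cmod (tensor f h p))\<^sup>2) \<in> borel_measurable (lborel \<Otimes>\<^sub>M lborel)"
      unfolding tensor_def by measurable
    show "integrable lborel (\<lambda>k. \<integral>q. norm ((cmod (tensor f h (k, q)))\<^sup>2) \<partial>lborel)"
      using L2_integrable[OF f] by (simp add: eq)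
    show "AE k in lborel. integrable lborel (\<lambda>q. (cmod (tensor f h (k, q)))\<^sup>2)"
      using L2_integrable[OF h] by (simp add: eq)
  qed
  show "tensor f h \<in> L2"
  proof (rule L2I)
    show "tensor f h \<in> borel_measurable borel"
      unfolding tensor_def by (intro borel_measurable_times borel_measurable_o_fst borel_measurable_o_snd) measurable
  qed (use int in \<open>simp add: lborel_prod\<close>)
  have "(\<integral>p. (cmod (tensor f h p))\<^sup>2 \<partial>lborel) = (\<integral>k. (\<integral>q. (cmod (tensor f h (k, q)))\<^sup>2 \<partial>lborel) \<partial>lborel)"
    using lborel_pair.integral_fst'[OF int] by (simp add: lborel_prod)
  also have "\<dots> = (norm_L2 f)\<^sup>2 * (norm_L2 h)\<^sup>2"
    by (simp add: eq norm_L2_sq)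
  finally show "norm_L2 (tensor f h) = norm_L2 f * norm_L2 h"
    by (simp add: norm_L2_def real_sqrt_mult)
qed

text \<open>The pairing is bilinear, without conjugation, so that \<open>op_B\<close> is \<alpha>
  times the pairing with l itself.\<close>

definition partial_pairing ::
  "('a \<times> 'b::euclidean_space \<Rightarrow> complex) \<Rightarrow> ('b \<Rightarrow> complex) \<Rightarrow> 'a \<Rightarrow> complex" where
  "partial_pairing g h = (\<lambda>k. \<integral>q. g (k, q) * h q \<partial>lborel)"

lemma AE_section_L2:
  fixes g :: "'a::euclidean_space \<times> 'b::euclidean_space \<Rightarrow> complex"
  assumes "g \<in> L2"
  shows "AE k in lborel. (\<lambda>q. g (k, q)) \<in> L2"
proof -
  have "integrable (lborel \<Otimes>\<^sub>M lborel) (\<lambda>p. (cmod (g p))\<^sup>2)"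
    using L2_integrable[OF assms] by (simp add: lborel_prod)
  from lborel_pair.AE_integrable_fst'[OF this] show ?thesis
    by eventually_elim (use borel_measurable_section[OF L2_measurable[OF assms]] in \<open>auto intro: L2I\<close>)
qed

text \<open>Cauchy--Schwarz in q on almost every section, then integration over k: the
  Hilbert--Schmidt bound for the integral operator with kernel g.\<close>

lemma partial_pairing_L2:
  fixes g :: "'a::euclidean_space \<times> 'b::euclidean_space \<Rightarrow> complex"
  assumes g: "g \<in> L2" and h: "h \<in> L2"
  shows "partial_pairing g h \<in> L2" "norm_L2 (partial_pairing g h) \<le> norm_L2 g * norm_L2 h"
proof -
  have [measurable]: "g \<in> borel_measurable borel" "h \<in> borel_measurable borel"
    using assms by (auto simp: L2_measurable)
  let ?G = "partial_pairing g h"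
  have meas: "?G \<in> borel_measurable borel"
    unfolding partial_pairing_def
    using borel_measurable_integral_section[of "\<lambda>p. g p * h (snd p)"]
      borel_measurable_times[OF _ borel_measurable_o_snd[of h], of g] by simp
  have int: "integrable (lborel \<Otimes>\<^sub>M lborel) (\<lambda>p. (cmod (g p))\<^sup>2)"
    using L2_integrable[OF g] by (simp add: lborel_prod)
  define s where "s k = (\<integral>q. (cmod (g (k, q)))\<^sup>2 \<partial>lborel)" for k
  have s_nonneg: "0 \<le> s k" for k
    by (simp add: s_def)
  have s_int: "integrable lborel s"
    unfolding s_def by (rule lborel_pair.integrable_fst'[OF int])
  have s_eq: "(\<integral>k. s k \<partial>lborel) = (norm_L2 g)\<^sup>2"
    unfolding s_def norm_L2_sq using lborel_pair.integral_fst'[OF int] by (simp add: lborel_prod)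
  have le: "AE k in lborel. (cmod (?G k))\<^sup>2 \<le> s k * (norm_L2 h)\<^sup>2"
    using AE_section_L2[OF g]
  proof eventually_elim
    case (elim k)
    have "(cmod (?G k))\<^sup>2 \<le> (norm_L2 (\<lambda>q. g (k, q)) * norm_L2 h)\<^sup>2"
      unfolding partial_pairing_def by (intro power_mono Cauchy_Schwarz_L2 elim h) auto
    then show ?case
      by (simp add: power_mult_distrib norm_L2_sq s_def)
  qed
  have int_G: "integrable lborel (\<lambda>k. (cmod (?G k))\<^sup>2)"
  proof (rule Bochner_Integration.integrable_bound)
    show "integrable lborel (\<lambda>k. s k * (norm_L2 h)\<^sup>2)"
      using s_int by simp
    show "AE k in lborel. norm ((cmod (?G k))\<^sup>2) \<le> norm (s k * (norm_L2 h)\<^sup>2)"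
      using le by eventually_elim (simp add: abs_mult abs_of_nonneg[OF s_nonneg])
  qed (use meas in measurable)
  show "?G \<in> L2"
    by (rule L2I[OF meas int_G])
  have "(norm_L2 ?G)\<^sup>2 \<le> (\<integral>k. s k * (norm_L2 h)\<^sup>2 \<partial>lborel)"
    unfolding norm_L2_sq[of ?G] by (rule integral_mono_AE[OF int_G _ le]) (use s_int in simp)
  also have "\<dots> = (norm_L2 g * norm_L2 h)\<^sup>2"
    by (simp add: s_eq power_mult_distrib)
  finally show "norm_L2 ?G \<le> norm_L2 g * norm_L2 h"
    by (rule power2_le_imp_le) simp
qed

text \<open>Fubini's theorem; it is the source of the adjointness of \<open>op_B\<close> and
  \<open>op_C\<close>.\<close>

lemma integral_mult_tensor:
  fixes g :: "'a::euclidean_space \<times> 'b::euclidean_space \<Rightarrow> complex"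
  assumes "g \<in> L2" "f \<in> L2" "h \<in> L2"
  shows "(\<integral>p. g p * tensor f h p \<partial>lborel) = (\<integral>k. f k * partial_pairing g h k \<partial>lborel)"
proof -
  have int: "integrable (lborel \<Otimes>\<^sub>M lborel) (\<lambda>p. g p * tensor f h p)"
    using L2_mult_integrable[OF assms(1) L2_tensor(1)[OF assms(2,3)]] by (simp add: lborel_prod)
  have "(\<integral>p. g p * tensor f h p \<partial>lborel) = (\<integral>k. (\<integral>q. f k * (g (k, q) * h q) \<partial>lborel) \<partial>lborel)"
    using lborel_pair.integral_fst'[OF int] by (simp add: lborel_prod tensor_def mult_ac)
  then show ?thesis
    by (simp add: partial_pairing_def)
qed

section \<open>The state space and its completeness\<close>

definition ip_H :: "'a::euclidean_space state \<Rightarrow> 'a state \<Rightarrow> complex" where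
  "ip_H u v = ip_L2 (fst u) (fst v) + ip_L2 (snd u) (snd v) / 2"

lemma space_H_iff:
  "u \<in> space_H \<longleftrightarrow> fst u \<in> L2 \<and> snd u \<in> L2 \<and> (AE p in lborel. snd u (prod.swap p) = snd u p)"
  by (auto simp: space_H_def case_prod_unfold)

lemma scale_H_simps [simp]:
  "fst (c \<odot> u) = (\<lambda>x. c * fst u x)" "snd (c \<odot> u) = (\<lambda>p. c * snd u p)"
  by (simp_all add: scale_H_def)

lemma vector_space_scale_H: "vector_space (\<odot>)"
  by unfold_locales (auto simp: scale_H_def algebra_simps plus_fun_def prod_eq_iff)

lemma norm_H_sq: "(norm_H u)\<^sup>2 = (norm_L2 (fst u))\<^sup>2 + (norm_L2 (snd u))\<^sup>2 / 2"
  by (simp add: norm_H_def)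

lemma norm_H_nonneg: "0 \<le> norm_H u"
  by (simp add: norm_H_def)

lemma norm_L2_fst_le: "norm_L2 (fst u) \<le> norm_H u"
  by (rule power2_le_imp_le) (simp_all add: norm_H_sq norm_H_nonneg)

text \<open>The sharp factor is the square root of 2; the integer keeps roots out of later
  constants.\<close>

lemma norm_L2_snd_le: "norm_L2 (snd u) \<le> 2 * norm_H u"
  by (rule power2_le_imp_le) (simp_all add: norm_H_sq norm_H_nonneg power_mult_distrib)

lemma norm_H_le: "norm_H u \<le> norm_L2 (fst u) + norm_L2 (snd u)"
  by (rule power2_le_imp_le) (simp_all add: norm_H_sq norm_H_nonneg power2_sum)

interpretation H: semi_hilbert_space "(\<odot>)" "space_H :: 'a::euclidean_space state set" ip_H
  rewrites "H.nrm = norm_H"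
proof -
  interpret vector_space "(\<odot>) :: complex \<Rightarrow> 'a state \<Rightarrow> 'a state"
    by (rule vector_space_scale_H)
  have *: "semi_inner_space (\<odot>) (space_H :: 'a state set) ip_H"
  proof
    fix u v w :: "'a state" and c :: complex
    assume u: "u \<in> space_H" and v: "v \<in> space_H"
    then have L2: "fst u \<in> L2" "snd u \<in> L2" "fst v \<in> L2" "snd v \<in> L2"
      and s: "AE p in lborel. snd u (prod.swap p) = snd u p" "AE p in lborel. snd v (prod.swap p) = snd v p"
      by (auto simp: space_H_iff)
    have "AE p in lborel. snd (u + v) (prod.swap p) = snd (u + v) p"
      using s by eventually_elim simp
    then show "u + v \<in> space_H"
      using L2 by (simp add: space_H_iff)
    show "ip_H u (c \<odot> v) = c * ip_H u v"
      using L2 by (simp add: ip_H_def L2.ip_sc_right distrib_left)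
    show "cnj (ip_H u v) = ip_H v u"
      using L2 by (simp add: ip_H_def L2.ip_cnj)
    assume w: "w \<in> space_H"
    then show "ip_H u (v + w) = ip_H u v + ip_H u w"
      using L2 by (simp add: ip_H_def L2.ip_add_right space_H_iff add_divide_distrib)
  next
    fix u :: "'a state" and c :: complex
    assume u: "u \<in> space_H"
    then have s: "AE p in lborel. snd u (prod.swap p) = snd u p"
      by (auto simp: space_H_iff)
    have "AE p in lborel. snd (c \<odot> u) (prod.swap p) = snd (c \<odot> u) p"
      using s by eventually_elim simp
    then show "c \<odot> u \<in> space_H"
      using u L2.sc_mem by (simp add: space_H_iff)
    show "0 \<le> Re (ip_H u u)"
      by (simp add: ip_H_def ip_L2_self)
  qed (auto simp: space_H_iff L2_zero)
  interpret semi_inner_space "(\<odot>)" "space_H :: 'a state set" ip_H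
    by fact
  have nrm: "nrm = (norm_H :: 'a state \<Rightarrow> real)"
    by (auto simp: fun_eq_iff nrm_def norm_H_def ip_H_def ip_L2_self norm_L2_def)
  then show "semi_inner_space.nrm (ip_H :: 'a state \<Rightarrow> _) = norm_H" .
  show "semi_hilbert_space (\<odot>) (space_H :: 'a state set) ip_H"
  proof unfold_locales
    fix x :: "nat \<Rightarrow> 'a state"
    assume x: "\<And>n. x n \<in> space_H"
      and C: "\<And>e. 0 < e \<Longrightarrow> \<exists>N. \<forall>m\<ge>N. \<forall>n\<ge>N. nrm (x m - x n) < e"
    have L2: "fst (x n) \<in> L2" "snd (x n) \<in> L2" for n
      using x[of n] by (auto simp: space_H_iff)
    have "\<exists>f\<in>L2. (\<lambda>n. norm_L2 (fst (x n) - f)) \<longlonglongrightarrow> 0"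
    proof (rule L2_complete)
      fix e :: real assume "0 < e"
      then obtain N where N: "\<And>m n. m \<ge> N \<Longrightarrow> n \<ge> N \<Longrightarrow> norm_H (x m - x n) < e"
        using C unfolding nrm by blast
      have "norm_L2 (fst (x m) - fst (x n)) < e" if "m \<ge> N" "n \<ge> N" for m n
        using N[OF that] norm_L2_fst_le[of "x m - x n"] by simp
      then show "\<exists>N. \<forall>m\<ge>N. \<forall>n\<ge>N. norm_L2 (fst (x m) - fst (x n)) < e"
        by blast
    qed (rule L2)
    then obtain f where f: "f \<in> L2" "(\<lambda>n. norm_L2 (fst (x n) - f)) \<longlonglongrightarrow> 0" by blast
    have "\<exists>g\<in>L2. (\<lambda>n. norm_L2 (snd (x n) - g)) \<longlonglongrightarrow> 0"
    proof (rule L2_complete)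
      fix e :: real assume "0 < e"
      then obtain N where N: "\<And>m n. m \<ge> N \<Longrightarrow> n \<ge> N \<Longrightarrow> norm_H (x m - x n) < e / 2"
        using C[of "e / 2"] unfolding nrm by auto
      have "norm_L2 (snd (x m) - snd (x n)) < e" if "m \<ge> N" "n \<ge> N" for m n
        using N[OF that] norm_L2_snd_le[of "x m - x n"] by simp
      then show "\<exists>N. \<forall>m\<ge>N. \<forall>n\<ge>N. norm_L2 (snd (x m) - snd (x n)) < e"
        by blast
    qed (rule L2)
    then obtain g where g: "g \<in> L2" "(\<lambda>n. norm_L2 (snd (x n) - g)) \<longlonglongrightarrow> 0" by blast
    define g' where "g' p = g (prod.swap p)" for p
    have g': "g' \<in> L2"
      using L2_swap(1)[OF g(1)] by (simp add: g'_def[abs_def])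
    \<comment> \<open>Symmetry survives the limit: \<open>snd (x n)\<close> is symmetric almost
      everywhere and swapping preserves the norm, so g and its swap differ by at most twice the
      distance of g from \<open>snd (x n)\<close>.\<close>
    have sw: "norm_L2 (g' - g) \<le> 2 * norm_L2 (snd (x n) - g)" for n
    proof -
      let ?y = "snd (x n)" and ?y' = "\<lambda>p. snd (x n) (prod.swap p)"
      have y': "?y' \<in> L2" by (rule L2_swap(1)[OF L2(2)])
      have "norm_L2 (?y' - ?y) = 0"
        using x[of n] y' L2 by (subst norm_L2_eq_0_iff) (auto simp: space_H_iff)
      moreover have "norm_L2 (g' - ?y') = norm_L2 (g - ?y)"
        using L2_swap(2)[OF L2.diff_mem[OF g(1) L2(2)[of n]]] by (simp add: g'_def[abs_def] fun_diff_def)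
      moreover have "norm_L2 (g - ?y) = norm_L2 (?y - g)"
        by (rule L2.nrm_minus_commute[OF g(1) L2(2)])
      moreover have "norm_L2 (g' - g) \<le> norm_L2 (g' - ?y') + norm_L2 (?y' - g)"
        using g' y' g by (intro L2.nrm_triangle_mid) auto
      moreover have "norm_L2 (?y' - g) \<le> norm_L2 (?y' - ?y) + norm_L2 (?y - g)"
        using y' L2 g by (intro L2.nrm_triangle_mid) auto
      ultimately show ?thesis by linarith
    qed
    have "(\<lambda>n. 2 * norm_L2 (snd (x n) - g)) \<longlonglongrightarrow> 2 * 0"
      by (intro tendsto_intros g)
    from LIMSEQ_le_const[OF this] sw have "norm_L2 (g' - g) \<le> 0"
      by simp
    then have "norm_L2 (g' - g) = 0"
      using norm_L2_nonneg[of "g' - g"] by linarith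
    then have "AE p in lborel. g (prod.swap p) = g p"
      using g' g by (subst (asm) norm_L2_eq_0_iff) (auto simp: g'_def)
    then have mem: "(f, g) \<in> space_H"
      using f g by (simp add: space_H_iff)
    have lim: "(\<lambda>n. norm_L2 (fst (x n) - f) + norm_L2 (snd (x n) - g)) \<longlonglongrightarrow> 0 + 0"
      by (intro tendsto_add f g)
    have "(\<lambda>n. norm_H (x n - (f, g))) \<longlonglongrightarrow> 0"
    proof (rule real_tendsto_sandwich[OF _ _ tendsto_const])
      show "(\<lambda>n. norm_L2 (fst (x n) - f) + norm_L2 (snd (x n) - g)) \<longlonglongrightarrow> 0"
        using lim by simp
      show "\<forall>\<^sub>F n in sequentially. norm_H (x n - (f, g)) \<le> norm_L2 (fst (x n) - f) + norm_L2 (snd (x n) - g)"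
        using norm_H_le[of "x _ - (f, g)"] by simp
    qed (simp add: norm_H_nonneg)
    then show "\<exists>y\<in>space_H. (\<lambda>n. nrm (x n - y)) \<longlonglongrightarrow> 0"
      using mem unfolding nrm by blast
  qed
qed

lemma eq_H_iff:
  assumes "u \<in> space_H" "v \<in> space_H"
  shows "u \<approx> v \<longleftrightarrow> norm_H (u - v) = 0"
proof -
  have m: "fst u - fst v \<in> L2" "snd u - snd v \<in> L2"
    using assms by (auto simp: space_H_iff)
  have "norm_H (u - v) = 0 \<longleftrightarrow> norm_L2 (fst u - fst v) = 0 \<and> norm_L2 (snd u - snd v) = 0"
    by (simp add: norm_H_def add_nonneg_eq_0_iff)
  then show ?thesis
    unfolding norm_L2_eq_0_iff[OF m(1)] norm_L2_eq_0_iff[OF m(2)] by (simp add: eq_H_def)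
qed

section \<open>The operator matrix\<close>

lemma nrm_ip_H: "semi_inner_space.nrm ip_H = norm_H"
  by (rule ext) (simp add: semi_inner_space.nrm_def[OF H.semi_inner_space_axioms] H.nrm_def)

lemma op_B_eq: "op_B l \<alpha> g = (\<lambda>k. of_real \<alpha> * partial_pairing g l k)"
  by (simp add: op_B_def partial_pairing_def)

lemma op_C_eq:
  "op_C l \<alpha> f = (\<lambda>p. of_real \<alpha> * (tensor (\<lambda>k. cnj (l k)) f p + tensor f (\<lambda>k. cnj (l k)) p))"
  by (auto simp: op_C_def tensor_def algebra_simps)

lemma op_D_eq: "op_D \<omega> \<gamma> g = (\<lambda>p. of_real (\<gamma> + \<omega> (fst p) + \<omega> (snd p)) * g p)"
  by (auto simp: op_D_def)

lemma op_matrix_simps: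
  "fst (op_matrix \<omega> l \<gamma> \<alpha> u) = op_A \<omega> \<gamma> (fst u) + op_B l \<alpha> (snd u)"
  "snd (op_matrix \<omega> l \<gamma> \<alpha> u) = op_C l \<alpha> (fst u) + op_D \<omega> \<gamma> (snd u)"
  by (simp_all add: op_matrix_def case_prod_unfold)

text \<open>The assumptions are stable under changing the signs of \<omega> and \<gamma>, on which
  the later reflection of the right half line depends.\<close>

locale matrix_model =
  fixes \<omega> :: "'a::euclidean_space \<Rightarrow> real" and l :: "'a \<Rightarrow> complex" and \<gamma> \<alpha> :: real
  assumes cont: "continuous_on UNIV \<omega>" and bdd: "bounded (range \<omega>)"
    and l_L2: "l \<in> L2" and \<alpha>_pos: "0 < \<alpha>"
begin

abbreviation w0 :: real where "w0 \<equiv> inf_of \<omega>"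
abbreviation w1 :: real where "w1 \<equiv> sup_of \<omega>"
abbreviation lc :: "'a \<Rightarrow> complex" where "lc \<equiv> \<lambda>k. cnj (l k)"
abbreviation T :: "'a state \<Rightarrow> 'a state" where "T \<equiv> op_matrix \<omega> l \<gamma> \<alpha>"

lemma w0_le: "w0 \<le> \<omega> k"
  unfolding inf_of_def by (rule cINF_lower) (use bdd in \<open>auto intro: bounded_imp_bdd_below\<close>)

lemma le_w1: "\<omega> k \<le> w1"
  unfolding sup_of_def by (rule cSUP_upper) (use bdd in \<open>auto intro: bounded_imp_bdd_above\<close>)

definition W :: real where "W = max \<bar>w0\<bar> \<bar>w1\<bar>"

lemma abs_\<omega>_le: "\<bar>\<omega> k\<bar> \<le> W"
  using w0_le[of k] le_w1[of k] by (auto simp: W_def)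

lemma measurable_\<omega> [measurable]: "\<omega> \<in> borel_measurable borel"
  using cont by (rule borel_measurable_continuous_onI)

lemma measurable_l [measurable]: "l \<in> borel_measurable borel"
  using l_L2 by (rule L2_measurable)

lemma lc_L2: "lc \<in> L2"
  using l_L2 by (rule L2_cnj)

lemma op_A_L2:
  assumes "f \<in> L2"
  shows "op_A \<omega> \<gamma> f \<in> L2" "norm_L2 (op_A \<omega> \<gamma> f) \<le> (\<bar>\<gamma>\<bar> + W) * norm_L2 f"
proof -
  have "\<bar>- \<gamma> + \<omega> k\<bar> \<le> \<bar>\<gamma>\<bar> + W" for k
    using abs_\<omega>_le[of k] by linarith
  then have "cmod (of_real (- \<gamma> + \<omega> k)) \<le> \<bar>\<gamma>\<bar> + W" for k
    unfolding norm_of_real by simp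
  then show "op_A \<omega> \<gamma> f \<in> L2" "norm_L2 (op_A \<omega> \<gamma> f) \<le> (\<bar>\<gamma>\<bar> + W) * norm_L2 f"
    unfolding op_A_def by (intro L2_mult_bounded[OF assms]; measurable)+
qed

lemma op_B_L2:
  assumes "g \<in> L2"
  shows "op_B l \<alpha> g \<in> L2" "norm_L2 (op_B l \<alpha> g) \<le> \<alpha> * (norm_L2 g * norm_L2 l)"
proof -
  note P = partial_pairing_L2[OF assms l_L2]
  show "op_B l \<alpha> g \<in> L2"
    unfolding op_B_eq using P(1) by (rule L2_scale)
  show "norm_L2 (op_B l \<alpha> g) \<le> \<alpha> * (norm_L2 g * norm_L2 l)"
    unfolding op_B_eq L2.nrm_sc[OF P(1)] using P(2) \<alpha>_pos by (simp add: mult_left_mono)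
qed

lemma op_C_L2:
  assumes "f \<in> L2"
  shows "op_C l \<alpha> f \<in> L2" "norm_L2 (op_C l \<alpha> f) \<le> 2 * \<alpha> * norm_L2 l * norm_L2 f"
proof -
  note t1 = L2_tensor[OF lc_L2 assms] and t2 = L2_tensor[OF assms lc_L2]
  have s: "tensor lc f + tensor f lc \<in> L2"
    using t1 t2 by (intro L2_add)
  have eq: "op_C l \<alpha> f = (\<lambda>p. of_real \<alpha> * (tensor lc f + tensor f lc) p)"
    by (simp add: op_C_eq)
  show "op_C l \<alpha> f \<in> L2"
    unfolding eq by (rule L2_scale[OF s])
  have "norm_L2 (op_C l \<alpha> f) = \<alpha> * norm_L2 (tensor lc f + tensor f lc)"
    unfolding eq L2.nrm_sc[OF s] using \<alpha>_pos by simp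
  also have "\<dots> \<le> \<alpha> * (norm_L2 (tensor lc f) + norm_L2 (tensor f lc))"
    using \<alpha>_pos t1 t2 by (intro mult_left_mono L2.nrm_triangle) auto
  finally show "norm_L2 (op_C l \<alpha> f) \<le> 2 * \<alpha> * norm_L2 l * norm_L2 f"
    by (simp add: t1 t2 algebra_simps)
qed

lemma measurable_\<omega>_fst: "(\<lambda>p. \<omega> (fst p)) \<in> borel_measurable (borel :: ('a \<times> 'a) measure)"
  and measurable_\<omega>_snd: "(\<lambda>p. \<omega> (snd p)) \<in> borel_measurable (borel :: ('a \<times> 'a) measure)"
  by (rule borel_measurable_o_fst[OF measurable_\<omega>], rule borel_measurable_o_snd[OF measurable_\<omega>])

lemma op_D_L2:
  assumes "g \<in> L2"
  shows "op_D \<omega> \<gamma> g \<in> L2" "norm_L2 (op_D \<omega> \<gamma> g) \<le> (\<bar>\<gamma>\<bar> + 2 * W) * norm_L2 g"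
proof -
  have *: "cmod (of_real (\<gamma> + \<omega> (fst p) + \<omega> (snd p))) \<le> \<bar>\<gamma>\<bar> + 2 * W" for p
    using abs_\<omega>_le[of "fst p"] abs_\<omega>_le[of "snd p"] unfolding norm_of_real by linarith
  have m: "(\<lambda>p. complex_of_real (\<gamma> + \<omega> (fst p) + \<omega> (snd p))) \<in> borel_measurable borel"
    using measurable_\<omega>_fst measurable_\<omega>_snd by measurable
  show "op_D \<omega> \<gamma> g \<in> L2" "norm_L2 (op_D \<omega> \<gamma> g) \<le> (\<bar>\<gamma>\<bar> + 2 * W) * norm_L2 g"
    unfolding op_D_eq using L2_mult_bounded[OF assms m *] by auto
qed

lemma T_mem: "T u \<in> space_H" if "u \<in> space_H"
proof -
  have L2: "fst u \<in> L2" "snd u \<in> L2" and s: "AE p in lborel. snd u (prod.swap p) = snd u p"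
    using that by (auto simp: space_H_iff)
  have "AE p in lborel. snd (T u) (prod.swap p) = snd (T u) p"
    using s by eventually_elim (simp add: op_matrix_simps op_C_eq op_D_eq tensor_def algebra_simps)
  then show ?thesis
    using L2 by (simp add: space_H_iff op_matrix_simps L2_add op_A_L2 op_B_L2 op_C_L2 op_D_L2)
qed

text \<open>The factor 2 cancels against the weight 1/2 of the inner product on symmetric functions.\<close>

lemma ip_op_C:
  assumes g: "g \<in> L2" "AE p in lborel. g (prod.swap p) = g p" and f: "f \<in> L2"
  shows "ip_L2 g (op_C l \<alpha> f) = 2 * ip_L2 (op_B l \<alpha> g) f"
proof -
  let ?cg = "\<lambda>p. cnj (g p)"
  have cg: "?cg \<in> L2" by (rule L2_cnj[OF g(1)])
  have [measurable]: "g \<in> borel_measurable borel" "f \<in> borel_measurable borel"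
    using assms by (auto simp: L2_measurable)
  have m: "tensor lc f \<in> borel_measurable borel"
    using L2_tensor(1)[OF lc_L2 f] by (rule L2_measurable)
  have m2: "tensor f lc \<in> borel_measurable borel"
    using L2_tensor(1)[OF f lc_L2] by (rule L2_measurable)
  have "(\<integral>p. ?cg p * tensor lc f p \<partial>lborel) = (\<integral>p. ?cg (prod.swap p) * tensor lc f (prod.swap p) \<partial>lborel)"
    by (rule integral_lborel_swap[symmetric]) (intro borel_measurable_times m, measurable)
  also have "\<dots> = (\<integral>p. ?cg p * tensor f lc p \<partial>lborel)"
  proof (rule integral_cong_AE)
    show "(\<lambda>p. ?cg p * tensor f lc p) \<in> borel_measurable lborel"
      by (simp, intro borel_measurable_times m2, measurable)
    show "(\<lambda>p. ?cg (prod.swap p) * tensor lc f (prod.swap p)) \<in> borel_measurable lborel"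
      using measurable_compose[OF measurable_swap_lborel, of "\<lambda>p. ?cg p * tensor lc f p" borel]
        borel_measurable_times[OF _ m, of ?cg] by simp
    show "AE p in lborel. ?cg (prod.swap p) * tensor lc f (prod.swap p) = ?cg p * tensor f lc p"
      using g(2) by eventually_elim (simp add: tensor_def)
  qed
  finally have sym: "(\<integral>p. ?cg p * tensor lc f p \<partial>lborel) = (\<integral>p. ?cg p * tensor f lc p \<partial>lborel)" .
  have "ip_L2 g (op_C l \<alpha> f) = (\<integral>p. of_real \<alpha> * (?cg p * tensor lc f p + ?cg p * tensor f lc p) \<partial>lborel)"
    unfolding ip_L2_def op_C_eq by (intro Bochner_Integration.integral_cong refl) (simp add: algebra_simps)
  also have "\<dots> = of_real \<alpha> * ((\<integral>p. ?cg p * tensor lc f p \<partial>lborel) + (\<integral>p. ?cg p * tensor f lc p \<partial>lborel))"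
    by (subst Bochner_Integration.integral_mult_right_zero, subst Bochner_Integration.integral_add)
      (auto intro!: L2_mult_integrable cg L2_tensor lc_L2 f)
  also have "\<dots> = 2 * of_real \<alpha> * (\<integral>k. f k * partial_pairing ?cg lc k \<partial>lborel)"
    by (simp add: sym integral_mult_tensor[OF cg f lc_L2])
  also have "(\<lambda>k. f k * partial_pairing ?cg lc k) = (\<lambda>k. cnj (partial_pairing g l k) * f k)"
    by (simp add: partial_pairing_def mult.commute flip: complex_cnj_mult)
  also have "2 * of_real \<alpha> * (\<integral>k. cnj (partial_pairing g l k) * f k \<partial>lborel) = 2 * ip_L2 (op_B l \<alpha> g) f"
    by (simp add: ip_L2_def op_B_eq mult.assoc)
  finally show ?thesis .
qed

lemma ip_op_A: "ip_L2 (op_A \<omega> \<gamma> f) f' = ip_L2 f (op_A \<omega> \<gamma> f')"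
  unfolding ip_L2_def op_A_def by (intro Bochner_Integration.integral_cong refl) simp

lemma ip_op_D: "ip_L2 (op_D \<omega> \<gamma> g) g' = ip_L2 g (op_D \<omega> \<gamma> g')"
  unfolding ip_L2_def op_D_eq by (intro Bochner_Integration.integral_cong refl) simp

lemma T_sym:
  assumes u: "u \<in> space_H" and v: "v \<in> space_H"
  shows "ip_H (T u) v = ip_H u (T v)"
proof -
  have L2: "fst u \<in> L2" "snd u \<in> L2" "fst v \<in> L2" "snd v \<in> L2"
    and s: "AE p in lborel. snd u (prod.swap p) = snd u p" "AE p in lborel. snd v (prod.swap p) = snd v p"
    using u v by (auto simp: space_H_iff)
  have 1: "ip_L2 (snd u) (op_C l \<alpha> (fst v)) = 2 * ip_L2 (op_B l \<alpha> (snd u)) (fst v)"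
    by (rule ip_op_C) (use L2 s in auto)
  have "ip_L2 (snd v) (op_C l \<alpha> (fst u)) = 2 * ip_L2 (op_B l \<alpha> (snd v)) (fst u)"
    by (rule ip_op_C) (use L2 s in auto)
  from arg_cong[OF this, of cnj] have 2: "ip_L2 (op_C l \<alpha> (fst u)) (snd v) = 2 * ip_L2 (fst u) (op_B l \<alpha> (snd v))"
    using L2 by (simp add: L2.ip_cnj op_C_L2 op_B_L2)
  show ?thesis
    unfolding ip_H_def op_matrix_simps
    using L2 by (simp add: L2.ip_add_left L2.ip_add_right op_A_L2 op_B_L2 op_C_L2 op_D_L2 1 2 ip_op_A ip_op_D add_divide_distrib)
qed

text \<open>Sum of crude bounds for the four blocks; those of \<open>op_B\<close> and
  \<open>op_D\<close> are doubled by \<open>norm_L2_snd_le\<close>.\<close>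

definition M :: real where
  "M = (\<bar>\<gamma>\<bar> + W) + 2 * (\<alpha> * norm_L2 l) + 2 * \<alpha> * norm_L2 l + 2 * (\<bar>\<gamma>\<bar> + 2 * W)"

lemma W_nonneg: "0 \<le> W"
  by (simp add: W_def)

lemma T_bounded:
  assumes "u \<in> space_H"
  shows "norm_H (T u) \<le> M * norm_H u"
proof -
  let ?a = "norm_L2 (fst u)" and ?b = "norm_L2 (snd u)" and ?n = "norm_H u"
  have L2: "fst u \<in> L2" "snd u \<in> L2"
    using assms by (auto simp: space_H_iff)
  have "norm_H (T u) \<le> norm_L2 (op_A \<omega> \<gamma> (fst u) + op_B l \<alpha> (snd u)) + norm_L2 (op_C l \<alpha> (fst u) + op_D \<omega> \<gamma> (snd u))"
    using norm_H_le[of "T u"] by (simp add: op_matrix_simps)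
  also have "\<dots> \<le> (norm_L2 (op_A \<omega> \<gamma> (fst u)) + norm_L2 (op_B l \<alpha> (snd u))) +
      (norm_L2 (op_C l \<alpha> (fst u)) + norm_L2 (op_D \<omega> \<gamma> (snd u)))"
    using L2 by (intro add_mono L2.nrm_triangle op_A_L2 op_B_L2 op_C_L2 op_D_L2)
  also have "\<dots> \<le> ((\<bar>\<gamma>\<bar> + W) * ?a + \<alpha> * (?b * norm_L2 l)) + (2 * \<alpha> * norm_L2 l * ?a + (\<bar>\<gamma>\<bar> + 2 * W) * ?b)"
    using L2 by (intro add_mono op_A_L2 op_B_L2 op_C_L2 op_D_L2)
  also have "\<dots> \<le> ((\<bar>\<gamma>\<bar> + W) * ?n + \<alpha> * ((2 * ?n) * norm_L2 l)) + (2 * \<alpha> * norm_L2 l * ?n + (\<bar>\<gamma>\<bar> + 2 * W) * (2 * ?n))"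
    using \<alpha>_pos W_nonneg norm_L2_fst_le[of u] norm_L2_snd_le[of u]
    by (intro add_mono mult_left_mono mult_right_mono) auto
  also have "\<dots> = M * ?n"
    by (simp add: M_def algebra_simps)
  finally show ?thesis .
qed

section \<open>Resolvent set, spectrum and essential spectrum of the operator matrix\<close>

sublocale Op: symmetric_operator "(\<odot>)" "space_H :: 'a state set" ip_H T M
  rewrites "semi_inner_space.nrm ip_H = norm_H"
proof -
  show "symmetric_operator (\<odot>) (space_H :: 'a state set) ip_H T M"
    by unfold_locales
      (use T_mem T_sym T_bounded \<alpha>_pos W_nonneg in \<open>auto simp: nrm_ip_H M_def\<close>)
qed (rule nrm_ip_H)

lemma shift_eq: "Op.shift w u = T u - w \<odot> u"
  by (rule Op.shift_def)

text \<open>A lower bound at w alone suffices: for real w the conjugate is w itself, and at nonreal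
  points a lower bound always holds.\<close>

lemma resolvent_set_eq: "resolvent_set T = {w. Op.bounded_below w}"
proof (intro equalityI subsetI CollectI)
  fix w assume "w \<in> resolvent_set T"
  then obtain R K where R: "\<And>u. u \<in> space_H \<Longrightarrow> R u \<in> space_H"
    "\<And>u. u \<in> space_H \<Longrightarrow> norm_H (R u) \<le> K * norm_H u"
    "\<And>u. u \<in> space_H \<Longrightarrow> R (T u - w \<odot> u) \<approx> u"
    unfolding resolvent_set_def bounded_operator_def by blast
  show "Op.bounded_below w"
  proof (rule Op.bounded_below_if_left_inverse[of R])
    fix u :: "'a state" assume u: "u \<in> space_H"
    then have "R (T u - w \<odot> u) \<in> space_H"
      by (intro R H.diff_mem T_mem H.sc_mem)
    then show "norm_H (R (T u - w \<odot> u) - u) = 0"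
      using eq_H_iff R(3) u by blast
  qed (use R in auto)
next
  fix w assume "w \<in> {w. Op.bounded_below w}"
  then have bb: "Op.bounded_below w" by simp
  have "Op.bounded_below (cnj w)"
  proof (cases "Im w = 0")
    case True
    then have "cnj w = w" by (simp add: complex_eq_iff)
    then show ?thesis using bb by simp
  qed (simp add: Op.bounded_below_nonreal)
  from Op.resolvent_exists[OF bb this] obtain R where
    R: "\<forall>u\<in>space_H. R u \<in> space_H"
      "\<forall>u\<in>space_H. \<forall>v\<in>space_H. norm_H (R (u + v) - (R u + R v)) = 0"
      "\<forall>c. \<forall>u\<in>space_H. norm_H (R (c \<odot> u) - c \<odot> R u) = 0"
      "\<exists>K. \<forall>u\<in>space_H. norm_H (R u) \<le> K * norm_H u"
      "\<forall>u\<in>space_H. norm_H (R (T u - w \<odot> u) - u) = 0 \<and> norm_H (T (R u) - w \<odot> R u - u) = 0"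
    by blast
  have "bounded_operator R"
    unfolding bounded_operator_def using R(1-4) by (auto simp: eq_H_iff)
  moreover have "\<forall>u\<in>space_H. R (T u - w \<odot> u) \<approx> u \<and> T (R u) - w \<odot> R u \<approx> u"
    using R(1,5) by (auto simp: eq_H_iff T_mem)
  ultimately show "w \<in> resolvent_set T"
    unfolding resolvent_set_def by blast
qed

lemma spectrum_eq: "spectrum T = {w. \<not> Op.bounded_below w}"
  by (auto simp: spectrum_def resolvent_set_eq)

lemma spectrum_real: "w \<in> spectrum T \<Longrightarrow> Im w = 0"
  using Op.bounded_below_nonreal[of w] by (auto simp: spectrum_eq)

text \<open>If z is not regular, the three facts about semi-Fredholm points (an eigenvector, lower
  bounds in a punctured neighbourhood, a finite-dimensional kernel) match the three conditions under
  which \<open>essential_spectrum\<close> removes a point.\<close>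

lemma not_in_essential_spectrum:
  fixes ell :: "'i \<Rightarrow> 'a state \<Rightarrow> complex"
  assumes "semi_fredholm_at (\<odot>) (space_H :: 'a state set) ip_H T M z C L I ell"
  shows "of_real z \<notin> essential_spectrum T"
proof (cases "Op.bounded_below (of_real z)")
  case True
  then show ?thesis
    by (simp add: essential_spectrum_def spectrum_eq)
next
  case False
  interpret F: semi_fredholm_at "(\<odot>)" "space_H :: 'a state set" ip_H T M z C L I ell
    rewrites "semi_inner_space.nrm ip_H = norm_H"
    by (rule assms nrm_ip_H)+
  obtain d where d: "d > 0" "\<And>w. 0 < dist w (of_real z) \<Longrightarrow> dist w (of_real z) < d \<Longrightarrow> Op.bounded_below w"
    using F.bounded_below_near by blast
  have "of_real z isolated_in spectrum T"
    unfolding isolated_in_dist_Ex_iff spectrum_eq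
    using False d by (metis dist_commute mem_Collect_eq zero_less_dist_iff)
  moreover have "eigenvalue T (of_real z)"
  proof -
    obtain u where u: "u \<in> space_H" "norm_H u = 1" "norm_H (T u - of_real z \<odot> u) = 0"
      using F.eigenvector_if_not_bounded_below[OF False] unfolding shift_eq by blast
    then have "T u \<approx> of_real z \<odot> u" "\<not> u \<approx> 0"
      using eq_H_iff[of "T u" "of_real z \<odot> u"] eq_H_iff[of u 0] by (auto simp: T_mem)
    then show ?thesis
      using u unfolding eigenvalue_def eigenspace_def by blast
  qed
  moreover have "finite_multiplicity T (of_real z)"
  proof -
    obtain B where B: "finite B" "B \<subseteq> space_H"
      "\<And>u. u \<in> space_H \<Longrightarrow> norm_H (T u - of_real z \<odot> u) = 0 \<Longrightarrow> \<exists>c. norm_H (u - (\<Sum>b\<in>B. c b \<odot> b)) = 0"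
      using F.finite_dimensional_kernel unfolding shift_eq by blast
    have "\<exists>c. u \<approx> (\<Sum>b\<in>B. c b \<odot> b)" if "u \<in> eigenspace T (of_real z)" for u
    proof -
      have u: "u \<in> space_H" "norm_H (T u - of_real z \<odot> u) = 0"
        using that eq_H_iff[of "T u" "of_real z \<odot> u"] by (auto simp: eigenspace_def T_mem)
      obtain c where c: "norm_H (u - (\<Sum>b\<in>B. c b \<odot> b)) = 0"
        using B(3)[OF u] by blast
      have "(\<Sum>b\<in>B. c b \<odot> b) \<in> space_H"
        using B(2) by (intro H.sum_mem) auto
      then show ?thesis
        using c u eq_H_iff by blast
    qed
    then show ?thesis
      unfolding finite_multiplicity_def using B(1,2) by blast
  qed
  ultimately show ?thesis
    by (simp add: essential_spectrum_def)
qed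

end

section \<open>The Schur complement\<close>

context matrix_model
begin

text \<open>For \<open>s = \<omega> k\<close> this is, up to a factor, the kernel of the Schur
  complement as a function of q. Decoupling s from k lets it run through the whole interval from w0
  to w1. With other arguments the same function represents the integral in \<Phi> and the second
  component of test vectors.\<close>

definition res :: "real \<Rightarrow> real \<Rightarrow> 'a \<Rightarrow> complex" where
  "res z s q = l q / of_real (\<gamma> + s + \<omega> q - z)"

definition res_pairing :: "real \<Rightarrow> real \<Rightarrow> ('a \<Rightarrow> complex) \<Rightarrow> complex" where
  "res_pairing z s f = (\<integral>q. f q * res z s q \<partial>lborel)"

lemma measurable_res [measurable]: "res z s \<in> borel_measurable borel"
  unfolding res_def[abs_def] by measurable

lemma
  assumes "0 < \<delta>" "\<And>q. \<delta> \<le> \<bar>\<gamma> + s + \<omega> q - z\<bar>"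
  shows res_L2: "res z s \<in> L2" and norm_res_le: "norm_L2 (res z s) \<le> 1 / \<delta> * norm_L2 l"
proof -
  have *: "AE q in lborel. cmod (res z s q) \<le> 1 / \<delta> * cmod (l q)"
    using assms frac_le[of "cmod (l _)" "cmod (l _)" \<delta>]
    by (auto simp: res_def norm_divide simp flip: of_real_add of_real_diff)
  show "res z s \<in> L2"
    by (rule L2_dominated[OF l_L2 _ *]) measurable
  show "norm_L2 (res z s) \<le> 1 / \<delta> * norm_L2 l"
    by (rule norm_L2_le[OF l_L2 _ _ *]) (use assms(1) in auto)
qed

text \<open>The identity \<open>1 / a - 1 / b = (b - a) / (a * b)\<close>, with both denominators at
  least \<delta> in modulus.\<close>

lemma norm_res_diff_le:
  assumes \<delta>: "0 < \<delta>" "\<And>q. \<delta> \<le> \<bar>\<gamma> + s + \<omega> q - z\<bar>" "\<And>q. \<delta> \<le> \<bar>\<gamma> + t + \<omega> q - z\<bar>"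
  shows "norm_L2 (res z s - res z t) \<le> \<bar>s - t\<bar> / \<delta>\<^sup>2 * norm_L2 l"
proof (rule norm_L2_le[OF l_L2])
  show "AE q in lborel. cmod ((res z s - res z t) q) \<le> \<bar>s - t\<bar> / \<delta>\<^sup>2 * cmod (l q)"
  proof (rule AE_I2)
    fix q
    define a b where "a = \<gamma> + s + \<omega> q - z" and "b = \<gamma> + t + \<omega> q - z"
    have ab: "\<delta> \<le> \<bar>a\<bar>" "\<delta> \<le> \<bar>b\<bar>"
      using \<delta> by (auto simp: a_def b_def)
    then have nz: "a \<noteq> 0" "b \<noteq> 0" using \<delta>(1) by auto
    have "(res z s - res z t) q = l q / of_real a - l q / of_real b"
      by (simp add: res_def a_def b_def)
    also have "\<dots> = of_real ((b - a) / (a * b)) * l q"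
      using nz by (simp add: field_simps)
    also have "b - a = t - s"
      by (simp add: a_def b_def)
    finally have "cmod ((res z s - res z t) q) = \<bar>s - t\<bar> / (\<bar>a\<bar> * \<bar>b\<bar>) * cmod (l q)"
      by (simp only: norm_mult norm_of_real abs_divide abs_mult abs_minus_commute)
    also have "\<dots> \<le> \<bar>s - t\<bar> / \<delta>\<^sup>2 * cmod (l q)"
      using ab \<delta>(1) by (intro mult_right_mono frac_le) (auto simp: power2_eq_square intro!: mult_mono)
    finally show "cmod ((res z s - res z t) q) \<le> \<bar>s - t\<bar> / \<delta>\<^sup>2 * cmod (l q)" .
  qed
  show "res z s - res z t \<in> borel_measurable borel"
    unfolding fun_diff_def by measurable
qed (use \<delta> in auto)

lemma measurable_Phi_shift: "(\<lambda>k. Phi \<omega> l \<gamma> \<alpha> (z - \<omega> k)) \<in> borel_measurable borel"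
proof -
  have [measurable]: "(\<lambda>p. l (snd p)) \<in> borel_measurable (borel :: ('a \<times> 'a) measure)"
    by (rule borel_measurable_o_snd[OF measurable_l])
  have "(\<lambda>p :: 'a \<times> 'a. (cmod (l (snd p)))\<^sup>2 / (\<omega> (snd p) + \<gamma> - (z - \<omega> (fst p)))) \<in> borel_measurable borel"
    using measurable_\<omega>_fst measurable_\<omega>_snd by measurable
  from borel_measurable_integral_section[OF this] show ?thesis
    unfolding Phi_def by simp
qed

text \<open>
  Eliminating the second component by \<open>D - z\<close> leaves multiplication by \<open>\<lambda>k. \<Phi> (z - \<omega> k)\<close>
  plus the integral operator with kernel
  \<open>- \<alpha>\<^sup>2 * cnj (l k) * l q / (\<gamma> + \<omega> k + \<omega> q - z)\<close>.
\<close>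

lemma schur_complement:
  assumes u: "u \<in> space_H" and \<delta>: "0 < \<delta>" "\<And>k q. \<delta> \<le> \<bar>\<gamma> + \<omega> k + \<omega> q - z\<bar>"
  defines "sd \<equiv> \<lambda>p. of_real (1 / (\<gamma> + \<omega> (fst p) + \<omega> (snd p) - z)) * snd (T u - of_real z \<odot> u) p"
  shows "AE k in lborel. of_real (Phi \<omega> l \<gamma> \<alpha> (z - \<omega> k)) * fst u k - fst (T u - of_real z \<odot> u) k
      + of_real \<alpha> * partial_pairing sd l k = of_real (\<alpha>\<^sup>2) * cnj (l k) * res_pairing z (\<omega> k) (fst u)"
    and "sd \<in> L2" and "norm_L2 sd \<le> 1 / \<delta> * norm_L2 (snd (T u - of_real z \<odot> u))"
    and "snd u = (\<lambda>p. of_real (1 / (\<gamma> + \<omega> (fst p) + \<omega> (snd p) - z)) *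
      (snd (T u - of_real z \<odot> u) - op_C l \<alpha> (fst u)) p)"
proof -
  define f g where "f = fst u" and "g = snd u"
  define r s where "r = fst (T u - of_real z \<odot> u)" and "s = snd (T u - of_real z \<odot> u)"
  define d where "d k q = \<gamma> + \<omega> k + \<omega> q - z" for k q
  have d: "\<delta> \<le> \<bar>d k q\<bar>" "d k q \<noteq> 0" for k q
    using \<delta>(2)[of k q] \<delta>(1) by (auto simp: d_def)
  have f: "f \<in> L2" and s: "s \<in> L2"
    using u T_mem[OF u] H.diff_mem[OF T_mem[OF u] H.sc_mem[OF u]] by (auto simp: space_H_iff f_def s_def)
  have [measurable]: "f \<in> borel_measurable borel"
    using f by (rule L2_measurable)
  have inv_le: "cmod (of_real (1 / d (fst p) (snd p))) \<le> 1 / \<delta>" for p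
    using d(1)[of "fst p" "snd p"] \<delta>(1) unfolding norm_of_real by (simp add: frac_le)
  have inv_m: "(\<lambda>p :: 'a \<times> 'a. complex_of_real (1 / d (fst p) (snd p))) \<in> borel_measurable borel"
    using measurable_\<omega>_fst measurable_\<omega>_snd unfolding d_def by measurable
  show sd: "sd \<in> L2" and "norm_L2 sd \<le> 1 / \<delta> * norm_L2 (snd (T u - of_real z \<odot> u))"
    using L2_mult_bounded[OF s inv_m inv_le] by (simp_all add: sd_def s_def d_def)
  \<comment> \<open>The second row of the equation solved for the second component.\<close>
  have g_eq: "g (k, q) = of_real (1 / d k q) * (s (k, q) - of_real \<alpha> * (cnj (l k) * f q) - of_real \<alpha> * (cnj (l q) * f k))" for k q
  proof -
    have "s (k, q) = of_real (d k q) * g (k, q) + of_real \<alpha> * (cnj (l k) * f q) + of_real \<alpha> * (cnj (l q) * f k)"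
      by (simp add: s_def f_def g_def op_matrix_simps op_C_eq op_D_eq tensor_def d_def algebra_simps)
    then show ?thesis
      using d(2)[of k q] by simp
  qed
  show "snd u = (\<lambda>p. of_real (1 / (\<gamma> + \<omega> (fst p) + \<omega> (snd p) - z)) *
      (snd (T u - of_real z \<odot> u) - op_C l \<alpha> (fst u)) p)"
  proof
    fix p show "snd u p = of_real (1 / (\<gamma> + \<omega> (fst p) + \<omega> (snd p) - z)) *
      (snd (T u - of_real z \<odot> u) - op_C l \<alpha> (fst u)) p"
      using g_eq[of "fst p" "snd p"]
      by (simp add: f_def g_def s_def d_def op_C_eq tensor_def algebra_simps)
  qed
  have sd_eq: "sd (k, q) = of_real (1 / d k q) * s (k, q)"
    and res_eq: "res z (\<omega> k) q = l q / of_real (d k q)" for k q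
    by (simp_all add: sd_def s_def d_def res_def)
  have "AE k in lborel. (\<lambda>q. sd (k, q)) \<in> L2"
    by (rule AE_section_L2[OF sd])
  then have "AE k in lborel. of_real (Phi \<omega> l \<gamma> \<alpha> (z - \<omega> k)) * f k - r k
      + of_real \<alpha> * partial_pairing sd l k = of_real (\<alpha>\<^sup>2) * cnj (l k) * res_pairing z (\<omega> k) f"
  proof eventually_elim
    case (elim k)
    have res: "res z (\<omega> k) \<in> L2"
      using res_L2[of \<delta> "\<omega> k" z] \<delta> by auto
    have I1: "integrable lborel (\<lambda>q. sd (k, q) * l q)"
      by (rule L2_mult_integrable[OF elim l_L2])
    have I2: "integrable lborel (\<lambda>q. f q * res z (\<omega> k) q)"
      by (rule L2_mult_integrable[OF f res])
    have I3: "integrable lborel (\<lambda>q. lc q * res z (\<omega> k) q)"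
      by (rule L2_mult_integrable[OF lc_L2 res])
    \<comment> \<open>After inserting g, the term with \<open>f q\<close> yields the integral
      operator. The term with \<open>f k\<close> multiplies f by the integral in \<Phi>; combined
      with \<open>- \<gamma> + \<omega> k - z\<close> from the first row it forms
      \<open>\<Phi> (z - \<omega> k)\<close>.\<close>
    have "partial_pairing g l k = (\<integral>q. sd (k, q) * l q - of_real \<alpha> * cnj (l k) * (f q * res z (\<omega> k) q)
        - of_real \<alpha> * f k * (lc q * res z (\<omega> k) q) \<partial>lborel)"
      unfolding partial_pairing_def
      by (intro Bochner_Integration.integral_cong refl)
        (simp add: g_eq sd_eq res_eq divide_inverse algebra_simps)
    also have "\<dots> = partial_pairing sd l k - of_real \<alpha> * cnj (l k) * res_pairing z (\<omega> k) f
        - of_real \<alpha> * f k * (\<integral>q. lc q * res z (\<omega> k) q \<partial>lborel)"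
      using I1 I2 I3 by (simp add: partial_pairing_def res_pairing_def)
    also have "(\<integral>q. lc q * res z (\<omega> k) q \<partial>lborel) = (\<integral>q. of_real ((cmod (l q))\<^sup>2 / (\<omega> q + \<gamma> - (z - \<omega> k))) \<partial>lborel)"
      by (intro Bochner_Integration.integral_cong refl)
        (simp add: res_def complex_norm_square mult.commute algebra_simps del: of_real_power)
    also have "\<dots> = of_real (\<integral>q. (cmod (l q))\<^sup>2 / (\<omega> q + \<gamma> - (z - \<omega> k)) \<partial>lborel)"
      by (rule integral_complex_of_real)
    finally have pp: "partial_pairing g l k = partial_pairing sd l k - of_real \<alpha> * cnj (l k) * res_pairing z (\<omega> k) f
        - of_real \<alpha> * f k * of_real (\<integral>q. (cmod (l q))\<^sup>2 / (\<omega> q + \<gamma> - (z - \<omega> k)) \<partial>lborel)" .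
    have "r k = of_real (- \<gamma> + \<omega> k - z) * f k + of_real \<alpha> * partial_pairing g l k"
      by (simp add: r_def f_def g_def op_matrix_simps op_A_def op_B_eq algebra_simps)
    then show ?case
      unfolding pp Phi_def by (simp add: algebra_simps power2_eq_square)
  qed
  then show "AE k in lborel. of_real (Phi \<omega> l \<gamma> \<alpha> (z - \<omega> k)) * fst u k - fst (T u - of_real z \<odot> u) k
      + of_real \<alpha> * partial_pairing sd l k = of_real (\<alpha>\<^sup>2) * cnj (l k) * res_pairing z (\<omega> k) (fst u)"
    by (simp only: f_def r_def)
qed

text \<open>
  Since \<open>res_pairing z s f\<close> is Lipschitz in \<open>s\<close>, its values for finitely many \<open>s\<close> control it
  up to a small multiple of \<open>norm_L2 f\<close>.
\<close>

lemma res_pairing_le_finite: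
  assumes \<delta>: "0 < \<delta>" "\<And>s q. w0 \<le> s \<Longrightarrow> s \<le> w1 \<Longrightarrow> \<delta> \<le> \<bar>\<gamma> + s + \<omega> q - z\<bar>" and \<epsilon>: "0 < \<epsilon>"
  shows "\<exists>I. finite I \<and> I \<subseteq> {w0..w1} \<and> (\<forall>f\<in>L2. \<forall>s\<in>{w0..w1}.
    cmod (res_pairing z s f) \<le> (\<Sum>t\<in>I. cmod (res_pairing z t f)) + \<epsilon> * norm_L2 f)"
proof -
  \<comment> \<open>In s, the pairing has Lipschitz constant
    \<open>norm_L2 f * norm_L2 l / \<delta>\<^sup>2\<close>, so a net of mesh \<eta> costs at most
    \<open>\<epsilon> * norm_L2 f\<close>. The summand 1 covers
    \<open>norm_L2 l = 0\<close>.\<close>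
  define \<eta> where "\<eta> = \<epsilon> * \<delta>\<^sup>2 / (norm_L2 l + 1)"
  have \<eta>: "\<eta> > 0"
    using \<delta>(1) \<epsilon> by (simp add: \<eta>_def add_nonneg_pos)
  obtain I where I: "finite I" "I \<subseteq> {w0..w1}" "{w0..w1} \<subseteq> (\<Union>t\<in>I. ball t \<eta>)"
    using seq_compact_imp_totally_bounded[of "{w0..w1}"] \<eta> compact_Icc[of w0 w1]
    by (auto simp: compact_eq_seq_compact_metric)
  have "cmod (res_pairing z s f) \<le> (\<Sum>t\<in>I. cmod (res_pairing z t f)) + \<epsilon> * norm_L2 f"
    if f: "f \<in> L2" and s: "s \<in> {w0..w1}" for f s
  proof -
    obtain t where t: "t \<in> I" "\<bar>s - t\<bar> < \<eta>"
      using I(3) s by (force simp: dist_real_def abs_minus_commute)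
    then have res: "res z s \<in> L2" "res z t \<in> L2"
      using s I(2) by (auto intro!: res_L2[of \<delta>] \<delta>)
    have "res_pairing z s f - res_pairing z t f = (\<integral>q. f q * (res z s - res z t) q \<partial>lborel)"
      using L2_mult_integrable[OF f res(1)] L2_mult_integrable[OF f res(2)]
      by (simp add: res_pairing_def right_diff_distrib)
    then have "cmod (res_pairing z s f - res_pairing z t f) \<le> norm_L2 f * norm_L2 (res z s - res z t)"
      using Cauchy_Schwarz_L2[OF f L2.diff_mem[OF res]] by simp
    also have "\<dots> \<le> norm_L2 f * (\<bar>s - t\<bar> / \<delta>\<^sup>2 * norm_L2 l)"
      using s t I(2) by (intro mult_left_mono norm_res_diff_le \<delta>) auto
    also have "\<dots> \<le> norm_L2 f * (\<eta> / \<delta>\<^sup>2 * norm_L2 l)"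
      using t by (intro mult_left_mono mult_right_mono divide_right_mono) auto
    also have "\<dots> \<le> norm_L2 f * \<epsilon>"
    proof (intro mult_left_mono)
      have "\<eta> / \<delta>\<^sup>2 * norm_L2 l = \<epsilon> * (norm_L2 l / (norm_L2 l + 1))"
        using \<delta>(1) by (simp add: \<eta>_def)
      also have "\<dots> \<le> \<epsilon> * 1"
        using \<epsilon> by (intro mult_left_mono) (auto simp: divide_le_eq_1 add_nonneg_pos)
      finally show "\<eta> / \<delta>\<^sup>2 * norm_L2 l \<le> \<epsilon>" by simp
    qed simp
    finally have "cmod (res_pairing z s f) \<le> cmod (res_pairing z t f) + \<epsilon> * norm_L2 f"
      using norm_triangle_sub[of "res_pairing z s f" "res_pairing z t f"] by (simp add: mult.commute)
    also have "cmod (res_pairing z t f) \<le> (\<Sum>t\<in>I. cmod (res_pairing z t f))"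
      using I(1) t by (intro member_le_sum) auto
    finally show ?thesis by simp
  qed
  then show ?thesis
    using I by blast
qed

text \<open>Multiplication by \<open>\<Phi> (z - \<omega> k)\<close> is bounded below by c. The
  integral operator is bounded by finitely many functionals plus an error of at most half of c,
  which moves to the left-hand side. The second component is then recovered from the second
  row.\<close>

lemma semi_fredholm:
  assumes \<delta>: "0 < \<delta>" "\<And>s q. w0 \<le> s \<Longrightarrow> s \<le> w1 \<Longrightarrow> \<delta> \<le> \<bar>\<gamma> + s + \<omega> q - z\<bar>"
    and c: "0 < c" "\<And>k. c \<le> \<bar>Phi \<omega> l \<gamma> \<alpha> (z - \<omega> k)\<bar>"
  shows "\<exists>C I. semi_fredholm_at (\<odot>) (space_H :: 'a state set) ip_H T M z C (1 / \<delta> * norm_L2 l) I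
    (\<lambda>s u. res_pairing z s (fst u))"
proof -
  have \<delta>': "\<delta> \<le> \<bar>\<gamma> + \<omega> k + \<omega> q - z\<bar>" for k q
    using \<delta>(2)[OF w0_le le_w1] .
  define \<Lambda> where "\<Lambda> = norm_L2 l"
  have \<Lambda>: "0 \<le> \<Lambda>" by (simp add: \<Lambda>_def)
  \<comment> \<open>Makes the contribution of the net error to the first row at most
    \<open>c / 2 * norm_L2 f\<close>, half of what the multiplication part provides.\<close>
  define \<epsilon> where "\<epsilon> = c / (2 * (\<alpha>\<^sup>2 * \<Lambda> + 1))"
  have pos: "\<alpha>\<^sup>2 * \<Lambda> + 1 > 0"
    using \<Lambda> by (intro add_nonneg_pos) auto
  have \<epsilon>: "0 < \<epsilon>" using c pos by (simp add: \<epsilon>_def)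
  have \<epsilon>_le: "\<alpha>\<^sup>2 * \<Lambda> * \<epsilon> \<le> c / 2"
    using c pos by (simp add: \<epsilon>_def field_simps)
  obtain I where I: "finite I" "I \<subseteq> {w0..w1}" "\<And>f s. f \<in> L2 \<Longrightarrow> s \<in> {w0..w1} \<Longrightarrow>
      cmod (res_pairing z s f) \<le> (\<Sum>t\<in>I. cmod (res_pairing z t f)) + \<epsilon> * norm_L2 f"
    using res_pairing_le_finite[OF \<delta> \<epsilon>] by blast
  \<comment> \<open>K1 is the constant for the first component (\<open>f_le\<close>); C adds the one
    for the second (\<open>g_le\<close>).\<close>
  define K1 where "K1 = 2 / c * (1 + 2 * \<alpha> * \<Lambda> / \<delta> + \<alpha>\<^sup>2 * \<Lambda>)"
  have K1: "K1 \<ge> 0"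
    using c \<delta>(1) \<Lambda> \<alpha>_pos by (simp add: K1_def)
  define C where "C = K1 + 1 / \<delta> * (2 + 2 * \<alpha> * \<Lambda> * K1)"
  have est: "norm_H u \<le> C * (norm_H (T u - of_real z \<odot> u) + (\<Sum>t\<in>I. cmod (res_pairing z t (fst u))))"
    if u: "u \<in> space_H" for u
  proof -
    define f g where "f = fst u" and "g = snd u"
    define r s where "r = fst (T u - of_real z \<odot> u)" and "s = snd (T u - of_real z \<odot> u)"
    define N where "N = norm_H (T u - of_real z \<odot> u)"
    define S where "S = (\<Sum>t\<in>I. cmod (res_pairing z t f))"
    define sd where "sd = (\<lambda>p. of_real (1 / (\<gamma> + \<omega> (fst p) + \<omega> (snd p) - z)) * s p)"
    define P where "P k = Phi \<omega> l \<gamma> \<alpha> (z - \<omega> k)" for k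
    have N: "0 \<le> N" by (simp add: N_def norm_H_nonneg)
    have S: "0 \<le> S" by (simp add: S_def sum_nonneg)
    have mem: "T u - of_real z \<odot> u \<in> space_H"
      using u by (intro H.diff_mem H.sc_mem T_mem)
    have L2: "f \<in> L2" "g \<in> L2" "r \<in> L2" "s \<in> L2"
      using u mem by (auto simp: space_H_iff f_def g_def r_def s_def)
    note sc = schur_complement[OF u \<delta>(1) \<delta>', folded f_def g_def r_def s_def P_def, folded sd_def]
    have r: "norm_L2 r \<le> N" and s: "norm_L2 s \<le> 2 * N"
      unfolding r_def s_def N_def by (rule norm_L2_fst_le norm_L2_snd_le)+
    have sd: "norm_L2 sd \<le> 1 / \<delta> * (2 * N)"
      using sc(3) mult_left_mono[OF s, of "1 / \<delta>"] \<delta>(1) by simp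
    define pp where "pp k = of_real \<alpha> * partial_pairing sd l k" for k
    have pp_L2: "pp \<in> L2"
      unfolding pp_def[abs_def] by (intro L2_scale partial_pairing_L2 sc l_L2)
    have "norm_L2 pp = \<alpha> * norm_L2 (partial_pairing sd l)"
      unfolding pp_def[abs_def] using \<alpha>_pos by (subst L2.nrm_sc) (auto intro: partial_pairing_L2 sc l_L2)
    also have "\<dots> \<le> \<alpha> * (norm_L2 sd * \<Lambda>)"
      unfolding \<Lambda>_def using \<alpha>_pos by (intro mult_left_mono partial_pairing_L2 sc l_L2) auto
    also have "\<dots> \<le> \<alpha> * (1 / \<delta> * (2 * N) * \<Lambda>)"
      using \<alpha>_pos sd \<Lambda> by (intro mult_left_mono mult_right_mono) auto
    finally have pp: "norm_L2 pp \<le> 2 * \<alpha> * \<Lambda> / \<delta> * N"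
      by (simp add: field_simps)
    define v where "v k = of_real (P k) * f k - r k + pp k" for k
    define Q where "Q = \<alpha>\<^sup>2 * (S + \<epsilon> * norm_L2 f)"
    have Q: "0 \<le> Q" using S \<epsilon> by (simp add: Q_def)
    have v_AE: "AE k in lborel. cmod (v k) \<le> Q * cmod (l k)"
      using sc(1)
    proof eventually_elim
      case (elim k)
      then have "v k = of_real (\<alpha>\<^sup>2) * cnj (l k) * res_pairing z (\<omega> k) f"
        by (simp add: v_def pp_def)
      then have "cmod (v k) = \<alpha>\<^sup>2 * (cmod (l k) * cmod (res_pairing z (\<omega> k) f))"
        by (simp only: norm_mult norm_of_real abs_power2 complex_mod_cnj mult.assoc)
      also have "\<dots> \<le> \<alpha>\<^sup>2 * (cmod (l k) * (S + \<epsilon> * norm_L2 f))"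
        unfolding S_def using w0_le le_w1 L2 by (intro mult_left_mono I) auto
      finally show ?case
        by (simp add: Q_def algebra_simps)
    qed
    have [measurable]: "P \<in> borel_measurable borel" "f \<in> borel_measurable borel"
      "r \<in> borel_measurable borel" "pp \<in> borel_measurable borel"
      using measurable_Phi_shift[of z] L2 pp_L2 by (auto simp: P_def[abs_def] L2_measurable)
    have v_m: "v \<in> borel_measurable borel"
      unfolding v_def[abs_def] by measurable
    have v_L2: "v \<in> L2"
      by (rule L2_dominated[OF l_L2 v_m v_AE])
    have v: "norm_L2 v \<le> Q * \<Lambda>"
      unfolding \<Lambda>_def by (rule norm_L2_le[OF l_L2 v_m Q v_AE])
    have Pf: "(\<lambda>k. of_real (P k) * f k) = v + r - pp"
      by (auto simp: v_def)
    have Pf_L2: "(\<lambda>k. of_real (P k) * f k) \<in> L2"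
      unfolding Pf using v_L2 L2 pp_L2 by (intro L2.diff_mem L2_add)
    have "norm_L2 (\<lambda>k. of_real (P k) * f k) \<le> norm_L2 (v + r) + norm_L2 pp"
      unfolding Pf using v_L2 L2 pp_L2 by (intro L2.nrm_triangle_diff L2_add)
    also have "norm_L2 (v + r) \<le> norm_L2 v + norm_L2 r"
      using v_L2 L2 by (intro L2.nrm_triangle)
    finally have Pf_le: "norm_L2 (\<lambda>k. of_real (P k) * f k) \<le> Q * \<Lambda> + N + 2 * \<alpha> * \<Lambda> / \<delta> * N"
      using v r pp by linarith
    have "norm_L2 f \<le> 1 / c * norm_L2 (\<lambda>k. of_real (P k) * f k)"
    proof (rule norm_L2_le[OF Pf_L2])
      have "cmod (f k) \<le> 1 / c * cmod (of_real (P k) * f k)" for k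
      proof -
        have "c * cmod (f k) \<le> \<bar>P k\<bar> * cmod (f k)"
          using c(2)[of k] by (intro mult_right_mono) (auto simp: P_def)
        then show ?thesis
          using c(1) by (simp add: norm_mult field_simps)
      qed
      then show "AE k in lborel. cmod (f k) \<le> 1 / c * cmod (of_real (P k) * f k)"
        by simp
    qed (use c in auto)
    then have "c * norm_L2 f \<le> Q * \<Lambda> + N + 2 * \<alpha> * \<Lambda> / \<delta> * N"
      using Pf_le c(1) by (simp add: field_simps)
    moreover have "Q * \<Lambda> = \<alpha>\<^sup>2 * \<Lambda> * S + \<alpha>\<^sup>2 * \<Lambda> * \<epsilon> * norm_L2 f"
      by (simp add: Q_def algebra_simps)
    moreover have "\<alpha>\<^sup>2 * \<Lambda> * \<epsilon> * norm_L2 f \<le> c / 2 * norm_L2 f"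
      using \<epsilon>_le by (intro mult_right_mono) auto
    ultimately have "c / 2 * norm_L2 f \<le> \<alpha>\<^sup>2 * \<Lambda> * S + N + 2 * \<alpha> * \<Lambda> / \<delta> * N"
      by simp
    also have "\<dots> \<le> (1 + 2 * \<alpha> * \<Lambda> / \<delta> + \<alpha>\<^sup>2 * \<Lambda>) * (N + S)"
    proof -
      have "0 \<le> (1 + 2 * \<alpha> * \<Lambda> / \<delta>) * S + \<alpha>\<^sup>2 * \<Lambda> * N"
        using S N \<Lambda> \<alpha>_pos \<delta>(1) by simp
      then show ?thesis by (simp add: algebra_simps add_divide_distrib)
    qed
    finally have "2 / c * (c / 2 * norm_L2 f) \<le> 2 / c * ((1 + 2 * \<alpha> * \<Lambda> / \<delta> + \<alpha>\<^sup>2 * \<Lambda>) * (N + S))"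
      using c(1) by (intro mult_left_mono) auto
    then have f_le: "norm_L2 f \<le> K1 * (N + S)"
      unfolding K1_def mult.assoc[of "2 / c" _ "N + S"] using c(1) by simp
    have "norm_L2 g \<le> 1 / \<delta> * norm_L2 (s - op_C l \<alpha> f)"
    proof (rule norm_L2_le)
      show "s - op_C l \<alpha> f \<in> L2"
        using L2 by (intro L2.diff_mem op_C_L2)
      have "cmod (g p) \<le> 1 / \<delta> * cmod ((s - op_C l \<alpha> f) p)" for p
      proof -
        have "cmod (g p) = 1 / \<bar>\<gamma> + \<omega> (fst p) + \<omega> (snd p) - z\<bar> * cmod ((s - op_C l \<alpha> f) p)"
          by (subst sc(4)) (simp only: norm_mult norm_of_real abs_divide abs_one)
        also have "\<dots> \<le> 1 / \<delta> * cmod ((s - op_C l \<alpha> f) p)"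
          using \<delta>'[of "fst p" "snd p"] \<delta>(1) by (intro mult_right_mono frac_le) auto
        finally show ?thesis .
      qed
      then show "AE p in lborel. cmod (g p) \<le> 1 / \<delta> * cmod ((s - op_C l \<alpha> f) p)"
        by simp
    qed (use L2 \<delta>(1) in \<open>auto simp: L2_measurable\<close>)
    also have "norm_L2 (s - op_C l \<alpha> f) \<le> norm_L2 s + norm_L2 (op_C l \<alpha> f)"
      using L2 by (intro L2.nrm_triangle_diff op_C_L2)
    also have "\<dots> \<le> 2 * (N + S) + 2 * \<alpha> * \<Lambda> * (K1 * (N + S))"
    proof (rule add_mono)
      show "norm_L2 s \<le> 2 * (N + S)" using s S by simp
      have "norm_L2 (op_C l \<alpha> f) \<le> 2 * \<alpha> * \<Lambda> * norm_L2 f"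
        using op_C_L2(2)[OF L2(1)] by (simp add: \<Lambda>_def)
      also have "\<dots> \<le> 2 * \<alpha> * \<Lambda> * (K1 * (N + S))"
        using f_le \<alpha>_pos \<Lambda> by (intro mult_left_mono) auto
      finally show "norm_L2 (op_C l \<alpha> f) \<le> 2 * \<alpha> * \<Lambda> * (K1 * (N + S))" .
    qed
    finally have g_le: "norm_L2 g \<le> 1 / \<delta> * (2 * (N + S) + 2 * \<alpha> * \<Lambda> * (K1 * (N + S)))"
      using \<delta>(1) by (simp add: divide_right_mono)
    have "norm_H u \<le> norm_L2 f + norm_L2 g"
      using norm_H_le[of u] by (simp add: f_def g_def)
    also have "\<dots> \<le> C * (N + S)"
      using f_le g_le by (simp add: C_def algebra_simps add_divide_distrib)
    finally show ?thesis
      by (simp add: N_def S_def f_def)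
  qed
  have "semi_fredholm_at (\<odot>) (space_H :: 'a state set) ip_H T M z C (1 / \<delta> * norm_L2 l) I
    (\<lambda>s u. res_pairing z s (fst u))"
  proof (unfold_locales, unfold nrm_ip_H shift_eq)
    fix u v :: "'a state" and i :: real and a :: complex
    assume u: "u \<in> space_H" and i: "i \<in> I"
    have L2: "fst u \<in> L2" and res: "res z i \<in> L2" and nres: "norm_L2 (res z i) \<le> 1 / \<delta> * norm_L2 l"
      using u i I(2) res_L2[of \<delta> i z] norm_res_le[of \<delta> i z] \<delta> by (auto simp: space_H_iff subset_iff)
    show "res_pairing z i (fst (a \<odot> u)) = a * res_pairing z i (fst u)"
      by (simp add: res_pairing_def mult.assoc)
    show "cmod (res_pairing z i (fst u)) \<le> 1 / \<delta> * norm_L2 l * norm_H u"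
    proof -
      have "cmod (res_pairing z i (fst u)) \<le> norm_L2 (fst u) * norm_L2 (res z i)"
        unfolding res_pairing_def by (rule Cauchy_Schwarz_L2[OF L2 res])
      also have "\<dots> \<le> norm_H u * (1 / \<delta> * norm_L2 l)"
        using nres norm_L2_fst_le by (intro mult_mono norm_H_nonneg norm_L2_nonneg)
      finally show ?thesis by (simp add: mult.commute)
    qed
    assume v: "v \<in> space_H"
    then have "fst v \<in> L2" by (simp add: space_H_iff)
    then show "res_pairing z i (fst (u + v)) = res_pairing z i (fst u) + res_pairing z i (fst v)"
      using L2_mult_integrable[OF L2 res] L2_mult_integrable[OF _ res]
      by (simp add: res_pairing_def distrib_right)
  qed (use I(1) est in auto)
  then show ?thesis by blast
qed

end

section \<open>Approximate eigenvectors\<close>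

context matrix_model
begin

text \<open>Dominated convergence: the balls shrink to a single point, which is a null set.\<close>

lemma norm_L2_indicator_ball_small:
  assumes "0 < \<eta>"
  shows "\<exists>d>0. \<forall>r\<le>d. norm_L2 (\<lambda>x. indicator (ball k r) x * l x) < \<eta>"
proof -
  let ?s = "\<lambda>n x. indicator (ball k (1 / Suc n)) x * (cmod (l x))\<^sup>2 :: real"
  have "(\<lambda>n. \<integral>x. ?s n x \<partial>lborel) \<longlonglongrightarrow> (\<integral>x. 0 \<partial>(lborel :: 'a measure))"
  proof (rule integral_dominated_convergence)
    show "integrable lborel (\<lambda>x. (cmod (l x))\<^sup>2)"
      by (rule L2_integrable[OF l_L2])
    show "AE x in lborel. (\<lambda>n. ?s n x) \<longlonglongrightarrow> 0"
      using AE_lborel_singleton[of k]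
    proof eventually_elim
      case (elim x)
      then have "0 < dist k x" by simp
      then obtain N where N: "inverse (real (Suc N)) < dist k x"
        using reals_Archimedean by blast
      have "?s n x = 0" if "N \<le> n" for n
      proof -
        have "1 / real (Suc n) \<le> inverse (real (Suc N))"
          using that by (simp add: field_simps)
        then show ?thesis using N by (simp add: indicator_def)
      qed
      then show ?case
        by (intro tendsto_eventually) (auto simp: eventually_sequentially)
    qed
    show "AE x in lborel. norm (?s n x) \<le> (cmod (l x))\<^sup>2" for n
      by (auto simp: indicator_def)
  qed (auto intro!: borel_measurable_times borel_measurable_indicator)
  moreover have "0 < \<eta>\<^sup>2" using assms by simp
  ultimately have "\<forall>\<^sub>F n in sequentially. (\<integral>x. ?s n x \<partial>lborel) < \<eta>\<^sup>2"
    using order_tendstoD(2) by fastforce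
  then obtain n where n: "(\<integral>x. ?s n x \<partial>lborel) < \<eta>\<^sup>2"
    using eventually_happens'[OF sequentially_bot] by blast
  have "norm_L2 (\<lambda>x. indicator (ball k r) x * l x) < \<eta>" if "r \<le> 1 / Suc n" for r
  proof -
    have "(norm_L2 (\<lambda>x. indicator (ball k r) x * l x))\<^sup>2 \<le> (\<integral>x. ?s n x \<partial>lborel)"
      unfolding norm_L2_sq
    proof (rule integral_mono_AE)
      have i: "integrable lborel (\<lambda>x. indicator A x * (cmod (l x))\<^sup>2)" if "A \<in> sets borel" for A
        using integrable_mult_indicator[OF _ L2_integrable[OF l_L2], of A] that by simp
      show "integrable lborel (?s n)" by (rule i) simp
      have "(cmod (indicator (ball k r) x * l x))\<^sup>2 = indicator (ball k r) x * (cmod (l x))\<^sup>2" for x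
        by (simp add: indicator_def)
      then show "integrable lborel (\<lambda>x. (cmod (indicator (ball k r) x * l x))\<^sup>2)"
        using i[of "ball k r"] by simp
      show "AE x in lborel. (cmod (indicator (ball k r) x * l x))\<^sup>2 \<le> ?s n x"
        using that by (auto simp: indicator_def)
    qed
    then have "(norm_L2 (\<lambda>x. indicator (ball k r) x * l x))\<^sup>2 < \<eta>\<^sup>2"
      using n by simp
    then show ?thesis
      using assms by (intro power2_less_imp_less[of _ \<eta>]) auto
  qed
  then show ?thesis
    by (intro exI[of _ "1 / real (Suc n)"]) auto
qed

text \<open>The normalised indicator of a small ball works: its pairing with l sees only the part of
  l on the ball, whose norm is small, and continuity of \<omega> controls the support.\<close>

lemma concentrated_unit_vector:
  assumes "0 < \<epsilon>" "0 < \<eta>"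
  shows "\<exists>a\<in>L2. norm_L2 a = 1 \<and> (\<forall>k. a k \<noteq> 0 \<longrightarrow> \<bar>\<omega> k - \<omega> k0\<bar> < \<epsilon>) \<and>
    cmod (\<integral>q. a q * l q \<partial>lborel) \<le> \<eta>"
proof -
  obtain d where d: "d > 0" "\<And>r. r \<le> d \<Longrightarrow> norm_L2 (\<lambda>x. indicator (ball k0 r) x * l x) < \<eta>"
    using norm_L2_indicator_ball_small[OF assms(2)] by blast
  obtain d' where d': "d' > 0" "\<And>k. dist k k0 < d' \<Longrightarrow> \<bar>\<omega> k - \<omega> k0\<bar> < \<epsilon>"
    using cont assms(1) unfolding continuous_on_iff dist_real_def by (metis UNIV_I)
  define r where "r = min d d'"
  define v where "v = measure lborel (ball k0 r)"
  have v: "v > 0"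
    using d d' content_ball_pos[of r k0] by (simp add: v_def r_def)
  define a where "a x = complex_of_real (indicator (ball k0 r) x / sqrt v)" for x
  have [measurable]: "ball k0 r \<in> sets borel"
    by simp
  have [measurable]: "a \<in> borel_measurable borel"
    unfolding a_def[abs_def] by measurable
  have sq: "(cmod (a x))\<^sup>2 = indicator (ball k0 r) x / v" for x
    using v by (simp add: a_def norm_divide power_divide indicator_def)
  have int: "integrable lborel (indicator (ball k0 r) :: 'a \<Rightarrow> real)"
    using emeasure_lborel_ball_finite[of k0 r] by simp
  have a: "a \<in> L2"
    by (rule L2I) (use int in \<open>simp_all add: sq\<close>)
  have "(norm_L2 a)\<^sup>2 = 1"
    using v by (simp add: norm_L2_sq sq v_def)
  then have a1: "norm_L2 a = 1"
    using norm_L2_nonneg[of a] by (simp add: power2_eq_1_iff)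
  have supp: "\<bar>\<omega> k - \<omega> k0\<bar> < \<epsilon>" if "a k \<noteq> 0" for k
    using that by (intro d') (auto simp: a_def r_def indicator_def dist_commute split: if_splits)
  have il: "(\<lambda>x. indicator (ball k0 r) x * l x) \<in> L2"
    by (rule L2_mult_bounded(1)[OF l_L2, of _ 1]) (auto simp: indicator_def)
  have "(\<integral>q. a q * l q \<partial>lborel) = (\<integral>q. a q * (indicator (ball k0 r) q * l q) \<partial>lborel)"
    by (intro Bochner_Integration.integral_cong refl) (simp add: a_def indicator_def)
  then have "cmod (\<integral>q. a q * l q \<partial>lborel) \<le> norm_L2 a * norm_L2 (\<lambda>x. indicator (ball k0 r) x * l x)"
    using Cauchy_Schwarz_L2[OF a il] by simp
  also have "\<dots> \<le> \<eta>"
    using a1 d(2)[of r] by (simp add: r_def)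
  finally show ?thesis
    using a a1 supp by blast
qed

text \<open>The infimum and the supremum need not be attained, so in general values can only be
  approximated. A gap around s would separate the range of \<omega>, which is connected.\<close>

lemma values_dense:
  assumes "w0 \<le> s" "s \<le> w1" "0 < \<epsilon>"
  shows "\<exists>k. \<bar>\<omega> k - s\<bar> < \<epsilon>"
proof (rule ccontr)
  assume *: "\<not> ?thesis"
  have "\<exists>k. \<omega> k < w0 + \<epsilon>"
    using cINF_less_iff[of UNIV \<omega> "w0 + \<epsilon>"] bdd assms(3) bounded_imp_bdd_below by (auto simp: inf_of_def)
  then obtain k1 where "\<omega> k1 < w0 + \<epsilon>" by blast
  then have k1: "\<omega> k1 \<le> s - \<epsilon>"
    using *[simplified, rule_format, of k1] assms(1) by linarith
  have "\<exists>k. w1 - \<epsilon> < \<omega> k"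
    using less_cSUP_iff[of UNIV \<omega> "w1 - \<epsilon>"] bdd assms(3) bounded_imp_bdd_above by (auto simp: sup_of_def)
  then obtain k2 where "w1 - \<epsilon> < \<omega> k2" by blast
  then have k2: "s + \<epsilon> \<le> \<omega> k2"
    using *[simplified, rule_format, of k2] assms(2) by linarith
  have "connected (range \<omega>)"
    using connected_continuous_image[OF cont] connected_UNIV by blast
  then have "s \<in> range \<omega>"
    using connectedD_interval[of "range \<omega>" "\<omega> k1" "\<omega> k2" s] k1 k2 assms(3) by auto
  then obtain k where "\<omega> k = s" by blast
  then show False
    using *[simplified, rule_format, of k] assms(3) by simp
qed

text \<open>The constant K collects the multiples of \<epsilon> that arise, so that test vectors can
  be built with \<epsilon> itself.\<close>

lemma in_spectrum_if_approximate_eigenvectors: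
  assumes "0 < c" "\<And>\<epsilon>. 0 < \<epsilon> \<Longrightarrow> \<exists>u\<in>space_H. c \<le> norm_H u \<and> norm_H (T u - z \<odot> u) \<le> K * \<epsilon>"
  shows "z \<in> spectrum T"
proof -
  have "\<not> Op.bounded_below z"
  proof
    assume "Op.bounded_below z"
    then obtain b where b: "b > 0" "\<And>u. u \<in> space_H \<Longrightarrow> b * norm_H u \<le> norm_H (T u - z \<odot> u)"
      unfolding Op.bounded_below_def shift_eq by blast
    define \<epsilon> where "\<epsilon> = b * c / (2 * (\<bar>K\<bar> + 1))"
    have \<epsilon>: "0 < \<epsilon>" using b(1) assms(1) by (simp add: \<epsilon>_def)
    obtain u where u: "u \<in> space_H" "c \<le> norm_H u" "norm_H (T u - z \<odot> u) \<le> K * \<epsilon>"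
      using assms(2)[OF \<epsilon>] by blast
    have "b * c \<le> b * norm_H u"
      using b u by (intro mult_left_mono) auto
    also have "\<dots> \<le> K * \<epsilon>"
      using b(2)[OF u(1)] u(3) by simp
    also have "\<dots> \<le> (\<bar>K\<bar> + 1) * \<epsilon>"
      using \<epsilon> by (intro mult_right_mono) auto
    also have "\<dots> = b * c / 2"
      by (simp add: \<epsilon>_def field_simps)
    finally show False
      using b(1) assms(1) by (simp add: mult_le_0_iff not_le)
  qed
  then show ?thesis
    by (simp add: spectrum_eq)
qed

lemma partial_pairing_tensor: "partial_pairing (tensor a b) l k = a k * (\<integral>q. b q * l q \<partial>lborel)"
  by (simp add: partial_pairing_def tensor_def mult.assoc)

text \<open>The test vector is the tensor square of a, with first component 0, where a is
  concentrated where \<omega> is close to half of \<open>z - \<gamma>\<close>. Then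
  \<open>D - z\<close> is small on the support, and \<open>op_B\<close> returns a multiplied by its
  small pairing with l.\<close>

lemma I_D_in_spectrum:
  assumes "2 * w0 + \<gamma> \<le> z" "z \<le> 2 * w1 + \<gamma>"
  shows "of_real z \<in> spectrum T"
proof (rule in_spectrum_if_approximate_eigenvectors)
  fix \<epsilon> :: real assume \<epsilon>: "0 < \<epsilon>"
  obtain k0 where k0: "\<bar>\<omega> k0 - (z - \<gamma>) / 2\<bar> < \<epsilon>"
    using values_dense[of "(z - \<gamma>) / 2" \<epsilon>] assms \<epsilon> by auto
  obtain a where a: "a \<in> L2" "norm_L2 a = 1" "\<And>k. a k \<noteq> 0 \<Longrightarrow> \<bar>\<omega> k - \<omega> k0\<bar> < \<epsilon>"
    "cmod (\<integral>q. a q * l q \<partial>lborel) \<le> \<epsilon>"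
    using concentrated_unit_vector[OF \<epsilon> \<epsilon>] by blast
  define u where "u = (0 :: 'a \<Rightarrow> complex, tensor a a)"
  note t = L2_tensor[OF a(1) a(1)]
  have u: "u \<in> space_H"
    using t by (simp add: space_H_iff u_def L2_zero tensor_def mult.commute)
  have "(norm_H u)\<^sup>2 = 1 / 2"
    using t a by (simp add: norm_H_sq u_def)
  \<comment> \<open>The weight of the inner product makes the norm \<open>1 / sqrt 2\<close>; the
    cruder lower bound 1/2 avoids the root.\<close>
  then have "(1 / 2)\<^sup>2 \<le> (norm_H u)\<^sup>2" by (simp add: power2_eq_square)
  then have 1: "1 / 2 \<le> norm_H u"
    by (rule power2_le_imp_le) (rule norm_H_nonneg)
  let ?v = "T u - of_real z \<odot> u" and ?c = "of_real \<alpha> * (\<integral>q. a q * l q \<partial>lborel)"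
  have "fst ?v = (\<lambda>k. ?c * a k)"
    by (auto simp: u_def op_matrix_simps op_A_def op_B_eq partial_pairing_tensor)
  then have "norm_L2 (fst ?v) = cmod ?c"
    using a by simp
  also have "\<dots> \<le> \<alpha> * \<epsilon>"
    using a(4) \<alpha>_pos by (simp add: norm_mult)
  finally have fst_le: "norm_L2 (fst ?v) \<le> \<alpha> * \<epsilon>" .
  have v: "?v \<in> space_H"
    using u by (intro H.diff_mem H.sc_mem T_mem)
  have snd: "snd ?v p = of_real (\<gamma> + \<omega> (fst p) + \<omega> (snd p) - z) * tensor a a p" for p
    by (simp add: u_def op_matrix_simps op_C_eq op_D_eq tensor_def algebra_simps)
  have snd_le: "norm_L2 (snd ?v) \<le> 4 * \<epsilon> * norm_L2 (tensor a a)"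
  proof (rule norm_L2_le[OF t(1)])
    have "cmod (snd ?v p) \<le> 4 * \<epsilon> * cmod (tensor a a p)" for p
    proof (cases "tensor a a p = 0")
      case False
      then have "\<bar>\<omega> (fst p) - \<omega> k0\<bar> < \<epsilon>" "\<bar>\<omega> (snd p) - \<omega> k0\<bar> < \<epsilon>"
        using a(3) by (auto simp: tensor_def)
      \<comment> \<open>Each of the two values of \<omega> is within 2 \<epsilon> of half of
        \<open>z - \<gamma>\<close>.\<close>
      then have "\<bar>\<gamma> + \<omega> (fst p) + \<omega> (snd p) - z\<bar> \<le> 4 * \<epsilon>"
        using k0 by (simp add: abs_less_iff abs_le_iff field_simps)
      then show ?thesis
        unfolding snd norm_mult norm_of_real by (intro mult_right_mono) auto
    next
      case True
      then have "snd ?v p = 0"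
        unfolding snd by simp
      then show ?thesis
        unfolding True by (simp only: norm_zero mult_zero_right order_refl)
    qed
    then show "AE p in lborel. cmod (snd ?v p) \<le> 4 * \<epsilon> * cmod (tensor a a p)"
      by blast
    show "snd ?v \<in> borel_measurable borel"
      using v unfolding space_H_iff by (blast intro: L2_measurable)
  qed (use \<epsilon> in simp)
  have "norm_H ?v \<le> (\<alpha> + 4) * \<epsilon>"
    using norm_H_le[of ?v] fst_le snd_le t a(2) by (simp add: algebra_simps)
  then show "\<exists>u\<in>space_H. 1 / 2 \<le> norm_H u \<and> norm_H (T u - of_real z \<odot> u) \<le> (\<alpha> + 4) * \<epsilon>"
    using u 1 by blast
qed simp

text \<open>
  For \<open>h = - \<alpha> * cnj l / (\<omega> + \<gamma> - e)\<close> and \<open>a\<close> concentrated where \<open>\<omega>\<close> is close to \<open>z - e\<close>,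
  the vector \<open>(a, a \<otimes> h + h \<otimes> a)\<close> is an approximate eigenvector.
\<close>

lemma shifted_zero_in_spectrum:
  assumes \<delta>: "0 < \<delta>" "\<And>q. \<delta> \<le> \<bar>\<omega> q + \<gamma> - e\<bar>" and zero: "Phi \<omega> l \<gamma> \<alpha> e = 0"
    and z: "w0 + e \<le> z" "z \<le> w1 + e"
  shows "of_real z \<in> spectrum T"
proof -
  have \<delta>': "\<delta> \<le> \<bar>\<gamma> + 0 + \<omega> q - e\<bar>" for q
    using \<delta>(2)[of q] by (simp add: algebra_simps)
  define h where "h q = - of_real \<alpha> * cnj (res e 0 q)" for q
  have h: "h \<in> L2"
    unfolding h_def[abs_def] by (intro L2_scale L2_cnj res_L2[OF \<delta>(1) \<delta>'])
  have nz: "\<omega> q + \<gamma> - e \<noteq> 0" for q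
    using \<delta>(1) \<delta>(2)[of q] by auto
  have h_eq: "h q * l q = of_real (- \<alpha> * ((cmod (l q))\<^sup>2 / (\<omega> q + \<gamma> - e)))" for q
    by (simp add: h_def res_def complex_norm_square mult.commute algebra_simps del: of_real_power)
  have "(\<integral>q. h q * l q \<partial>lborel) = of_real (\<integral>q. - \<alpha> * ((cmod (l q))\<^sup>2 / (\<omega> q + \<gamma> - e)) \<partial>lborel)"
    unfolding h_eq by (rule integral_complex_of_real)
  moreover have "\<alpha> * (\<integral>q. - \<alpha> * ((cmod (l q))\<^sup>2 / (\<omega> q + \<gamma> - e)) \<partial>lborel) = \<gamma> + e"
    using zero unfolding Phi_def Bochner_Integration.integral_mult_right_zero by (simp add: power2_eq_square)
  \<comment> \<open>This is \<open>\<Phi> e = 0\<close> in the form needed in the first row: the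
    coupling to h contributes \<open>\<gamma> + e\<close>, which turns
    \<open>- \<gamma> + \<omega> k - z\<close> into the small factor
    \<open>\<omega> k + e - z\<close>.\<close>
  ultimately have hl: "of_real \<alpha> * (\<integral>q. h q * l q \<partial>lborel) = of_real (\<gamma> + e)"
    by (simp only: of_real_mult[symmetric])
  \<comment> \<open>In the second row this cancels \<open>\<omega> q + \<gamma> - e\<close> from
    \<open>\<gamma> + \<omega> k + \<omega> q - z\<close> and again leaves
    \<open>\<omega> k + e - z\<close>; with the roles of k and q exchanged it does the same for the
    other tensor.\<close>
  have hC: "of_real \<alpha> * cnj (l q) = - of_real (\<omega> q + \<gamma> - e) * h q" for q
  proof -
    have "of_real (\<omega> q + \<gamma> - e) \<noteq> (0 :: complex)"
      using nz by (simp only: of_real_eq_0_iff not_False_eq_True)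
    moreover have "h q = - of_real \<alpha> * cnj (l q) / of_real (\<omega> q + \<gamma> - e)"
      by (simp add: h_def res_def algebra_simps)
    ultimately have "of_real (\<omega> q + \<gamma> - e) * h q = - of_real \<alpha> * cnj (l q)"
      by (simp only: nonzero_mult_div_cancel_left times_divide_eq_right not_False_eq_True)
    then show ?thesis
      by (simp only: mult_minus_left minus_minus)
  qed
  show ?thesis
  proof (rule in_spectrum_if_approximate_eigenvectors)
    fix \<epsilon> :: real assume \<epsilon>: "0 < \<epsilon>"
    obtain k0 where k0: "\<bar>\<omega> k0 - (z - e)\<bar> < \<epsilon>"
      using values_dense[of "z - e" \<epsilon>] z \<epsilon> by auto
    obtain a where a: "a \<in> L2" "norm_L2 a = 1" "\<And>k. a k \<noteq> 0 \<Longrightarrow> \<bar>\<omega> k - \<omega> k0\<bar> < \<epsilon>"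
      "cmod (\<integral>q. a q * l q \<partial>lborel) \<le> \<epsilon>"
      using concentrated_unit_vector[OF \<epsilon> \<epsilon>] by blast
    define u where "u = (a, tensor a h + tensor h a)"
    note t1 = L2_tensor[OF a(1) h] and t2 = L2_tensor[OF h a(1)]
    have u: "u \<in> space_H"
      using t1 t2 a by (simp add: space_H_iff u_def L2_add) (simp add: tensor_def mult.commute add.commute)
    have 1: "1 \<le> norm_H u"
      using norm_L2_fst_le[of u] a(2) by (simp add: u_def)
    let ?v = "T u - of_real z \<odot> u" and ?c = "of_real \<alpha> * (\<integral>q. a q * l q \<partial>lborel)"
    define b where "b k = of_real (\<omega> k + e - z) * a k" for k
    have [measurable]: "a \<in> borel_measurable borel"
      using a(1) by (rule L2_measurable)
    have b_m: "b \<in> borel_measurable borel"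
      unfolding b_def[abs_def] by measurable
    have b_le: "AE k in lborel. cmod (b k) \<le> 2 * \<epsilon> * cmod (a k)"
    proof (rule AE_I2)
      fix k show "cmod (b k) \<le> 2 * \<epsilon> * cmod (a k)"
      proof (cases "a k = 0")
        case False
        then have "\<bar>\<omega> k + e - z\<bar> \<le> 2 * \<epsilon>"
          using a(3)[of k] k0 by (simp add: abs_less_iff abs_le_iff)
        then show ?thesis
          unfolding b_def norm_mult norm_of_real by (intro mult_right_mono) auto
      qed (simp add: b_def)
    qed
    have b: "b \<in> L2"
      by (rule L2_dominated[OF a(1) b_m b_le])
    have nb: "norm_L2 b \<le> 2 * \<epsilon>"
      using norm_L2_le[OF a(1) b_m _ b_le] \<epsilon> a(2) by simp
    note s1 = L2_tensor[OF b h] and s2 = L2_tensor[OF h b]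
    have pp: "partial_pairing (snd u) l k = a k * (\<integral>q. h q * l q \<partial>lborel) + h k * (\<integral>q. a q * l q \<partial>lborel)" for k
    proof -
      have "partial_pairing (snd u) l k = (\<integral>q. a k * (h q * l q) + h k * (a q * l q) \<partial>lborel)"
        unfolding partial_pairing_def u_def
        by (intro Bochner_Integration.integral_cong refl) (simp add: tensor_def algebra_simps)
      then show ?thesis
        using L2_mult_integrable[OF h l_L2] L2_mult_integrable[OF a(1) l_L2] by simp
    qed
    have "fst ?v k = (b + (\<lambda>k. ?c * h k)) k" for k
    proof -
      have "fst ?v k = of_real (- \<gamma> + \<omega> k - z) * a k + (of_real \<alpha> * (\<integral>q. h q * l q \<partial>lborel)) * a k + ?c * h k"
        by (simp add: op_matrix_simps op_A_def op_B_eq pp) (simp add: u_def algebra_simps)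
      then show ?thesis
        unfolding hl by (simp add: b_def algebra_simps)
    qed
    then have "fst ?v = b + (\<lambda>k. ?c * h k)" by (rule ext)
    then have "norm_L2 (fst ?v) \<le> norm_L2 b + cmod ?c * norm_L2 h"
      using L2.nrm_triangle[OF b L2_scale[OF h, of ?c]] h by simp
    also have "\<dots> \<le> 2 * \<epsilon> + \<alpha> * \<epsilon> * norm_L2 h"
      using a(4) \<alpha>_pos nb by (intro add_mono mult_right_mono) (auto simp: norm_mult)
    finally have fst_le: "norm_L2 (fst ?v) \<le> 2 * \<epsilon> + \<alpha> * \<epsilon> * norm_L2 h" .
    have "snd ?v p = (tensor b h + tensor h b) p" for p
    proof -
      obtain k q where p: "p = (k, q)" by (cases p)
      have "snd ?v p = (of_real \<alpha> * cnj (l k)) * a q + (of_real \<alpha> * cnj (l q)) * a k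
          + of_real (\<gamma> + \<omega> k + \<omega> q - z) * (a k * h q + h k * a q)"
        by (simp add: p u_def op_matrix_simps op_C_eq op_D_eq tensor_def algebra_simps)
      also have "\<dots> = (tensor b h + tensor h b) p"
        unfolding hC by (simp add: p tensor_def b_def algebra_simps)
      finally show ?thesis .
    qed
    then have "snd ?v = tensor b h + tensor h b" by (rule ext)
    then have "norm_L2 (snd ?v) \<le> norm_L2 (tensor b h) + norm_L2 (tensor h b)"
      using L2.nrm_triangle[OF s1(1) s2(1)] by simp
    also have "\<dots> = 2 * norm_L2 b * norm_L2 h"
      by (simp add: s1 s2)
    also have "\<dots> \<le> 4 * \<epsilon> * norm_L2 h"
      using nb by (intro mult_right_mono) auto
    finally have "norm_H ?v \<le> (2 + \<alpha> * norm_L2 h + 4 * norm_L2 h) * \<epsilon>"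
      using norm_H_le[of ?v] fst_le by (simp add: algebra_simps)
    then show "\<exists>u\<in>space_H. 1 \<le> norm_H u \<and> norm_H (T u - of_real z \<odot> u) \<le> (2 + \<alpha> * norm_L2 h + 4 * norm_L2 h) * \<epsilon>"
      using u 1 by blast
  qed simp
qed

lemma interval_in_essential_spectrum:
  assumes "a < b" and sub: "\<And>x. a \<le> x \<Longrightarrow> x \<le> b \<Longrightarrow> of_real x \<in> spectrum T" and z: "a \<le> z" "z \<le> b"
  shows "of_real z \<in> essential_spectrum T"
proof -
  have "\<not> of_real z isolated_in spectrum T"
  proof
    assume "of_real z isolated_in spectrum T"
    then obtain e where e: "e > 0" "\<And>y. y \<in> spectrum T \<Longrightarrow> dist (of_real z) y < e \<Longrightarrow> y = of_real z"
      unfolding isolated_in_dist_Ex_iff by blast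
    have "\<exists>y. a \<le> y \<and> y \<le> b \<and> y \<noteq> z \<and> \<bar>z - y\<bar> < e"
    proof (cases "z < b")
      case True
      then show ?thesis
        using e(1) z by (intro exI[of _ "min b (z + e / 2)"]) (auto simp: min_def)
    next
      case False
      then show ?thesis
        using e(1) z assms(1) by (intro exI[of _ "max a (z - e / 2)"]) (auto simp: max_def)
    qed
    then obtain y where y: "a \<le> y" "y \<le> b" "y \<noteq> z" "\<bar>z - y\<bar> < e" by blast
    have "dist (of_real z) (of_real y :: complex) < e"
      using y(4) by (simp add: dist_norm flip: of_real_diff)
    then show False
      using e(2)[OF sub] y by auto
  qed
  then show ?thesis
    using sub z by (auto simp: essential_spectrum_def)
qed

end

section \<open>The function \<open>\<Phi>\<close> and its zeros\<close>

locale matrix_model_nontrivial = matrix_model +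
  assumes nonconstant: "\<not> \<omega> constant_on UNIV"
    and l_nonzero: "\<not> (AE q in lborel. l q = 0)"
begin

abbreviation \<Phi> :: "real \<Rightarrow> real" where "\<Phi> \<equiv> Phi \<omega> l \<gamma> \<alpha>"

lemma w0_less_w1: "w0 < w1"
proof (rule ccontr)
  assume "\<not> w0 < w1"
  then have "\<omega> k = w0" for k
    using w0_le[of k] le_w1[of k] by linarith
  then show False
    using nonconstant by (auto simp: constant_on_def)
qed

lemma integrable_Phi:
  assumes "z < w0 + \<gamma>"
  shows "integrable lborel (\<lambda>q. (cmod (l q))\<^sup>2 / (\<omega> q + \<gamma> - z))"
proof (rule Bochner_Integration.integrable_bound)
  show "integrable lborel (\<lambda>q. (cmod (l q))\<^sup>2 / (w0 + \<gamma> - z))"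
    using L2_integrable[OF l_L2] by simp
  have "norm ((cmod (l q))\<^sup>2 / (\<omega> q + \<gamma> - z)) \<le> norm ((cmod (l q))\<^sup>2 / (w0 + \<gamma> - z))" for q
    using assms w0_le[of q] by (simp add: frac_le)
  then show "AE q in lborel. norm ((cmod (l q))\<^sup>2 / (\<omega> q + \<gamma> - z)) \<le> norm ((cmod (l q))\<^sup>2 / (w0 + \<gamma> - z))"
    by simp
qed measurable

text \<open>Of the integral only weak monotonicity is used; strictness comes from the summand
  \<open>- z\<close>.\<close>

lemma Phi_strict_antimono:
  assumes "y < z" "z < w0 + \<gamma>"
  shows "\<Phi> z < \<Phi> y"
proof -
  have "(\<integral>q. (cmod (l q))\<^sup>2 / (\<omega> q + \<gamma> - y) \<partial>lborel) \<le> (\<integral>q. (cmod (l q))\<^sup>2 / (\<omega> q + \<gamma> - z) \<partial>lborel)"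
  proof (rule integral_mono)
    fix q show "(cmod (l q))\<^sup>2 / (\<omega> q + \<gamma> - y) \<le> (cmod (l q))\<^sup>2 / (\<omega> q + \<gamma> - z)"
      using assms w0_le[of q] by (intro divide_left_mono) auto
  qed (use assms in \<open>auto intro: integrable_Phi\<close>)
  from mult_left_mono[OF this, of "\<alpha>\<^sup>2"] show ?thesis
    using assms unfolding Phi_def by simp
qed

lemma Phi_antimono: "y \<le> z \<Longrightarrow> z < w0 + \<gamma> \<Longrightarrow> \<Phi> z \<le> \<Phi> y"
  using Phi_strict_antimono[of y z] by (cases "y = z") auto

text \<open>The integral is the pairing of \<open>lc\<close> with \<open>res 0 (- z)\<close>, so the
  Lipschitz bound for \<open>res\<close> applies at a fixed distance from the singularity.\<close>

lemma continuous_Phi: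
  assumes "b < w0 + \<gamma>"
  shows "continuous_on {..b} \<Phi>"
proof -
  define \<delta> where "\<delta> = w0 + \<gamma> - b"
  have \<delta>: "0 < \<delta>" using assms by (simp add: \<delta>_def)
  have ge: "\<delta> \<le> \<bar>\<gamma> + - z + \<omega> q - 0\<bar>" if "z \<le> b" for z q
    using that w0_le[of q] by (simp add: \<delta>_def)
  define J where "J z = (\<integral>q. lc q * res 0 (- z) q \<partial>lborel)" for z
  have J: "J z = of_real (\<integral>q. (cmod (l q))\<^sup>2 / (\<omega> q + \<gamma> - z) \<partial>lborel)" for z
  proof -
    have "J z = (\<integral>q. of_real ((cmod (l q))\<^sup>2 / (\<omega> q + \<gamma> - z)) \<partial>lborel)"
      unfolding J_def by (intro Bochner_Integration.integral_cong refl)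
        (simp add: res_def complex_norm_square mult.commute algebra_simps del: of_real_power)
    then show ?thesis by (simp only: integral_complex_of_real)
  qed
  have "((norm_L2 l)\<^sup>2 / \<delta>\<^sup>2)-lipschitz_on {..b} J"
  proof (rule lipschitz_onI)
    fix y z assume "y \<in> {..b}" "z \<in> {..b}"
    then have yz: "\<And>q. \<delta> \<le> \<bar>\<gamma> + - y + \<omega> q - 0\<bar>" "\<And>q. \<delta> \<le> \<bar>\<gamma> + - z + \<omega> q - 0\<bar>"
      using ge by auto
    note r = res_L2[OF \<delta> yz(1)] res_L2[OF \<delta> yz(2)]
    have "J y - J z = (\<integral>q. lc q * (res 0 (- y) - res 0 (- z)) q \<partial>lborel)"
      unfolding J_def using L2_mult_integrable[OF lc_L2 r(1)] L2_mult_integrable[OF lc_L2 r(2)]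
      by (simp add: right_diff_distrib)
    then have "cmod (J y - J z) \<le> norm_L2 lc * norm_L2 (res 0 (- y) - res 0 (- z))"
      using Cauchy_Schwarz_L2[OF lc_L2 L2.diff_mem[OF r]] by simp
    also have "\<dots> \<le> norm_L2 l * (\<bar>- y - - z\<bar> / \<delta>\<^sup>2 * norm_L2 l)"
      using norm_res_diff_le[OF \<delta> yz] unfolding norm_L2_cnj by (intro mult_left_mono norm_L2_nonneg)
    finally show "dist (J y) (J z) \<le> (norm_L2 l)\<^sup>2 / \<delta>\<^sup>2 * dist y z"
      by (simp add: dist_norm power2_eq_square abs_minus_commute algebra_simps)
  qed simp
  then have "continuous_on {..b} (\<lambda>z. - \<gamma> - z - \<alpha>\<^sup>2 * Re (J z))"
    by (intro continuous_intros lipschitz_on_continuous_on)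
  moreover have "\<Phi> z = - \<gamma> - z - \<alpha>\<^sup>2 * Re (J z)" for z
    unfolding J Re_complex_of_real Phi_def by simp
  ultimately show ?thesis by simp
qed

text \<open>Existence is kept apart from \<open>E\<close>, whose \<open>THE\<close> carries no
  information without a zero.\<close>

definition has_E :: bool where
  "has_E \<longleftrightarrow> (\<exists>z<w0 + \<gamma>. \<Phi> z = 0)"

abbreviation E :: real where "E \<equiv> zero_E \<omega> l \<gamma> \<alpha>"

text \<open>Supplies the left end point for the intermediate value theorem: at distance at least 1
  from the singularity the integral is at most the square of \<open>norm_L2 l\<close>.\<close>

lemma Phi_far_nonneg:
  assumes "z \<le> w0 + \<gamma> - 1" "z \<le> - \<gamma> - \<alpha>\<^sup>2 * (norm_L2 l)\<^sup>2"
  shows "0 \<le> \<Phi> z"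
proof -
  have "(\<integral>q. (cmod (l q))\<^sup>2 / (\<omega> q + \<gamma> - z) \<partial>lborel) \<le> (norm_L2 l)\<^sup>2"
    unfolding norm_L2_sq
  proof (rule integral_mono)
    fix q
    have "1 \<le> \<omega> q + \<gamma> - z"
      using assms w0_le[of q] by simp
    then show "(cmod (l q))\<^sup>2 / (\<omega> q + \<gamma> - z) \<le> (cmod (l q))\<^sup>2"
      using frac_le[of "(cmod (l q))\<^sup>2" "(cmod (l q))\<^sup>2" 1 "\<omega> q + \<gamma> - z"] by simp
  qed (use assms l_L2 in \<open>auto intro: integrable_Phi L2_integrable\<close>)
  from mult_left_mono[OF this, of "\<alpha>\<^sup>2"] show ?thesis
    using assms unfolding Phi_def by simp
qed

lemma has_E_if_Phi_nonpos:
  assumes "b < w0 + \<gamma>" "\<Phi> b \<le> 0"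
  shows "has_E"
proof -
  define a where "a = min b (min (w0 + \<gamma> - 1) (- \<gamma> - \<alpha>\<^sup>2 * (norm_L2 l)\<^sup>2))"
  have a: "a \<le> b" "0 \<le> \<Phi> a"
    by (auto simp: a_def intro!: Phi_far_nonneg)
  have "\<exists>x\<ge>a. x \<le> b \<and> \<Phi> x = 0"
    by (rule IVT2') (use a assms continuous_Phi[OF assms(1)] in \<open>auto intro: continuous_on_subset\<close>)
  then show ?thesis
    using assms(1) le_less_trans unfolding has_E_def by blast
qed

lemma zero_E_eq:
  assumes "z < w0 + \<gamma>" "\<Phi> z = 0"
  shows "E = z"
  unfolding zero_E_def
proof (rule the_equality)
  fix y assume "y < w0 + \<gamma> \<and> \<Phi> y = 0"
  then show "y = z"
    using Phi_strict_antimono[of y z] Phi_strict_antimono[of z y] assms by (cases y z rule: linorder_cases) auto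
qed (use assms in simp)

lemma zero_E:
  assumes has_E
  shows "E < w0 + \<gamma>" "\<Phi> E = 0"
  using assms zero_E_eq unfolding has_E_def by auto

lemma Phi_pos_if_not_has_E: "\<not> has_E \<Longrightarrow> z < w0 + \<gamma> \<Longrightarrow> 0 < \<Phi> z"
  using has_E_if_Phi_nonpos by force

text \<open>The argument \<open>z - \<omega> k\<close> stays between \<open>z - w1\<close> and
  \<open>z - w0\<close>, left of \<open>w0 + \<gamma>\<close>, where \<Phi> decreases. It is
  therefore enough that \<Phi> is positive at the right end or negative at the left end.\<close>

lemma Phi_bounded_away_left:
  assumes "z < 2 * w0 + \<gamma>" "has_E \<Longrightarrow> z < w0 + E \<or> w1 + E < z"
  shows "\<exists>c>0. \<forall>k. c \<le> \<bar>\<Phi> (z - \<omega> k)\<bar>"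
proof -
  have lt: "z - \<omega> k < w0 + \<gamma>" for k
    using assms(1) w0_le[of k] by simp
  have lt': "z - w0 < w0 + \<gamma>" using assms(1) by simp
  have above: "\<Phi> (z - w0) \<le> \<Phi> (z - \<omega> k)" for k
    by (rule Phi_antimono) (use w0_le[of k] lt' in auto)
  have below: "\<Phi> (z - \<omega> k) \<le> \<Phi> (z - w1)" for k
    by (rule Phi_antimono) (use le_w1[of k] lt in auto)
  consider "0 < \<Phi> (z - w0)" | "\<Phi> (z - w1) < 0"
  proof (cases has_E)
    case True
    note E = zero_E[OF True]
    from assms(2)[OF True] show ?thesis
    proof
      assume "z < w0 + E"
      then show ?thesis
        using Phi_strict_antimono[of "z - w0" E] E that by simp
    next
      assume "w1 + E < z"
      then show ?thesis
        using Phi_strict_antimono[of E "z - w1"] E that lt' w0_less_w1 by simp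
    qed
  next
    case False
    then show ?thesis
      using Phi_pos_if_not_has_E lt' that by blast
  qed
  then show ?thesis
  proof cases
    case 1
    then show ?thesis
      using above by (intro exI[of _ "\<Phi> (z - w0)"]) (auto intro: order_trans[OF _ abs_ge_self])
  next
    case 2
    then show ?thesis
      using below by (intro exI[of _ "- \<Phi> (z - w1)"]) (auto intro: order_trans[OF _ abs_ge_minus_self])
  qed
qed

section \<open>Existence of the zeros and the critical couplings\<close>

abbreviation N0 :: real where "N0 \<equiv> norm_L2 (quot_sqrt l (\<lambda>q. \<omega> q - w0))"

lemma measurable_quot_sqrt: "quot_sqrt l (\<lambda>q. \<omega> q - w0) \<in> borel_measurable borel"
  unfolding quot_sqrt_def by measurable

lemma norm_quot_sqrt: "0 \<le> w q \<Longrightarrow> (cmod (quot_sqrt l w q))\<^sup>2 = (cmod (l q))\<^sup>2 / w q"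
  by (simp add: quot_sqrt_def norm_divide power_divide)

text \<open>At a zero E the denominator exceeds \<open>\<omega> q - w0\<close>, so the integral is
  at most the square of N0. As \<open>E < w0 + \<gamma>\<close>, the value \<open>\<Phi> E\<close>
  would be larger than \<open>- 2 * \<gamma> - w0 - \<alpha>\<^sup>2 * N0\<^sup>2\<close>, which is
  nonnegative.\<close>

lemma not_has_E_if:
  assumes R0: "cond_R0 \<omega> l" and le: "\<alpha>\<^sup>2 * N0\<^sup>2 \<le> - 2 * \<gamma> - w0"
  shows "\<not> has_E"
proof
  assume has_E
  note E = zero_E[OF this]
  have ae: "AE q in lborel. \<omega> q - w0 = 0 \<longrightarrow> l q = 0" and L2: "quot_sqrt l (\<lambda>q. \<omega> q - w0) \<in> L2"
    using R0 by (auto simp: cond_R0_def quot_sqrt_in_L2_def)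
  have "(\<integral>q. (cmod (l q))\<^sup>2 / (\<omega> q + \<gamma> - E) \<partial>lborel) \<le> N0\<^sup>2"
    unfolding norm_L2_sq
  proof (rule integral_mono_AE)
    show "AE q in lborel. (cmod (l q))\<^sup>2 / (\<omega> q + \<gamma> - E) \<le> (cmod (quot_sqrt l (\<lambda>q. \<omega> q - w0) q))\<^sup>2"
      using ae
    proof eventually_elim
      case (elim q)
      show ?case
      \<comment> \<open>Where \<open>\<omega> q = w0\<close> the quotient has the default value 0,
        so the comparison rests on \<open>l q = 0\<close> there.\<close>
      proof (cases "\<omega> q = w0")
        case True
        then show ?thesis using elim by simp
      next
        case False
        then have "0 < \<omega> q - w0" using w0_le[of q] by simp
        then show ?thesis
          using E(1) by (subst norm_quot_sqrt) (auto intro!: divide_left_mono)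
      qed
    qed
  qed (use E L2 in \<open>auto intro: integrable_Phi L2_integrable\<close>)
  from mult_left_mono[OF this, of "\<alpha>\<^sup>2"] show False
    using E le unfolding Phi_def by simp
qed

text \<open>Without a zero, \<open>\<Phi>\<close> stays positive up to \<open>w0 + \<gamma>\<close>, and Fatou's lemma applies there.\<close>

lemma not_has_E_imp:
  assumes "\<not> has_E"
  shows "cond_R0 \<omega> l" "\<alpha>\<^sup>2 * N0\<^sup>2 \<le> - 2 * \<gamma> - w0"
proof -
  let ?Q = "quot_sqrt l (\<lambda>q. \<omega> q - w0)"
  \<comment> \<open>The distance to \<open>w0 + \<gamma>\<close>. Positivity of \<Phi> at
    \<open>w0 + \<gamma> - t n\<close> is a bound for the integral of \<open>G n\<close>.\<close>
  define t where "t n = inverse (real (Suc n))" for n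
  have t: "0 < t n" for n by (simp add: t_def)
  have t0: "t \<longlonglongrightarrow> 0"
    unfolding t_def[abs_def] by (rule LIMSEQ_inverse_real_of_nat)
  define G where "G n q = (cmod (l q))\<^sup>2 / (\<omega> q - w0 + t n)" for n q
  have G_m [measurable]: "G n \<in> borel_measurable borel" for n
    unfolding G_def[abs_def] by measurable
  have G_nonneg: "0 \<le> G n q" for n q
    using t[of n] w0_le[of q] by (simp add: G_def)
  have G_int: "integrable lborel (G n)" for n
    using integrable_Phi[of "w0 + \<gamma> - t n"] t[of n] by (simp add: G_def[abs_def] algebra_simps)
  have G_le: "(\<integral>q. G n q \<partial>lborel) \<le> (- 2 * \<gamma> - w0 + t n) / \<alpha>\<^sup>2" for n
  proof -
    have "0 < \<Phi> (w0 + \<gamma> - t n)"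
      using Phi_pos_if_not_has_E[OF assms] t by simp
    then show ?thesis
      using \<alpha>_pos by (simp add: Phi_def G_def field_simps)
  qed
  have lim: "(\<lambda>n. (- 2 * \<gamma> - w0 + t n) / \<alpha>\<^sup>2) \<longlonglongrightarrow> (- 2 * \<gamma> - w0 + 0) / \<alpha>\<^sup>2"
    using \<alpha>_pos by (intro tendsto_intros t0) auto
  define b where "b = (- 2 * \<gamma> - w0) / \<alpha>\<^sup>2"
  have "0 \<le> (- 2 * \<gamma> - w0 + t n) / \<alpha>\<^sup>2" for n
    using G_le[of n] G_nonneg integral_nonneg_AE[of "G n" lborel] by fastforce
  from LIMSEQ_le_const[OF lim, of 0] this have b: "0 \<le> b"
    by (auto simp: b_def)
  have Fatou: "(\<integral>\<^sup>+q. liminf (\<lambda>n. ennreal (G n q)) \<partial>lborel) \<le> ennreal b"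
  proof -
    have "(\<integral>\<^sup>+q. liminf (\<lambda>n. ennreal (G n q)) \<partial>lborel) \<le> liminf (\<lambda>n. \<integral>\<^sup>+q. ennreal (G n q) \<partial>lborel)"
      by (rule nn_integral_liminf) measurable
    also have "\<dots> \<le> liminf (\<lambda>n. ennreal ((- 2 * \<gamma> - w0 + t n) / \<alpha>\<^sup>2))"
    proof (rule Liminf_mono, rule always_eventually, rule allI)
      fix n
      have "(\<integral>\<^sup>+q. ennreal (G n q) \<partial>lborel) = ennreal (\<integral>q. G n q \<partial>lborel)"
        by (rule nn_integral_eq_integral[OF G_int]) (use G_nonneg in simp)
      then show "(\<integral>\<^sup>+q. ennreal (G n q) \<partial>lborel) \<le> ennreal ((- 2 * \<gamma> - w0 + t n) / \<alpha>\<^sup>2)"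
        using G_le[of n] by (simp only: ennreal_leI)
    qed
    also have "\<dots> = ennreal b"
      using lim_imp_Liminf[OF sequentially_bot tendsto_ennrealI[OF lim]] by (simp add: b_def)
    finally show ?thesis .
  qed
  have liminf_pos: "liminf (\<lambda>n. ennreal (G n q)) = ennreal ((cmod (?Q q))\<^sup>2)" if "\<omega> q \<noteq> w0" for q
  proof -
    have pos: "0 < \<omega> q - w0" using that w0_le[of q] by simp
    have "(\<lambda>n. G n q) \<longlonglongrightarrow> (cmod (l q))\<^sup>2 / (\<omega> q - w0 + 0)"
      unfolding G_def using pos by (intro tendsto_intros t0) auto
    from lim_imp_Liminf[OF sequentially_bot tendsto_ennrealI[OF this]] show ?thesis
      using pos by (simp add: norm_quot_sqrt)
  qed
  \<comment> \<open>On the set where \<omega> equals w0 the integrands blow up unless l vanishes, so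
    finiteness of the Fatou bound gives the first half of \<open>cond_R0\<close>.\<close>
  have liminf_zero: "liminf (\<lambda>n. ennreal (G n q)) = \<infinity>" if "\<omega> q = w0" "l q \<noteq> 0" for q
  proof -
    have "G n q = (cmod (l q))\<^sup>2 * real (Suc n)" for n
      using that by (simp add: G_def t_def divide_inverse)
    moreover have "filterlim (\<lambda>n. (cmod (l q))\<^sup>2 * real (Suc n)) at_top sequentially"
      using that filterlim_tendsto_pos_mult_at_top[OF tendsto_const _ filterlim_compose[OF filterlim_real_sequentially filterlim_Suc], of "(cmod (l q))\<^sup>2"]
      by simp
    ultimately have "(\<lambda>n. ennreal (G n q)) \<longlonglongrightarrow> \<infinity>"
      by (simp add: ennreal_tendsto_top_eq_at_top[symmetric])
    from lim_imp_Liminf[OF sequentially_bot this] show ?thesis .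
  qed
  have m: "(\<lambda>q. liminf (\<lambda>n. ennreal (G n q))) \<in> borel_measurable lborel"
    by measurable
  have "(\<integral>\<^sup>+q. liminf (\<lambda>n. ennreal (G n q)) \<partial>lborel) \<noteq> \<infinity>"
    using Fatou by (auto simp: top_unique)
  from nn_integral_noteq_infinite[OF m this]
  have ae: "AE q in lborel. \<omega> q - w0 = 0 \<longrightarrow> l q = 0"
    by eventually_elim (use liminf_zero in auto)
  have "(\<integral>\<^sup>+q. ennreal ((cmod (?Q q))\<^sup>2) \<partial>lborel) \<le> (\<integral>\<^sup>+q. liminf (\<lambda>n. ennreal (G n q)) \<partial>lborel)"
  proof (rule nn_integral_mono)
    fix q show "ennreal ((cmod (?Q q))\<^sup>2) \<le> liminf (\<lambda>n. ennreal (G n q))"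
      using liminf_pos[of q] by (cases "\<omega> q = w0") (auto simp: quot_sqrt_def)
  qed
  also have "\<dots> \<le> ennreal ((sqrt b)\<^sup>2)"
    using Fatou b by simp
  finally have Q: "?Q \<in> L2" "N0 \<le> sqrt b"
    using L2_if_nn_integral_le[OF measurable_quot_sqrt, of "sqrt b"] b by auto
  show "cond_R0 \<omega> l"
    using ae Q by (simp add: cond_R0_def quot_sqrt_in_L2_def)
  have "N0\<^sup>2 \<le> (sqrt b)\<^sup>2"
    using Q by (intro power_mono) auto
  then show "\<alpha>\<^sup>2 * N0\<^sup>2 \<le> - 2 * \<gamma> - w0"
    using b \<alpha>_pos by (simp add: b_def field_simps)
qed

text \<open>The real \<open>sqrt\<close> is odd, so for negative x both sides are false. This allows
  thresholds with negative radicands to be handled uniformly.\<close>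

lemma le_quotient_sqrt_iff:
  assumes "0 < n"
  shows "\<alpha> \<le> sqrt x / n \<longleftrightarrow> \<alpha>\<^sup>2 * n\<^sup>2 \<le> x"
proof -
  have "\<alpha> \<le> sqrt x / n \<longleftrightarrow> \<alpha> * n \<le> sqrt x"
    using assms by (simp add: field_simps)
  also have "\<dots> \<longleftrightarrow> (\<alpha> * n)\<^sup>2 \<le> x"
    using real_sqrt_le_iff[of "(\<alpha> * n)\<^sup>2" x] assms \<alpha>_pos by (simp del: real_sqrt_le_iff)
  finally show ?thesis
    by (simp add: power_mult_distrib)
qed

lemma not_has_E_iff: "\<not> has_E \<longleftrightarrow> cond_R0 \<omega> l \<and> \<alpha> \<le> alpha1 \<omega> l \<gamma>"
proof (cases "cond_R0 \<omega> l")
  case True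
  then have L2: "quot_sqrt l (\<lambda>q. \<omega> q - w0) \<in> L2" and ae: "AE q in lborel. \<omega> q - w0 = 0 \<longrightarrow> l q = 0"
    by (auto simp: cond_R0_def quot_sqrt_in_L2_def)
  have "N0 \<noteq> 0"
  proof
    assume "N0 = 0"
    then have "AE q in lborel. quot_sqrt l (\<lambda>q. \<omega> q - w0) q = 0"
      using norm_L2_eq_0_iff[OF L2] by simp
    then have "AE q in lborel. l q = 0"
      using ae by eventually_elim (auto simp: quot_sqrt_def)
    then show False using l_nonzero by simp
  qed
  then have "0 < N0"
    using norm_L2_nonneg less_le by metis
  from le_quotient_sqrt_iff[OF this] show ?thesis
    using True not_has_E_if not_has_E_imp unfolding alpha1_def by blast
qed (use not_has_E_imp in blast)

text \<open>At \<open>z = 2 * w0 + \<gamma> - w1\<close> the denominator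
  \<open>\<omega> q + \<gamma> - z\<close> is the weight under the root in \<open>alpha2\<close>,
  and \<open>- \<gamma> - z\<close> is its radicand.\<close>

lemma le_alpha2_iff: "\<alpha> \<le> alpha2 \<omega> l \<gamma> \<longleftrightarrow> 0 \<le> \<Phi> (2 * w0 + \<gamma> - w1)"
proof -
  let ?w = "\<lambda>q. w1 - 2 * w0 + \<omega> q"
  have pos: "0 < w1 - w0" using w0_less_w1 by simp
  have ge: "w1 - w0 \<le> ?w q" for q
    using w0_le[of q] by simp
  have sq: "(cmod (quot_sqrt l ?w q))\<^sup>2 = (cmod (l q))\<^sup>2 / (\<omega> q + \<gamma> - (2 * w0 + \<gamma> - w1))" for q
    using norm_quot_sqrt[of ?w q] ge[of q] pos by (simp add: algebra_simps)
  have m: "quot_sqrt l ?w \<in> borel_measurable borel"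
    unfolding quot_sqrt_def by measurable
  have L2: "quot_sqrt l ?w \<in> L2"
    by (rule L2I[OF m]) (use integrable_Phi[of "2 * w0 + \<gamma> - w1"] w0_less_w1 in \<open>simp add: sq\<close>)
  have "norm_L2 (quot_sqrt l ?w) \<noteq> 0"
  proof
    assume "norm_L2 (quot_sqrt l ?w) = 0"
    then have "AE q in lborel. quot_sqrt l ?w q = 0"
      using norm_L2_eq_0_iff[OF L2] by simp
    then have "AE q in lborel. l q = 0"
    proof eventually_elim
      case (elim q)
      then show ?case
        using ge[of q] pos by (auto simp: quot_sqrt_def)
    qed
    then show False using l_nonzero by simp
  qed
  then have "0 < norm_L2 (quot_sqrt l ?w)"
    using norm_L2_nonneg less_le by metis
  from le_quotient_sqrt_iff[OF this, of "w1 - 2 * w0 - 2 * \<gamma>"] show ?thesis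
    unfolding alpha2_def norm_L2_sq[of "quot_sqrt l ?w"] sq Phi_def by (auto simp: algebra_simps)
qed

text \<open>Takes the place of comparing \<open>alpha1\<close> with \<open>alpha2\<close>: above
  \<open>alpha2\<close> the function \<Phi> is already negative at a point left of
  \<open>w0 + \<gamma>\<close>.\<close>

lemma has_E_if_gt_alpha2: "alpha2 \<omega> l \<gamma> < \<alpha> \<Longrightarrow> has_E"
  using has_E_if_Phi_nonpos[of "2 * w0 + \<gamma> - w1"] le_alpha2_iff w0_less_w1 by simp

lemma le_alpha2_iff_E:
  assumes has_E
  shows "\<alpha> \<le> alpha2 \<omega> l \<gamma> \<longleftrightarrow> 2 * w0 + \<gamma> \<le> w1 + E"
proof -
  note E = zero_E[OF assms]
  show ?thesis
    using Phi_antimono[of "2 * w0 + \<gamma> - w1" E] Phi_strict_antimono[of E "2 * w0 + \<gamma> - w1"] E w0_less_w1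
    unfolding le_alpha2_iff by fastforce
qed

lemma I_E_in_essential_spectrum:
  assumes has_E "w0 + E \<le> z" "z \<le> w1 + E"
  shows "of_real z \<in> essential_spectrum T"
proof (rule interval_in_essential_spectrum[of "w0 + E" "w1 + E"])
  note E = zero_E[OF assms(1)]
  have *: "w0 + \<gamma> - E \<le> \<bar>\<omega> q + \<gamma> - E\<bar>" for q
    using w0_le[of q] by linarith
  fix x assume "w0 + E \<le> x" "x \<le> w1 + E"
  then show "of_real x \<in> spectrum T"
    using shifted_zero_in_spectrum[OF _ * E(2)] E(1) by simp
qed (use assms w0_less_w1 in auto)

lemma I_D_in_essential_spectrum:
  assumes "2 * w0 + \<gamma> \<le> z" "z \<le> 2 * w1 + \<gamma>"
  shows "of_real z \<in> essential_spectrum T"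
  by (rule interval_in_essential_spectrum[of "2 * w0 + \<gamma>" "2 * w1 + \<gamma>"])
    (use assms w0_less_w1 I_D_in_spectrum in auto)

lemma inf_of_uminus: "inf_of (\<lambda>x. - \<omega> x) = - w1"
  unfolding inf_of_def sup_of_def Inf_real_def by (simp add: image_image)

lemma sup_of_uminus: "sup_of (\<lambda>x. - \<omega> x) = - w0"
  unfolding inf_of_def sup_of_def Inf_real_def by (simp add: image_image)

text \<open>The right half line is reduced to the left one by changing the signs of \<open>\<omega>\<close>, \<open>\<gamma>\<close> and \<open>z\<close>.\<close>

lemma Phi_uminus: "Phi (\<lambda>x. - \<omega> x) l (- \<gamma>) \<alpha> z = - \<Phi> (- z)"
proof -
  have "(\<integral>q. (cmod (l q))\<^sup>2 / (- \<omega> q + - \<gamma> - z) \<partial>lborel) = (\<integral>q. - ((cmod (l q))\<^sup>2 / (\<omega> q + \<gamma> - - z)) \<partial>lborel)"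
  proof (intro Bochner_Integration.integral_cong refl)
    fix q
    have "- \<omega> q + - \<gamma> - z = - (\<omega> q + \<gamma> - - z)" by simp
    then show "(cmod (l q))\<^sup>2 / (- \<omega> q + - \<gamma> - z) = - ((cmod (l q))\<^sup>2 / (\<omega> q + \<gamma> - - z))"
      by (simp only: divide_minus_right)
  qed
  then show ?thesis
    by (simp add: Phi_def)
qed

text \<open>Only \<Phi>, its zeros and the thresholds are transported by the reflection, not the
  operator matrix. The locale predicate does not mention \<gamma>; the value
  \<open>- \<gamma>\<close> is supplied at each interpretation.\<close>

lemma reflected: "matrix_model_nontrivial (\<lambda>x. - \<omega> x) l \<alpha>"
proof
  show "continuous_on UNIV (\<lambda>x. - \<omega> x)"
    using cont by (intro continuous_intros)
  show "bounded (range (\<lambda>x. - \<omega> x))"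
    using bdd by (simp add: bounded_iff image_iff)
  show "\<not> (\<lambda>x. - \<omega> x) constant_on UNIV"
    using nonconstant unfolding constant_on_def by (metis minus_equation_iff)
qed (use l_L2 \<alpha>_pos l_nonzero in auto)

definition has_F :: bool where
  "has_F \<longleftrightarrow> (\<exists>z>w1 + \<gamma>. \<Phi> z = 0)"

abbreviation F :: real where "F \<equiv> zero_F \<omega> l \<gamma> \<alpha>"

lemma has_E_reflected: "matrix_model_nontrivial.has_E (\<lambda>x. - \<omega> x) l (- \<gamma>) \<alpha> \<longleftrightarrow> has_F"
proof -
  interpret r: matrix_model_nontrivial "\<lambda>x. - \<omega> x" l "- \<gamma>" \<alpha>
    by (rule reflected)
  have "(\<exists>z. z < - w1 + - \<gamma> \<and> P (- z)) \<longleftrightarrow> (\<exists>z>w1 + \<gamma>. P z)" for P :: "real \<Rightarrow> bool"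
  proof
    assume "\<exists>z. z < - w1 + - \<gamma> \<and> P (- z)"
    then obtain z where "z < - w1 + - \<gamma>" "P (- z)" by blast
    then show "\<exists>z>w1 + \<gamma>. P z" by (intro exI[of _ "- z"]) auto
  next
    assume "\<exists>z>w1 + \<gamma>. P z"
    then obtain z where "w1 + \<gamma> < z" "P z" by blast
    then show "\<exists>z. z < - w1 + - \<gamma> \<and> P (- z)" by (intro exI[of _ "- z"]) auto
  qed
  from this[of "\<lambda>z. \<Phi> z = 0"] show ?thesis
    by (simp add: has_F_def r.has_E_def Phi_uminus inf_of_uminus)
qed

lemma zero_E_reflected:
  assumes has_F
  shows "zero_E (\<lambda>x. - \<omega> x) l (- \<gamma>) \<alpha> = - F"
proof -
  interpret r: matrix_model_nontrivial "\<lambda>x. - \<omega> x" l "- \<gamma>" \<alpha>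
    by (rule reflected)
  have E: "r.E < - w1 + - \<gamma>" "\<Phi> (- r.E) = 0"
    using r.zero_E[unfolded has_E_reflected, OF assms] by (simp_all add: Phi_uminus inf_of_uminus)
  have "F = - r.E"
    unfolding zero_F_def
  proof (rule the_equality)
    fix y assume "w1 + \<gamma> < y \<and> \<Phi> y = 0"
    then have "r.E = - y"
      by (intro r.zero_E_eq) (simp_all add: Phi_uminus inf_of_uminus)
    then show "y = - r.E" by simp
  qed (use E in auto)
  then show ?thesis by simp
qed

lemma zero_F:
  assumes has_F
  shows "w1 + \<gamma> < F" "\<Phi> F = 0"
proof -
  interpret r: matrix_model_nontrivial "\<lambda>x. - \<omega> x" l "- \<gamma>" \<alpha>
    by (rule reflected)
  show "w1 + \<gamma> < F" "\<Phi> F = 0"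
    using r.zero_E[unfolded has_E_reflected, OF assms] zero_E_reflected[OF assms]
    by (simp_all add: Phi_uminus inf_of_uminus)
qed

lemma not_has_F_iff: "\<not> has_F \<longleftrightarrow> cond_R1 \<omega> l \<and> \<alpha> \<le> alpha3 \<omega> l \<gamma>"
proof -
  interpret r: matrix_model_nontrivial "\<lambda>x. - \<omega> x" l "- \<gamma>" \<alpha>
    by (rule reflected)
  show ?thesis
    using r.not_has_E_iff
    by (simp add: has_E_reflected cond_R0_def cond_R1_def alpha1_def alpha3_def inf_of_uminus algebra_simps)
qed

lemma alpha2_reflected: "alpha2 (\<lambda>x. - \<omega> x) l (- \<gamma>) = alpha4 \<omega> l \<gamma>"
  by (simp add: alpha2_def alpha4_def inf_of_uminus sup_of_uminus algebra_simps)

lemma has_F_if_gt_alpha4: "alpha4 \<omega> l \<gamma> < \<alpha> \<Longrightarrow> has_F"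
proof -
  interpret r: matrix_model_nontrivial "\<lambda>x. - \<omega> x" l "- \<gamma>" \<alpha>
    by (rule reflected)
  show "alpha4 \<omega> l \<gamma> < \<alpha> \<Longrightarrow> has_F"
    using r.has_E_if_gt_alpha2 by (simp add: has_E_reflected alpha2_reflected)
qed

lemma le_alpha4_iff_F:
  assumes has_F
  shows "\<alpha> \<le> alpha4 \<omega> l \<gamma> \<longleftrightarrow> w0 + F \<le> 2 * w1 + \<gamma>"
proof -
  interpret r: matrix_model_nontrivial "\<lambda>x. - \<omega> x" l "- \<gamma>" \<alpha>
    by (rule reflected)
  show ?thesis
    using r.le_alpha2_iff_E[unfolded has_E_reflected, OF assms] zero_E_reflected[OF assms]
    by (auto simp: alpha2_reflected inf_of_uminus sup_of_uminus)
qed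

lemma Phi_bounded_away_right:
  assumes "2 * w1 + \<gamma> < z" "has_F \<Longrightarrow> z < w0 + F \<or> w1 + F < z"
  shows "\<exists>c>0. \<forall>k. c \<le> \<bar>\<Phi> (z - \<omega> k)\<bar>"
proof -
  interpret r: matrix_model_nontrivial "\<lambda>x. - \<omega> x" l "- \<gamma>" \<alpha>
    by (rule reflected)
  have "\<exists>c>0. \<forall>k. c \<le> \<bar>Phi (\<lambda>x. - \<omega> x) l (- \<gamma>) \<alpha> (- z - - \<omega> k)\<bar>"
    by (rule r.Phi_bounded_away_left)
      (use assms zero_E_reflected in \<open>auto simp: has_E_reflected inf_of_uminus sup_of_uminus\<close>)
  then show ?thesis
    by (simp add: Phi_uminus)
qed

text \<open>\<open>shifted_zero_in_spectrum\<close> asks only for a positive distance of the zero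
  from the values of \<open>\<omega> q + \<gamma>\<close>, so it serves on this side without
  reflection.\<close>

lemma I_F_in_essential_spectrum:
  assumes has_F "w0 + F \<le> z" "z \<le> w1 + F"
  shows "of_real z \<in> essential_spectrum T"
proof (rule interval_in_essential_spectrum[of "w0 + F" "w1 + F"])
  note F = zero_F[OF assms(1)]
  have *: "F - w1 - \<gamma> \<le> \<bar>\<omega> q + \<gamma> - F\<bar>" for q
    using le_w1[of q] by linarith
  fix x assume "w0 + F \<le> x" "x \<le> w1 + F"
  then show "of_real x \<in> spectrum T"
    using shifted_zero_in_spectrum[OF _ * F(2)] F(1) by simp
qed (use assms w0_less_w1 in auto)

theorem essential_spectrum_eq:
  "essential_spectrum T = of_real ` ((if has_E then {w0 + E..w1 + E} else {}) \<union>
     {2 * w0 + \<gamma>..2 * w1 + \<gamma>} \<union> (if has_F then {w0 + F..w1 + F} else {}))"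
  (is "_ = of_real ` ?S")
proof (intro equalityI subsetI)
  fix w assume w: "w \<in> essential_spectrum T"
  then have "w \<in> spectrum T"
    by (simp add: essential_spectrum_def)
  define z where "z = Re w"
  have wz: "w = of_real z"
    using spectrum_real[OF \<open>w \<in> spectrum T\<close>] by (simp add: z_def complex_eq_iff)
  have "z \<in> ?S"
  proof (rule ccontr)
    assume z: "z \<notin> ?S"
    \<comment> \<open>Here s ranges over the whole interval and not only over values of \<omega>, as
      the finite net in \<open>semi_fredholm\<close> is taken there.\<close>
    have *: "\<exists>\<delta>>0. \<forall>s q. w0 \<le> s \<longrightarrow> s \<le> w1 \<longrightarrow> \<delta> \<le> \<bar>\<gamma> + s + \<omega> q - z\<bar>"
      and **: "\<exists>c>0. \<forall>k. c \<le> \<bar>\<Phi> (z - \<omega> k)\<bar>"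
    proof -
      consider "z < 2 * w0 + \<gamma>" | "2 * w1 + \<gamma> < z"
        using z by auto
      then show "\<exists>\<delta>>0. \<forall>s q. w0 \<le> s \<longrightarrow> s \<le> w1 \<longrightarrow> \<delta> \<le> \<bar>\<gamma> + s + \<omega> q - z\<bar>"
      proof cases
        case 1
        have "2 * w0 + \<gamma> - z \<le> \<bar>\<gamma> + s + \<omega> q - z\<bar>" if "w0 \<le> s" for s q
          using that w0_le[of q] by linarith
        then show ?thesis
          using 1 by (intro exI[of _ "2 * w0 + \<gamma> - z"]) auto
      next
        case 2
        have "z - 2 * w1 - \<gamma> \<le> \<bar>\<gamma> + s + \<omega> q - z\<bar>" if "s \<le> w1" for s q
          using that le_w1[of q] by linarith
        then show ?thesis
          using 2 by (intro exI[of _ "z - 2 * w1 - \<gamma>"]) auto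
      qed
      show "\<exists>c>0. \<forall>k. c \<le> \<bar>\<Phi> (z - \<omega> k)\<bar>"
      proof (cases "z < 2 * w0 + \<gamma>")
        case True
        then show ?thesis
          by (rule Phi_bounded_away_left) (use z in auto)
      next
        case False
        with z have "2 * w1 + \<gamma> < z" by auto
        then show ?thesis
          by (rule Phi_bounded_away_right) (use z in auto)
      qed
    qed
    then show False
      using semi_fredholm[of _ z] not_in_essential_spectrum w unfolding wz by blast
  qed
  then show "w \<in> of_real ` ?S"
    unfolding wz by blast
next
  fix w :: complex assume "w \<in> of_real ` ?S"
  then show "w \<in> essential_spectrum T"
    by (auto simp: I_D_in_essential_spectrum intro: I_E_in_essential_spectrum I_F_in_essential_spectrum split: if_splits)
qed

end

section \<open>The case distinction\<close>

text \<open>Ranges of \<alpha> are cut by \<open>min\<close> and \<open>max\<close> where thresholds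
  of the two pairs meet. Joining all three intervals requires both \<open>\<alpha> \<le> a2\<close>
  and \<open>\<alpha> \<le> a4\<close>, absence of a zero requires \<open>\<alpha> \<le> a1\<close>
  or \<open>\<alpha> \<le> a3\<close>, and no order between the pairs guarantees one from the other.
  A coupling removed by a cut and not met by another clause is still described by
  \<open>essential_spectrum_eq\<close>.\<close>

theorem theorem2p1:
  fixes \<omega> :: "real ^ 'd \<Rightarrow> real" and l :: "real ^ 'd \<Rightarrow> complex" and \<gamma> \<alpha> :: real
  defines "w0 \<equiv> inf_of \<omega>" and "w1 \<equiv> sup_of \<omega>"
    and "R0 \<equiv> cond_R0 \<omega> l" and "R1 \<equiv> cond_R1 \<omega> l"
    and "E \<equiv> zero_E \<omega> l \<gamma> \<alpha>" and "F \<equiv> zero_F \<omega> l \<gamma> \<alpha>"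
    and "a1 \<equiv> alpha1 \<omega> l \<gamma>" and "a2 \<equiv> alpha2 \<omega> l \<gamma>"
    and "a3 \<equiv> alpha3 \<omega> l \<gamma>" and "a4 \<equiv> alpha4 \<omega> l \<gamma>"
  defines "I_E \<equiv> {w0 + E..w1 + E}"
    and "I_D \<equiv> {2 * w0 + \<gamma>..2 * w1 + \<gamma>}"
    and "I_F \<equiv> {w0 + F..w1 + F}"
    and "\<sigma> \<equiv> essential_spectrum (op_matrix \<omega> l \<gamma> \<alpha>)"
  assumes "\<And>k. 0 \<le> \<omega> k" and "\<not> \<omega> constant_on UNIV" and "bounded (range \<omega>)"
    and "continuous_on UNIV \<omega>"
    and "l \<in> L2" and "\<not> (AE q in lborel. l q = 0)"
    and "0 < \<alpha>"
  shows
   "(\<not> R0 \<and> \<not> R1 \<longrightarrow>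
     ((\<gamma> \<in> {..w0 / 2 - w1} \<longrightarrow>
        ((\<alpha> \<in> {0<..a2} \<longrightarrow> \<sigma> = of_real ` ({w0 + E..2 * w1 + \<gamma>} \<union> I_F)) \<and>
         (\<alpha> \<in> {a2<..} \<longrightarrow> \<sigma> = of_real ` (I_E \<union> I_D \<union> I_F)))) \<and>
      (\<gamma> \<in> {w0 / 2 - w1<..w1 / 2 - w0} \<longrightarrow>
        ((\<alpha> \<in> {0<..min a2 a4} \<longrightarrow> \<sigma> = of_real ` {w0 + E..w1 + F}) \<and>
         (\<alpha> \<in> {a2<..a4} \<longrightarrow> \<sigma> = of_real ` (I_E \<union> {2 * w0 + \<gamma>..w1 + F})) \<and>
         (\<alpha> \<in> {a4<..} \<longrightarrow> \<sigma> = of_real ` (I_E \<union> I_D \<union> I_F)))) \<and>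
      (\<gamma> \<in> {w1 / 2 - w0<..} \<longrightarrow>
        ((\<alpha> \<in> {0<..a4} \<longrightarrow> \<sigma> = of_real ` (I_E \<union> {2 * w0 + \<gamma>..w1 + F})) \<and>
         (\<alpha> \<in> {a4<..} \<longrightarrow> \<sigma> = of_real ` (I_E \<union> I_D \<union> I_F)))))) \<and>
    (R0 \<and> \<not> R1 \<longrightarrow>
     ((\<gamma> \<in> {..w0 / 2 - w1} \<longrightarrow>
        ((\<alpha> \<in> {0<..a1} \<longrightarrow> \<sigma> = of_real ` (I_D \<union> I_F)) \<and>
         (\<alpha> \<in> {a1<..a2} \<longrightarrow> \<sigma> = of_real ` ({w0 + E..2 * w1 + \<gamma>} \<union> I_F)) \<and>
         (\<alpha> \<in> {a2<..} \<longrightarrow> \<sigma> = of_real ` (I_E \<union> I_D \<union> I_F)))) \<and>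
      (\<gamma> \<in> {w0 / 2 - w1<..- w0 / 2} \<longrightarrow>
        ((\<alpha> \<in> {0<..min a1 a4} \<longrightarrow> \<sigma> = of_real ` {2 * w0 + \<gamma>..w1 + F}) \<and>
         (\<alpha> \<in> {a1<..min a2 a4} \<longrightarrow> \<sigma> = of_real ` {w0 + E..w1 + F}) \<and>
         (\<alpha> \<in> {a2<..a4} \<longrightarrow> \<sigma> = of_real ` (I_E \<union> {2 * w0 + \<gamma>..w1 + F})) \<and>
         (\<alpha> \<in> {max a1 a4<..} \<longrightarrow> \<sigma> = of_real ` (I_E \<union> I_D \<union> I_F)))) \<and>
      (\<gamma> \<in> {- w0 / 2<..w1 / 2 - w0} \<longrightarrow>
        ((\<alpha> \<in> {0<..min a2 a4} \<longrightarrow> \<sigma> = of_real ` {w0 + E..w1 + F}) \<and>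
         (\<alpha> \<in> {a2<..a4} \<longrightarrow> \<sigma> = of_real ` (I_E \<union> {2 * w0 + \<gamma>..w1 + F})) \<and>
         (\<alpha> \<in> {a4<..} \<longrightarrow> \<sigma> = of_real ` (I_E \<union> I_D \<union> I_F)))) \<and>
      (\<gamma> \<in> {w1 / 2 - w0<..} \<longrightarrow>
        ((\<alpha> \<in> {0<..a4} \<longrightarrow> \<sigma> = of_real ` (I_E \<union> {2 * w0 + \<gamma>..w1 + F})) \<and>
         (\<alpha> \<in> {a4<..} \<longrightarrow> \<sigma> = of_real ` (I_E \<union> I_D \<union> I_F)))))) \<and>
    (\<not> R0 \<and> R1 \<longrightarrow>
     ((\<gamma> \<in> {..w0 / 2 - w1} \<longrightarrow>
        ((\<alpha> \<in> {0<..a2} \<longrightarrow> \<sigma> = of_real ` ({w0 + E..2 * w1 + \<gamma>} \<union> I_F)) \<and>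
         (\<alpha> \<in> {a2<..} \<longrightarrow> \<sigma> = of_real ` (I_E \<union> I_D \<union> I_F)))) \<and>
      (\<gamma> \<in> {w0 / 2 - w1<..- w1 / 2} \<longrightarrow>
        ((\<alpha> \<in> {0<..min a2 a4} \<longrightarrow> \<sigma> = of_real ` {w0 + E..w1 + F}) \<and>
         (\<alpha> \<in> {a2<..a4} \<longrightarrow> \<sigma> = of_real ` (I_E \<union> {2 * w0 + \<gamma>..w1 + F})) \<and>
         (\<alpha> \<in> {a4<..} \<longrightarrow> \<sigma> = of_real ` (I_E \<union> I_D \<union> I_F)))) \<and>
      (\<gamma> \<in> {- w1 / 2<..w1 / 2 - w0} \<longrightarrow>
        ((\<alpha> \<in> {0<..min a2 a3} \<longrightarrow> \<sigma> = of_real ` {w0 + E..2 * w1 + \<gamma>}) \<and>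
         (\<alpha> \<in> {a2<..a3} \<longrightarrow> \<sigma> = of_real ` (I_E \<union> I_D)) \<and>
         (\<alpha> \<in> {a3<..a4} \<longrightarrow> \<sigma> = of_real ` (I_E \<union> {2 * w0 + \<gamma>..w1 + F})) \<and>
         (\<alpha> \<in> {a4<..} \<longrightarrow> \<sigma> = of_real ` (I_E \<union> I_D \<union> I_F)))) \<and>
      (\<gamma> \<in> {w1 / 2 - w0<..} \<longrightarrow>
        ((\<alpha> \<in> {0<..a3} \<longrightarrow> \<sigma> = of_real ` (I_E \<union> I_D)) \<and>
         (\<alpha> \<in> {a3<..a4} \<longrightarrow> \<sigma> = of_real ` (I_E \<union> {2 * w0 + \<gamma>..w1 + F})) \<and>
         (\<alpha> \<in> {a4<..} \<longrightarrow> \<sigma> = of_real ` (I_E \<union> I_D \<union> I_F)))))) \<and>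
    (R0 \<and> R1 \<longrightarrow>
     ((\<gamma> \<in> {..w0 / 2 - w1} \<longrightarrow>
        ((\<alpha> \<in> {0<..a1} \<longrightarrow> \<sigma> = of_real ` (I_D \<union> I_F)) \<and>
         (\<alpha> \<in> {a1<..a2} \<longrightarrow> \<sigma> = of_real ` ({w0 + E..2 * w1 + \<gamma>} \<union> I_F)) \<and>
         (\<alpha> \<in> {a2<..} \<longrightarrow> \<sigma> = of_real ` (I_E \<union> I_D \<union> I_F)))) \<and>
      (\<gamma> \<in> {w0 / 2 - w1<..- w1 / 2} \<longrightarrow>
        ((\<alpha> \<in> {0<..min a1 a4} \<longrightarrow> \<sigma> = of_real ` {2 * w0 + \<gamma>..w1 + F}) \<and>
         (\<alpha> \<in> {a1<..min a2 a4} \<longrightarrow> \<sigma> = of_real ` {w0 + E..w1 + F}) \<and>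
         (\<alpha> \<in> {a2<..a4} \<longrightarrow> \<sigma> = of_real ` (I_E \<union> {2 * w0 + \<gamma>..w1 + F})) \<and>
         (\<alpha> \<in> {max a1 a4<..} \<longrightarrow> \<sigma> = of_real ` (I_E \<union> I_D \<union> I_F)))) \<and>
      (\<gamma> \<in> {- w1 / 2<..- w0 / 2} \<longrightarrow>
        ((\<alpha> \<in> {0<..min a1 a3} \<longrightarrow> \<sigma> = of_real ` I_D) \<and>
         (\<alpha> \<in> {a1<..min a2 a3} \<longrightarrow> \<sigma> = of_real ` {w0 + E..2 * w1 + \<gamma>}) \<and>
         (\<alpha> \<in> {a2<..a3} \<longrightarrow> \<sigma> = of_real ` (I_E \<union> I_D)) \<and>
         (\<alpha> \<in> {max a1 a3<..a4} \<longrightarrow> \<sigma> = of_real ` (I_E \<union> {2 * w0 + \<gamma>..w1 + F})) \<and>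
         (\<alpha> \<in> {max a1 a4<..} \<longrightarrow> \<sigma> = of_real ` (I_E \<union> I_D \<union> I_F)))) \<and>
      (\<gamma> \<in> {- w0 / 2<..w1 / 2 - w0} \<longrightarrow>
        ((\<alpha> \<in> {0<..min a2 a3} \<longrightarrow> \<sigma> = of_real ` {w0 + E..2 * w1 + \<gamma>}) \<and>
         (\<alpha> \<in> {a2<..a3} \<longrightarrow> \<sigma> = of_real ` (I_E \<union> I_D)) \<and>
         (\<alpha> \<in> {a3<..a4} \<longrightarrow> \<sigma> = of_real ` (I_E \<union> {2 * w0 + \<gamma>..w1 + F})) \<and>
         (\<alpha> \<in> {a4<..} \<longrightarrow> \<sigma> = of_real ` (I_E \<union> I_D \<union> I_F)))) \<and>
      (\<gamma> \<in> {w1 / 2 - w0<..} \<longrightarrow>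
        ((\<alpha> \<in> {0<..a3} \<longrightarrow> \<sigma> = of_real ` (I_E \<union> I_D)) \<and>
         (\<alpha> \<in> {a3<..a4} \<longrightarrow> \<sigma> = of_real ` (I_E \<union> {2 * w0 + \<gamma>..w1 + F})) \<and>
         (\<alpha> \<in> {a4<..} \<longrightarrow> \<sigma> = of_real ` (I_E \<union> I_D \<union> I_F))))))"
proof -
  interpret mm: matrix_model_nontrivial \<omega> l \<gamma> \<alpha>
    by unfold_locales (use assms in auto)
  have w: "w0 < w1"
    using mm.w0_less_w1 by (simp add: w0_def w1_def)
  have E: "w0 + E < 2 * w0 + \<gamma>" if mm.has_E
    using mm.zero_E[OF that] by (simp add: w0_def E_def)
  have F: "2 * w1 + \<gamma> < w1 + F" if mm.has_F
    using mm.zero_F[OF that] by (simp add: w1_def F_def)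
  have has_E: "mm.has_E \<longleftrightarrow> \<not> R0 \<or> a1 < \<alpha>"
    using mm.not_has_E_iff by (auto simp: R0_def a1_def)
  have has_F: "mm.has_F \<longleftrightarrow> \<not> R1 \<or> a3 < \<alpha>"
    using mm.not_has_F_iff by (auto simp: R1_def a3_def)
  \<comment> \<open>For ranges bounded below by a2 or a4 alone, the existence of the zero is
    obtained from that bound instead of a1 or a3.\<close>
  have gt: "a2 < \<alpha> \<Longrightarrow> mm.has_E" "a4 < \<alpha> \<Longrightarrow> mm.has_F"
    using mm.has_E_if_gt_alpha2 mm.has_F_if_gt_alpha4 by (auto simp: a2_def a4_def)
  have le2: "2 * w0 + \<gamma> \<le> w1 + E" if mm.has_E "\<alpha> \<le> a2"
    using mm.le_alpha2_iff_E[OF that(1)] that(2) by (simp add: a2_def w0_def w1_def E_def)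
  have le4: "w0 + F \<le> 2 * w1 + \<gamma>" if mm.has_F "\<alpha> \<le> a4"
    using mm.le_alpha4_iff_F[OF that(1)] that(2) by (simp add: a4_def w0_def w1_def F_def)
  \<comment> \<open>The radicands are nonpositive here and \<open>sqrt\<close> is odd, so these
    thresholds are at most 0 and every positive \<alpha> lies above them.\<close>
  have neg: "- w0 / 2 < \<gamma> \<Longrightarrow> a1 \<le> 0" "w1 / 2 - w0 < \<gamma> \<Longrightarrow> a2 \<le> 0"
    "\<gamma> \<le> - w1 / 2 \<Longrightarrow> a3 \<le> 0" "\<gamma> \<le> w0 / 2 - w1 \<Longrightarrow> a4 \<le> 0"
    by (auto simp: a1_def a2_def a3_def a4_def alpha1_def alpha2_def alpha3_def alpha4_def
        w0_def w1_def intro!: divide_nonpos_nonneg)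
  have \<sigma>: "\<sigma> = of_real ` ((if mm.has_E then I_E else {}) \<union> I_D \<union> (if mm.has_F then I_F else {}))"
    unfolding \<sigma>_def mm.essential_spectrum_eq
    by (simp add: I_E_def I_D_def I_F_def w0_def w1_def E_def F_def)
  note I = I_E_def I_D_def I_F_def
  have EDF: "\<sigma> = of_real ` (I_E \<union> I_D \<union> I_F)" if mm.has_E mm.has_F
    using that by (simp add: \<sigma>)
  have ED: "\<sigma> = of_real ` (I_E \<union> I_D)" if mm.has_E "\<not> mm.has_F"
    using that by (simp add: \<sigma>)
  have DF: "\<sigma> = of_real ` (I_D \<union> I_F)" if "\<not> mm.has_E" mm.has_F
    using that by (simp add: \<sigma>)
  have D: "\<sigma> = of_real ` I_D" if "\<not> mm.has_E" "\<not> mm.has_F"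
    using that by (simp add: \<sigma>)
  \<comment> \<open>The left end of \<open>I_E\<close> lies below that of \<open>I_D\<close> by
    \<open>E\<close>, and its right end reaches \<open>I_D\<close> by \<open>le2\<close>, so no gap
    remains.\<close>
  have E_D: "I_E \<union> I_D = {w0 + E..2 * w1 + \<gamma>}" if mm.has_E "\<alpha> \<le> a2"
    using E[OF that(1)] le2[OF that] w by (auto simp: I)
  have D_F: "I_D \<union> I_F = {2 * w0 + \<gamma>..w1 + F}" if mm.has_F "\<alpha> \<le> a4"
    using F[OF that(1)] le4[OF that] w by (auto simp: I)
  have EDxF: "\<sigma> = of_real ` ({w0 + E..2 * w1 + \<gamma>} \<union> I_F)" if mm.has_E mm.has_F "\<alpha> \<le> a2"
    using EDF E_D that by simp
  have ExDF: "\<sigma> = of_real ` (I_E \<union> {2 * w0 + \<gamma>..w1 + F})" if mm.has_E mm.has_F "\<alpha> \<le> a4"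
    using EDF D_F that by (simp add: Un_assoc)
  have EDF_joined: "\<sigma> = of_real ` {w0 + E..w1 + F}" if mm.has_E mm.has_F "\<alpha> \<le> a2" "\<alpha> \<le> a4"
  proof -
    have "{w0 + E..2 * w1 + \<gamma>} \<union> I_F = {w0 + E..w1 + F}"
      using E F le2 le4 that w by (auto simp: I)
    then show ?thesis using EDxF that by simp
  qed
  have ED_joined: "\<sigma> = of_real ` {w0 + E..2 * w1 + \<gamma>}" if mm.has_E "\<not> mm.has_F" "\<alpha> \<le> a2"
    using ED E_D that by simp
  have DF_joined: "\<sigma> = of_real ` {2 * w0 + \<gamma>..w1 + F}" if "\<not> mm.has_E" mm.has_F "\<alpha> \<le> a4"
    using DF D_F that by simp
  note order = w neg gt[unfolded has_E has_F]
  show ?thesis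
    \<comment> \<open>The form of the set in each clause selects one rule; only its conditions on
      the existence of the zeros and on the thresholds are left, and these follow from
      \<open>order\<close> and the range of \<alpha>.\<close>
    by (intro conjI impI;
      (rule EDxF EDF_joined ExDF DF_joined ED_joined EDF ED DF D);
      (insert order, (unfold has_E has_F)?, use \<open>0 < \<alpha>\<close> in force))
qed

end
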